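(* Let $(\pi,\mathcal{L})$ be a submersion between the spray manifolds $(\overline{M},\overline{\mathbf{G}})$ and $(M,\mathbf{G})$. Let $c(t)$, $t\in(a,b)$, be a smooth curve on $M$ with nowhere-vanishing $\dot c(t)$, and $\overline{c}(t)$ a lifting of $c(t)$ tangent to $\mathcal{L}$, where the interval $(a,b)$ is sufficiently small so that $N=\cup_{t\in(a,b)}(T_{c(t)}M\backslash\{0\})$, $\overline{N}=\cup_{t\in(a,b)}(T_{\overline{c}(t)}\overline{M}\backslash\{0\})$ and $N_\mathcal{L}=\cup_{t\in(a,b)}(\mathcal{L}_{\overline{c}(t)}\backslash\{0\})$ are imbedded submanifolds in $TM\backslash0$, $T\overline{M}\backslash0$ and $\overline{N}$ respectively and $\Phi^{N_\mathcal{L}}_N=\pi_*|_{N_\mathcal{L}}:N_\mathcal{L}\to N$ is a diffeomorphism. Then $$\Phi^{T(T\overline{M})|_{\mathcal{L}}}_{T\mathcal{L}}\left(\widetilde{\dot{\overline{c}}(t)}^{\overline{\mathcal{H}}}|_{N_\mathcal{L}}\right)=((\Phi_{N}^{N_\mathcal{L}})^{-1})_*\left(\widetilde{\dot{c}(t)}^{\mathcal{H}}\right).$$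
   Context: A spray structure on a smooth manifold $M$ is a smooth tangent vector field $\mathbf{G}$ on the slit tangent bundle $TM\backslash 0$ which, in every standard local coordinate $(x^i,y^j)$ (i.e. $x=(x^i)\in M$, $y=y^j\partial_{x^j}\in T_xM$), has the form $\mathbf{G}=y^i\partial_{x^i}-2\mathbf{G}^i\partial_{y^i}$, where $\mathbf{G}^i(x,\lambda y)=\lambda^2\mathbf{G}^i(x,y)$ for all $\lambda>0$. Put $\mathbf{N}^i_j=\frac{\partial}{\partial y^j}\mathbf{G}^i$ and $\delta_{x^i}=\partial_{x^i}-\mathbf{N}^j_i\partial_{y^j}$. A geodesic is a smooth curve $c(t)$ with nowhere-vanishing $\dot c(t)$ such that $(c(t),\dot c(t))$ is an integral curve of $\mathbf{G}$. The horizonal lifting of $v=a^i\partial_{x^i}\in T_xM$ at $(x,y)$, $y\neq0$, is $\widetilde{v}^{\mathcal{H}}=a^i\delta_{x^i}\in T_{(x,y)}(TM\backslash0)$ (coordinate independent). For a curve $c(t)$ on $M$, $\widetilde{\dot c(t)}^{\mathcal{H}}$ denotes the vector field on $\cup_t(T_{c(t)}M\backslash\{0\})$ whose value at each $(c(t),y)$ is the horizonal lifting of $\dot c(t)$ there. The same notions for $\overline{\mathbf{G}}$ on $\overline{M}$ are marked by bars ($\overline{\mathcal{H}}$ etc.). Submersion between spray structures: $\pi:\overline{M}\to M$ is a smooth submersion of manifolds, $\overline{\mathbf{G}}$, $\mathbf{G}$ are spray structures on $\overline{M}$, $M$, and $\mathcal{L}\subset T\overline{M}$ is a distribution (smooth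 linear subbundle) each of whose fibers $\mathcal{L}_{\overline{p}}$ is a linear complement of $\ker(\pi_*|_{\overline{p}})$ in $T_{\overline{p}}\overline{M}$. The pair $(\pi,\mathcal{L})$ is a submersion between $\overline{\mathbf{G}}$ and $\mathbf{G}$ if (1) $\overline{\mathbf{G}}|_{\mathcal{L}\backslash0}$ is tangent to $\mathcal{L}\backslash0$ everywhere; (2) for any geodesic $\overline{c}(t)$ of $\overline{\mathbf{G}}$ with $(\overline{c}(t),\dot{\overline{c}}(t))\in\mathcal{L}\backslash0$, $\pi(\overline{c}(t))$ is a geodesic of $\mathbf{G}$. $\overline{c}(t)$ is a lifting of $c(t)$ tangent to $\mathcal{L}$ if $\pi(\overline{c}(t))=c(t)$ and $\dot{\overline{c}}(t)\in\mathcal{L}_{\overline{c}(t)}$ for all $t$. Bundle maps: $\Phi^{T\overline{M}}_{\mathcal{L}}:T\overline{M}\to\mathcal{L}$ is, fiberwise, the linear projection onto $\mathcal{L}_{\overline{p}}$ with kernel $\ker(\pi_*|_{\overline{p}})$; $\Phi^{T(T\overline{M})|_{\mathcal{L}}}_{T\mathcal{L}}:T(T\overline{M})|_{\mathcal{L}}\to T\mathcal{L}$ is the restriction of the tangent map $(\Phi^{T\overline{M}}_{\mathcal{L}})_*:T(T\overline{M})\to T\mathcal{L}$ to $T(T\overline{M})|_{\mathcal{L}}$. *)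

theory Defs
  imports "HOL-Analysis.Analysis" "HOL-Library.FuncSet"
begin

section \<open>Smooth maps between Euclidean spaces\<close>

fun ck_on :: "nat \<Rightarrow> 'e::euclidean_space set \<Rightarrow> ('e \<Rightarrow> 'f::euclidean_space) \<Rightarrow> bool" where
  "ck_on 0 S f \<longleftrightarrow> continuous_on S f"
| "ck_on (Suc k) S f \<longleftrightarrow> (\<forall>x\<in>S. f differentiable (at x)) \<and>
     (\<forall>v. ck_on k S (\<lambda>x. frechet_derivative f (at x) v))"

text \<open>Only used for open \<open>S\<close>.\<close>

definition smooth_on :: "'e::euclidean_space set \<Rightarrow> ('e \<Rightarrow> 'f::euclidean_space) \<Rightarrow> bool" where
  "smooth_on S f \<longleftrightarrow> (\<forall>k. ck_on k S f)"


section \<open>Manifolds\<close>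

text \<open>A chart is a pair of a domain and a coordinate map; values of the coordinate map outside the
  domain are irrelevant. A manifold is given by an atlas, which need not be maximal; the point set
  and the topology are read off from the atlas. The dimension is that of the model space \<open>'e\<close>.\<close>

type_synonym ('a, 'e) chart = "'a set \<times> ('a \<Rightarrow> 'e)"
type_synonym ('a, 'e) atlas = "('a, 'e) chart set"

abbreviation dom_of :: "('a, 'e) chart \<Rightarrow> 'a set" where "dom_of c \<equiv> fst c"
abbreviation coord :: "('a, 'e) chart \<Rightarrow> 'a \<Rightarrow> 'e" where "coord c \<equiv> snd c"

definition param :: "('a, 'e) chart \<Rightarrow> 'e \<Rightarrow> 'a" where
  "param c = inv_into (dom_of c) (coord c)"

definition local_rep :: "('a, 'e) chart \<Rightarrow> ('b, 'f) chart \<Rightarrow> ('a \<Rightarrow> 'b) \<Rightarrow> 'e \<Rightarrow> 'f" where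
  "local_rep c d f = (\<lambda>x. coord d (f (param c x)))"

definition points :: "('a, 'e) atlas \<Rightarrow> 'a set" where
  "points A = (\<Union>c\<in>A. dom_of c)"

definition atlas_topology :: "('a, 'e::euclidean_space) atlas \<Rightarrow> 'a topology" where
  "atlas_topology A =
     topology_generated_by {dom_of c \<inter> coord c -` V | c V. c \<in> A \<and> open V}"

definition smooth_atlas :: "('a, 'e::euclidean_space) atlas \<Rightarrow> bool" where
  "smooth_atlas A \<longleftrightarrow>
     (\<forall>c\<in>A. inj_on (coord c) (dom_of c)) \<and>
     (\<forall>c\<in>A. \<forall>d\<in>A. open (coord c ` (dom_of c \<inter> dom_of d)) \<and>
        smooth_on (coord c ` (dom_of c \<inter> dom_of d)) (local_rep c d (\<lambda>p. p)))"

definition manifold :: "('a, 'e::euclidean_space) atlas \<Rightarrow> bool" where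
  "manifold A \<longleftrightarrow> smooth_atlas A \<and>
     Hausdorff_space (atlas_topology A) \<and> second_countable (atlas_topology A)"

definition open_submanifold :: "('a, 'e) atlas \<Rightarrow> 'a set \<Rightarrow> ('a, 'e) atlas" where
  "open_submanifold A W = (\<lambda>c. (dom_of c \<inter> W, coord c)) ` A"

definition smooth_map ::
  "('a, 'e::euclidean_space) atlas \<Rightarrow> ('b, 'f::euclidean_space) atlas \<Rightarrow> ('a \<Rightarrow> 'b) \<Rightarrow> bool" where
  "smooth_map A B f \<longleftrightarrow> continuous_map (atlas_topology A) (atlas_topology B) f \<and>
     (\<forall>c\<in>A. \<forall>d\<in>B. smooth_on (coord c ` (dom_of c \<inter> f -` dom_of d)) (local_rep c d f))"

definition diffeomorphism ::
  "('a, 'e::euclidean_space) atlas \<Rightarrow> ('b, 'f::euclidean_space) atlas \<Rightarrow> ('a \<Rightarrow> 'b) \<Rightarrow> bool" where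
  "diffeomorphism A B f \<longleftrightarrow> bij_betw f (points A) (points B) \<and>
     smooth_map A B f \<and> smooth_map B A (inv_into (points A) f)"


section \<open>Tangent vectors and tangent maps\<close>

text \<open>A tangent vector at \<open>p\<close> is the pair of \<open>p\<close> and the family of its components in all charts of
  the atlas around \<open>p\<close>, subject to the transformation law; the components in all other charts are
  set to \<open>0\<close>.\<close>

type_synonym ('a, 'e) tangent = "'a \<times> (('a, 'e) chart \<Rightarrow> 'e)"

abbreviation base :: "('a, 'e) tangent \<Rightarrow> 'a" where "base u \<equiv> fst u"
abbreviation comp_in :: "('a, 'e) tangent \<Rightarrow> ('a, 'e) chart \<Rightarrow> 'e" where "comp_in u \<equiv> snd u"

definition tangent_space :: "('a, 'e::euclidean_space) atlas \<Rightarrow> 'a \<Rightarrow> ('a, 'e) tangent set" where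
  "tangent_space A p = {u. base u = p \<and> p \<in> points A \<and>
     (\<forall>c\<in>A. \<forall>d\<in>A. p \<in> dom_of c \<and> p \<in> dom_of d \<longrightarrow>
        comp_in u d = frechet_derivative (local_rep c d (\<lambda>q. q)) (at (coord c p)) (comp_in u c)) \<and>
     (\<forall>c. \<not> (c \<in> A \<and> p \<in> dom_of c) \<longrightarrow> comp_in u c = 0)}"

text \<open>The tangent vector \<open>a\<^sup>i \<partial>\<^sub>x\<^sub>i\<close> at \<open>p\<close>, where \<open>x\<close> are the coordinates of the chart \<open>c\<close>.\<close>

definition coord_vector ::
  "('a, 'e::euclidean_space) atlas \<Rightarrow> ('a, 'e) chart \<Rightarrow> 'a \<Rightarrow> 'e \<Rightarrow> ('a, 'e) tangent" where
  "coord_vector A c p a = (p, \<lambda>d. if d \<in> A \<and> p \<in> dom_of d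
     then frechet_derivative (local_rep c d (\<lambda>q. q)) (at (coord c p)) a else 0)"

definition tangent_zero :: "'a \<Rightarrow> ('a, 'e::euclidean_space) tangent" where
  "tangent_zero p = (p, \<lambda>c. 0)"

definition tangent_add ::
  "('a, 'e::euclidean_space) tangent \<Rightarrow> ('a, 'e) tangent \<Rightarrow> ('a, 'e) tangent" where
  "tangent_add u v = (base u, \<lambda>c. comp_in u c + comp_in v c)"

text \<open>The natural charts of \<open>TM\<close> have coordinates \<open>(x, y)\<close>. As \<open>tangent_bundle\<close> is again an atlas,
  \<open>T(TM)\<close> is obtained by iteration; its charts are modelled on \<open>('e \<times> 'e) \<times> ('e \<times> 'e)\<close>, with
  coordinates \<open>((x, y), (dx, dy))\<close>.\<close>

definition tangent_chart ::
  "('a, 'e::euclidean_space) atlas \<Rightarrow> ('a, 'e) chart \<Rightarrow> (('a, 'e) tangent, 'e \<times> 'e) chart" where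
  "tangent_chart A c =
     ((\<Union>p\<in>dom_of c. tangent_space A p), \<lambda>u. (coord c (base u), comp_in u c))"

definition tangent_bundle ::
  "('a, 'e::euclidean_space) atlas \<Rightarrow> (('a, 'e) tangent, 'e \<times> 'e) atlas" where
  "tangent_bundle A = tangent_chart A ` A"

abbreviation nonzero_vectors :: "('a, 'e::euclidean_space) tangent set" where
  "nonzero_vectors \<equiv> {u. u \<noteq> tangent_zero (base u)}"

definition slit_bundle ::
  "('a, 'e::euclidean_space) atlas \<Rightarrow> (('a, 'e) tangent, 'e \<times> 'e) atlas" where
  "slit_bundle A = open_submanifold (tangent_bundle A) nonzero_vectors"

definition chart_at :: "('a, 'e) atlas \<Rightarrow> 'a \<Rightarrow> ('a, 'e) chart" where
  "chart_at A p = (SOME c. c \<in> A \<and> p \<in> dom_of c)"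

text \<open>For \<open>f\<close> smooth near \<open>base u\<close> the result does not depend on the chart chosen.\<close>

definition tangent_map ::
  "('a, 'e::euclidean_space) atlas \<Rightarrow> ('b, 'f::euclidean_space) atlas \<Rightarrow> ('a \<Rightarrow> 'b) \<Rightarrow>
   ('a, 'e) tangent \<Rightarrow> ('b, 'f) tangent" where
  "tangent_map A B f u = (let p = base u; c = chart_at A p in
     (f p, \<lambda>d. if d \<in> B \<and> f p \<in> dom_of d
        then frechet_derivative (local_rep c d f) (at (coord c p)) (comp_in u c) else 0))"

definition embedded_submanifold ::
  "('a, 'k::euclidean_space) atlas \<Rightarrow> ('a, 'e::euclidean_space) atlas \<Rightarrow> bool" where
  "embedded_submanifold B A \<longleftrightarrow> manifold B \<and> points B \<subseteq> points A \<and>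
     smooth_map B A (\<lambda>p. p) \<and>
     (\<forall>p\<in>points B. inj_on (tangent_map B A (\<lambda>p. p)) (tangent_space B p)) \<and>
     atlas_topology B = subtopology (atlas_topology A) (points B)"

definition smooth_curve :: "('a, 'e::euclidean_space) atlas \<Rightarrow> real set \<Rightarrow> (real \<Rightarrow> 'a) \<Rightarrow> bool" where
  "smooth_curve A I c \<longleftrightarrow> open I \<and> is_interval I \<and> smooth_map {(I, \<lambda>t. t)} A c"

text \<open>The pair \<open>(c(t), c'(t))\<close> as a point of the tangent bundle.\<close>

definition velocity ::
  "('a, 'e::euclidean_space) atlas \<Rightarrow> (real \<Rightarrow> 'a) \<Rightarrow> real \<Rightarrow> ('a, 'e) tangent" where
  "velocity A c t = (c t, \<lambda>d. if d \<in> A \<and> c t \<in> dom_of d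
     then vector_derivative (\<lambda>s. coord d (c s)) (at t) else 0)"

text \<open>The tangent space at \<open>p\<close> of a submanifold \<open>S\<close> of the manifold \<open>A\<close>, as a subset of
  \<open>tangent_space A p\<close>.\<close>

definition subset_tangent_space ::
  "('a, 'e::euclidean_space) atlas \<Rightarrow> 'a set \<Rightarrow> 'a \<Rightarrow> ('a, 'e) tangent set" where
  "subset_tangent_space A S p = {velocity A \<gamma> 0 | \<gamma> \<epsilon>. 0 < \<epsilon> \<and>
     smooth_curve A {-\<epsilon><..<\<epsilon>} \<gamma> \<and> \<gamma> ` {-\<epsilon><..<\<epsilon>} \<subseteq> S \<and> \<gamma> 0 = p}"


section \<open>Sprays\<close>

text \<open>A vector field on the slit tangent bundle takes values in \<open>T(TM)\<close>, the tangent spaces of the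
  open subset \<open>TM \<setminus> 0\<close> being those of \<open>TM\<close>.

  \<open>spray_coeff M G c x y\<close> is the vector of the coefficients \<open>G\<^sup>i(x, y)\<close> in
  \<open>G = y\<^sup>i \<partial>\<^sub>x\<^sub>i - 2 G\<^sup>i \<partial>\<^sub>y\<^sub>i\<close> with respect to the chart \<open>c\<close>.\<close>

definition spray_coeff ::
  "('a, 'e::euclidean_space) atlas \<Rightarrow>
   (('a, 'e) tangent \<Rightarrow> (('a, 'e) tangent, 'e \<times> 'e) tangent) \<Rightarrow>
   ('a, 'e) chart \<Rightarrow> 'e \<Rightarrow> 'e \<Rightarrow> 'e" where
  "spray_coeff M G c x y = (- (1/2)) *\<^sub>R
     snd (comp_in (G (coord_vector M c (param c x) y)) (tangent_chart M c))"

definition spray ::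
  "('a, 'e::euclidean_space) atlas \<Rightarrow>
   (('a, 'e) tangent \<Rightarrow> (('a, 'e) tangent, 'e \<times> 'e) tangent) \<Rightarrow> bool" where
  "spray M G \<longleftrightarrow>
     smooth_map (slit_bundle M) (tangent_bundle (tangent_bundle M)) G \<and>
     (\<forall>u\<in>points (slit_bundle M). base (G u) = u) \<and>
     (\<forall>c\<in>M. \<forall>u\<in>points (slit_bundle M). base u \<in> dom_of c \<longrightarrow>
        fst (comp_in (G u) (tangent_chart M c)) = comp_in u c) \<and>
     (\<forall>c\<in>M. \<forall>x\<in>coord c ` dom_of c. \<forall>y. y \<noteq> 0 \<longrightarrow> (\<forall>r>0.
        spray_coeff M G c x (r *\<^sub>R y) = r\<^sup>2 *\<^sub>R spray_coeff M G c x y))"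

text \<open>The linear map \<open>a \<mapsto> (N\<^sup>j\<^sub>i a\<^sup>i)\<^sub>j\<close> with \<open>N\<^sup>j\<^sub>i = \<partial>G\<^sup>j/\<partial>y\<^sup>i\<close>.\<close>

definition spray_connection ::
  "('a, 'e::euclidean_space) atlas \<Rightarrow>
   (('a, 'e) tangent \<Rightarrow> (('a, 'e) tangent, 'e \<times> 'e) tangent) \<Rightarrow>
   ('a, 'e) chart \<Rightarrow> 'e \<Rightarrow> 'e \<Rightarrow> 'e \<Rightarrow> 'e" where
  "spray_connection M G c x y = frechet_derivative (spray_coeff M G c x) (at y)"

text \<open>The horizontal lifting \<open>a\<^sup>i \<delta>\<^sub>x\<^sub>i = a\<^sup>i \<partial>\<^sub>x\<^sub>i - N\<^sup>j\<^sub>i a\<^sup>i \<partial>\<^sub>y\<^sub>j\<close> of \<open>v\<close> at the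
  nonzero vector \<open>u\<close> over the same point; it does not depend on the chart.\<close>

definition horizontal_lift ::
  "('a, 'e::euclidean_space) atlas \<Rightarrow>
   (('a, 'e) tangent \<Rightarrow> (('a, 'e) tangent, 'e \<times> 'e) tangent) \<Rightarrow>
   ('a, 'e) tangent \<Rightarrow> ('a, 'e) tangent \<Rightarrow> (('a, 'e) tangent, 'e \<times> 'e) tangent" where
  "horizontal_lift M G v u = (let c = chart_at M (base u) in
     coord_vector (tangent_bundle M) (tangent_chart M c) u
       (comp_in v c,
        - spray_connection M G c (coord c (base u)) (comp_in u c) (comp_in v c)))"

definition geodesic ::
  "('a, 'e::euclidean_space) atlas \<Rightarrow>
   (('a, 'e) tangent \<Rightarrow> (('a, 'e) tangent, 'e \<times> 'e) tangent) \<Rightarrow>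
   real set \<Rightarrow> (real \<Rightarrow> 'a) \<Rightarrow> bool" where
  "geodesic M G I c \<longleftrightarrow> smooth_curve M I c \<and>
     (\<forall>t\<in>I. velocity M c t \<in> nonzero_vectors \<and>
        velocity (tangent_bundle M) (velocity M c) t = G (velocity M c t))"


section \<open>Submersions between sprays\<close>

definition submersion ::
  "('b, 'f::euclidean_space) atlas \<Rightarrow> ('a, 'e::euclidean_space) atlas \<Rightarrow> ('b \<Rightarrow> 'a) \<Rightarrow> bool" where
  "submersion Mb M \<pi> \<longleftrightarrow> smooth_map Mb M \<pi> \<and>
     (\<forall>p\<in>points Mb. tangent_map Mb M \<pi> ` tangent_space Mb p = tangent_space M (\<pi> p))"

definition vertical_space ::
  "('b, 'f::euclidean_space) atlas \<Rightarrow> ('a, 'e::euclidean_space) atlas \<Rightarrow> ('b \<Rightarrow> 'a) \<Rightarrow> 'b \<Rightarrow>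
   ('b, 'f) tangent set" where
  "vertical_space Mb M \<pi> p =
     {u \<in> tangent_space Mb p. tangent_map Mb M \<pi> u = tangent_zero (\<pi> p)}"

abbreviation fiber :: "('b, 'f) tangent set \<Rightarrow> 'b \<Rightarrow> ('b, 'f) tangent set" where
  "fiber L p \<equiv> {u\<in>L. base u = p}"

text \<open>A distribution is given by its total space \<open>L\<close>. Smoothness of the linear subbundle: locally
  there is a smooth frame \<open>X\<^sub>0, \<dots>, X\<^sub>r\<^sub>-\<^sub>1\<close>, where the bijectivity of
  \<open>a \<mapsto> \<Sum>i<r. a\<^sub>i X\<^sub>i(q)\<close> onto the fiber says that \<open>X\<^sub>i(q)\<close> is a basis of the fiber.\<close>

definition distribution :: "('b, 'f::euclidean_space) atlas \<Rightarrow> ('b, 'f) tangent set \<Rightarrow> bool" where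
  "distribution Mb L \<longleftrightarrow> L \<subseteq> points (tangent_bundle Mb) \<and>
     (\<exists>r. \<forall>p\<in>points Mb. \<exists>W X. openin (atlas_topology Mb) W \<and> p \<in> W \<and>
        (\<forall>i<r. smooth_map (open_submanifold Mb W) (tangent_bundle Mb) (X i) \<and>
               (\<forall>q\<in>W. base (X i q) = q)) \<and>
        (\<forall>q\<in>W. bij_betw (\<lambda>a. (q, \<lambda>c. \<Sum>i<r. a i *\<^sub>R comp_in (X i q) c))
                  (PiE {..<r::nat} (\<lambda>_. UNIV :: real set)) (fiber L q)))"

definition complements_vertical ::
  "('b, 'f::euclidean_space) atlas \<Rightarrow> ('a, 'e::euclidean_space) atlas \<Rightarrow> ('b \<Rightarrow> 'a) \<Rightarrow>
   ('b, 'f) tangent set \<Rightarrow> bool" where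
  "complements_vertical Mb M \<pi> L \<longleftrightarrow> (\<forall>p\<in>points Mb.
     fiber L p \<inter> vertical_space Mb M \<pi> p = {tangent_zero p} \<and>
     {tangent_add l k | l k. l \<in> fiber L p \<and> k \<in> vertical_space Mb M \<pi> p} = tangent_space Mb p)"

definition spray_submersion ::
  "('b, 'f::euclidean_space) atlas \<Rightarrow>
   (('b, 'f) tangent \<Rightarrow> (('b, 'f) tangent, 'f \<times> 'f) tangent) \<Rightarrow>
   ('a, 'e::euclidean_space) atlas \<Rightarrow>
   (('a, 'e) tangent \<Rightarrow> (('a, 'e) tangent, 'e \<times> 'e) tangent) \<Rightarrow>
   ('b \<Rightarrow> 'a) \<Rightarrow> ('b, 'f) tangent set \<Rightarrow> bool" where
  "spray_submersion Mb Gb M G \<pi> L \<longleftrightarrow>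
     manifold Mb \<and> manifold M \<and> spray Mb Gb \<and> spray M G \<and>
     submersion Mb M \<pi> \<and> distribution Mb L \<and> complements_vertical Mb M \<pi> L \<and>
     (\<forall>u \<in> L \<inter> nonzero_vectors.
        Gb u \<in> subset_tangent_space (tangent_bundle Mb) (L \<inter> nonzero_vectors) u) \<and>
     (\<forall>I cb. geodesic Mb Gb I cb \<and> (\<forall>t\<in>I. velocity Mb cb t \<in> L \<inter> nonzero_vectors) \<longrightarrow>
        geodesic M G I (\<lambda>t. \<pi> (cb t)))"

definition is_lifting_tangent_to ::
  "('b, 'f::euclidean_space) atlas \<Rightarrow> ('b \<Rightarrow> 'a) \<Rightarrow> ('b, 'f) tangent set \<Rightarrow> real set \<Rightarrow>
   (real \<Rightarrow> 'a) \<Rightarrow> (real \<Rightarrow> 'b) \<Rightarrow> bool" where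
  "is_lifting_tangent_to Mb \<pi> L I c cb \<longleftrightarrow> smooth_curve Mb I cb \<and>
     (\<forall>t\<in>I. \<pi> (cb t) = c t \<and> velocity Mb cb t \<in> L)"

text \<open>The fiberwise linear projection of \<open>T Mb\<close> onto \<open>L\<close> whose kernel is the vertical space. It is
  treated as a map from \<open>T Mb\<close> to itself, so that its tangent map takes values in
  \<open>T L \<subseteq> T(T Mb)\<close>.\<close>

definition distribution_projection ::
  "('b, 'f::euclidean_space) atlas \<Rightarrow> ('a, 'e::euclidean_space) atlas \<Rightarrow> ('b \<Rightarrow> 'a) \<Rightarrow>
   ('b, 'f) tangent set \<Rightarrow> ('b, 'f) tangent \<Rightarrow> ('b, 'f) tangent" where
  "distribution_projection Mb M \<pi> L u = (THE l. l \<in> fiber L (base u) \<and>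
     (\<exists>k\<in>vertical_space Mb M \<pi> (base u). u = tangent_add l k))"

end

theory Submission
  imports Defs
begin

text \<open>
  Everything is compared in charts \<open>kb\<close> and \<open>k\<close> adapted to \<open>\<pi>\<close>. Write \<open>P\<close> for \<open>\<pi>\<close> in coordinates, \<open>dP\<close>
  for its derivative, \<open>Q x\<close> for the projection onto the fiber of \<open>L\<close> with kernel \<open>ker (dP x)\<close>,
  \<open>\<Phi>\<close> for the resulting bundle map \<open>(x, y) \<mapsto> (x, Q x y)\<close>, and \<open>Gb\<close>, \<open>G\<close> also for the coefficients of the
  two sprays, with derivatives \<open>Nb\<close>, \<open>N\<close> in the fiber direction.

  A geodesic of \<open>Gb\<close> that starts in \<open>L\<close> can be kept in \<open>L\<close>, and then \<open>\<pi>\<close> maps it to a geodesic of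
  \<open>G\<close>. Differentiating its image twice gives, for \<open>y\<close> in the fiber of \<open>L\<close> over \<open>x\<close>,
  \<open>D\<^sup>2P(y, y) - 2 dP (Gb(x, y)) = - 2 G(P x, dP y)\<close> (lemma \<open>spray_relation\<close>). Both sides may be
  differentiated along the lines \<open>y + s v\<close> in the fiber, and since \<open>D\<^sup>2P\<close> is symmetric this yields
  \<open>D\<^sup>2P(y, v) - dP (Nb v) = - N (dP v)\<close> (lemma \<open>connection_relation\<close>). In other words, the tangent map
  of \<open>\<pi>\<^sub>*\<close> sends the horizontal lift of \<open>v\<close> at \<open>y\<close> to the horizontal lift of \<open>dP v\<close> at \<open>dP y\<close>. Because
  \<open>\<pi>\<^sub>* \<circ> \<Phi> = \<pi>\<^sub>*\<close>, it does the same to the image of that lift under the tangent map of \<open>\<Phi>\<close> (lemma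
  \<open>pushforward_projected_horizontal\<close>).

  The projected lift is the velocity at \<open>0\<close> of the curve
  \<open>s \<mapsto> (cb (t + s), Q (cb (t + s)) (y - s (Nb v)))\<close> (lemma \<open>curve_in_L\<close>). This curve runs in \<open>NL\<close>, hence its
  velocity comes from a tangent vector \<open>\<zeta>\<close> of \<open>NL\<close> (lemma \<open>velocity_tangent_to_embedded\<close>). The vector
  \<open>w\<close> of the theorem is the image of \<open>\<zeta>\<close> under the tangent map of the diffeomorphism
  \<open>\<pi>\<^sub>* : NL \<rightarrow> N\<close>, and both equations follow from the chain rule.

  The existence of geodesics in \<open>L\<close> (lemma \<open>geodesic_ode_solution\<close>) rests on the theorem of Picard and
  Lindeloef, on the smoothness of \<open>Q\<close>, which is built from a frame of \<open>L\<close> by inverting a smooth family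
  of linear maps, and on an auxiliary equation whose solutions project into \<open>L\<close>.
\<close>

section \<open>Calculus of smooth maps\<close>

lemma ck_on_cong:
  assumes "open S" "\<And>x. x \<in> S \<Longrightarrow> f x = g x" "ck_on k S f"
  shows "ck_on k S g"
  using assms
proof (induction k arbitrary: f g)
  case 0
  then show ?case using continuous_on_cong[of S S f g] by simp
next
  case (Suc k)
  have d: "(g has_derivative frechet_derivative f (at x)) (at x)" if "x \<in> S" for x
    using Suc.prems that
    by (auto intro!: has_derivative_transform_within_open[of f _ x UNIV S g] simp: frechet_derivative_works)
  have "ck_on k S (\<lambda>x. frechet_derivative g (at x) v)" for v
  proof (rule Suc.IH)
    show "open S" by fact
    show "ck_on k S (\<lambda>x. frechet_derivative f (at x) v)" using Suc.prems by simp
    show "frechet_derivative f (at x) v = frechet_derivative g (at x) v" if "x \<in> S" for x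
      using frechet_derivative_at[OF d[OF that]] by simp
  qed
  then show ?case using d by (auto simp: differentiable_def)
qed

text \<open>Any function that is the derivative at the points of \<open>S\<close> may replace \<open>frechet_derivative\<close>; this
  turns the rules of differentiation into steps of an induction on the order.\<close>

lemma ck_on_SucI:
  assumes "open S" "\<And>x. x \<in> S \<Longrightarrow> (f has_derivative f' x) (at x)"
    and "\<And>v. ck_on k S (\<lambda>x. f' x v)"
  shows "ck_on (Suc k) S f"
proof -
  have "ck_on k S (\<lambda>x. frechet_derivative f (at x) v)" for v
    using assms(1) _ assms(3)[of v]
    by (rule ck_on_cong) (use frechet_derivative_at[OF assms(2)] in metis)
  then show ?thesis using assms(2) by (auto simp: differentiable_def)
qed

lemma ck_on_has_derivative:
  "ck_on (Suc k) S f \<Longrightarrow> x \<in> S \<Longrightarrow> (f has_derivative frechet_derivative f (at x)) (at x)"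
  by (simp add: frechet_derivative_works)

lemma ck_on_Suc_imp: "ck_on (Suc k) S f \<Longrightarrow> ck_on k S f"
proof (induction k arbitrary: f)
  case 0
  then show ?case
    by (auto intro!: continuous_at_imp_continuous_on differentiable_imp_continuous_within)
next
  case (Suc k)
  then show ?case by (metis ck_on.simps(2))
qed

lemma ck_on_imp_continuous_on: "ck_on k S f \<Longrightarrow> continuous_on S f"
  by (induction k) (auto simp del: ck_on.simps(2) dest: ck_on_Suc_imp)

lemma ck_on_subset: "ck_on k S f \<Longrightarrow> T \<subseteq> S \<Longrightarrow> ck_on k T f"
  by (induction k arbitrary: f) (auto intro: continuous_on_subset)

lemma ck_on_const: "ck_on k S (\<lambda>x. c)"
  by (induction k arbitrary: c) (auto)

lemma ck_on_bounded_linear: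
  assumes "bounded_linear h" "open S" "ck_on k S f"
  shows "ck_on k S (\<lambda>x. h (f x))"
  using assms(3)
proof (induction k arbitrary: f)
  case 0
  then show ?case using assms(1) by (simp add: bounded_linear.continuous_on)
next
  case (Suc k)
  show ?case
    by (rule ck_on_SucI[OF \<open>open S\<close>, where f'="\<lambda>x v. h (frechet_derivative f (at x) v)"])
      (use Suc in \<open>auto intro!: bounded_linear.has_derivative[OF assms(1)]
        simp: frechet_derivative_works\<close>)
qed

lemma ck_on_id: "open S \<Longrightarrow> ck_on k S (\<lambda>x. x)"
  by (induction k) (auto intro: ck_on_const intro!: ck_on_SucI[where f'="\<lambda>x v. v"] simp del: ck_on.simps(2))

lemma ck_on_add:
  assumes "open S" "ck_on k S f" "ck_on k S g"
  shows "ck_on k S (\<lambda>x. f x + g x)"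
  using assms(2,3)
proof (induction k arbitrary: f g)
  case 0
  then show ?case by (auto intro: continuous_on_add)
next
  case (Suc k)
  show ?case
    by (rule ck_on_SucI[OF \<open>open S\<close>, where f'="\<lambda>x v. frechet_derivative f (at x) v + frechet_derivative g (at x) v"])
      (use Suc in \<open>auto intro!: has_derivative_add simp: frechet_derivative_works\<close>)
qed

lemma ck_on_sum:
  assumes "open S" "\<And>i. i \<in> A \<Longrightarrow> ck_on k S (f i)"
  shows "ck_on k S (\<lambda>x. \<Sum>i\<in>A. f i x)"
  using assms(2)
  by (induction A rule: infinite_finite_induct) (auto intro: ck_on_const ck_on_add assms(1))

lemma ck_on_bilinear:
  assumes "bounded_bilinear h" "open S" "ck_on k S f" "ck_on k S g"
  shows "ck_on k S (\<lambda>x. h (f x) (g x))"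
  using assms(3,4)
proof (induction k arbitrary: f g)
  case 0
  then show ?case using assms(1) by (auto intro: bounded_bilinear.continuous_on)
next
  case (Suc k)
  have f: "ck_on k S f" and g: "ck_on k S g" using Suc.prems ck_on_Suc_imp by blast+
  show ?case
    by (rule ck_on_SucI[OF \<open>open S\<close>, where f'="\<lambda>x v. h (f x) (frechet_derivative g (at x) v) + h (frechet_derivative f (at x) v) (g x)"])
      (use Suc f g in \<open>auto intro!: bounded_bilinear.FDERIV[OF assms(1)] ck_on_add[OF assms(2)]
        simp: frechet_derivative_works\<close>)
qed

lemma ck_on_Pair:
  assumes "open S" "ck_on k S f" "ck_on k S g"
  shows "ck_on k S (\<lambda>x. (f x, g x))"
  using assms(2,3)
proof (induction k arbitrary: f g)
  case 0
  then show ?case by (auto intro: continuous_on_Pair)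
next
  case (Suc k)
  show ?case
    by (rule ck_on_SucI[OF \<open>open S\<close>, where f'="\<lambda>x v. (frechet_derivative f (at x) v, frechet_derivative g (at x) v)"])
      (use Suc in \<open>auto intro!: has_derivative_Pair simp: frechet_derivative_works\<close>)
qed

lemma ck_on_locally: "(\<And>x. x \<in> S \<Longrightarrow> \<exists>T. open T \<and> x \<in> T \<and> ck_on k T f) \<Longrightarrow> ck_on k S f"
proof (induction k arbitrary: f)
  case 0
  then show ?case
    by (auto intro!: continuous_at_imp_continuous_on) (metis continuous_on_eq_continuous_at)
next
  case (Suc k)
  have "f differentiable (at x)" if "x \<in> S" for x using Suc.prems[OF that] by auto
  moreover have "ck_on k S (\<lambda>x. frechet_derivative f (at x) v)" for v
  proof (rule Suc.IH)
    fix x assume "x \<in> S"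
    then show "\<exists>T. open T \<and> x \<in> T \<and> ck_on k T (\<lambda>x. frechet_derivative f (at x) v)"
      using Suc.prems[of x] by auto
  qed
  ultimately show ?case by simp
qed

lemma linear_eq_sum_Basis:
  fixes f :: "'a::euclidean_space \<Rightarrow> 'b::real_vector"
  assumes "linear f"
  shows "f v = (\<Sum>b\<in>Basis. (v \<bullet> b) *\<^sub>R f b)"
proof -
  have "f v = f (\<Sum>b\<in>Basis. (v \<bullet> b) *\<^sub>R b)" by (simp add: euclidean_representation)
  then show ?thesis by (simp add: linear_sum[OF assms] linear_cmul[OF assms])
qed

text \<open>For families of linear maps this reduces convergence in operator norm to convergence on the
  vectors of a basis.\<close>

lemma linear_diff_bound:
  fixes f g :: "'a::euclidean_space \<Rightarrow> 'b::real_normed_vector"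
  assumes f: "linear f" and g: "linear g"
  shows "norm (f e - g e) \<le> (\<Sum>b\<in>Basis. norm (f b - g b)) * norm e"
proof -
  have "f e - g e = (\<Sum>b\<in>Basis. (e \<bullet> b) *\<^sub>R (f b - g b))"
    using linear_eq_sum_Basis[OF f, of e] linear_eq_sum_Basis[OF g, of e]
    by (simp add: sum_subtractf scaleR_diff_right)
  also have "norm \<dots> \<le> (\<Sum>b\<in>Basis. \<bar>e \<bullet> b\<bar> * norm (f b - g b))"
    by (rule order_trans[OF norm_sum]) simp
  also have "\<dots> \<le> (\<Sum>b\<in>Basis. norm e * norm (f b - g b))"
    by (intro sum_mono mult_right_mono) (auto simp: Basis_le_norm)
  finally show ?thesis by (simp add: sum_distrib_left mult.commute)
qed

text \<open>By the chain rule and an expansion in a basis, a directional derivative of the composition is a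
  sum of products of components of the derivative of \<open>f\<close> with partial derivatives of \<open>g\<close> composed
  with \<open>f\<close>. Each factor has one order less, so the induction hypothesis applies to it.\<close>

lemma ck_on_compose:
  assumes "open S" "open T" "ck_on k S f" "ck_on k T g" "\<And>x. x \<in> S \<Longrightarrow> f x \<in> T"
  shows "ck_on k S (\<lambda>x. g (f x))"
  using assms(3,4)
proof (induction k arbitrary: g)
  case 0
  then show ?case using assms(5) by (auto intro: continuous_on_compose2)
next
  case (Suc k)
  have f: "ck_on k S f" using Suc.prems ck_on_Suc_imp by blast
  have dg: "(g has_derivative frechet_derivative g (at y)) (at y)" if "y \<in> T" for y
    using Suc.prems(2) that by (simp add: frechet_derivative_works)
  have df: "(f has_derivative frechet_derivative f (at y)) (at y)" if "y \<in> S" for y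
    using Suc.prems(1) that by (simp add: frechet_derivative_works)
  have eq: "frechet_derivative g (at (f x)) v = (\<Sum>b\<in>Basis. (v \<bullet> b) *\<^sub>R frechet_derivative g (at (f x)) b)"
    if "x \<in> S" for x v
    by (rule linear_eq_sum_Basis) (use dg[OF assms(5)[OF that]] has_derivative_linear in blast)
  have "ck_on k S (\<lambda>x. \<Sum>b\<in>Basis. (frechet_derivative f (at x) v \<bullet> b) *\<^sub>R frechet_derivative g (at (f x)) b)" for v
    by (intro ck_on_sum ck_on_bilinear[OF bounded_bilinear_scaleR] assms(1) Suc.IH f
        ck_on_bounded_linear[OF bounded_linear_inner_left]) (use Suc.prems in auto)
  then have 1: "ck_on k S (\<lambda>x. frechet_derivative g (at (f x)) (frechet_derivative f (at x) v))" for v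
    by (rule ck_on_cong[OF assms(1), rotated]) (use eq in auto)
  show ?case
    by (rule ck_on_SucI[OF \<open>open S\<close>, where f'="\<lambda>x v. frechet_derivative g (at (f x)) (frechet_derivative f (at x) v)"])
     (use 1 df dg assms(5) in \<open>auto intro: diff_chain_at[of f _ _ g, unfolded o_def]\<close>)
qed

lemma smooth_on_cong:
  "open S \<Longrightarrow> (\<And>x. x \<in> S \<Longrightarrow> f x = g x) \<Longrightarrow> smooth_on S f \<Longrightarrow> smooth_on S g"
  unfolding smooth_on_def by (rule allI, rule ck_on_cong[of S f]) auto

lemma smooth_on_has_derivative:
  "smooth_on S f \<Longrightarrow> x \<in> S \<Longrightarrow> (f has_derivative frechet_derivative f (at x)) (at x)"
  unfolding smooth_on_def by (rule ck_on_has_derivative[of 0]) (erule allE)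

lemma smooth_on_imp_continuous_on: "smooth_on S f \<Longrightarrow> continuous_on S f"
  unfolding smooth_on_def using ck_on_imp_continuous_on by blast

lemma smooth_on_subset: "smooth_on S f \<Longrightarrow> T \<subseteq> S \<Longrightarrow> smooth_on T f"
  unfolding smooth_on_def using ck_on_subset by blast

lemma smooth_on_derivative: "smooth_on S f \<Longrightarrow> smooth_on S (\<lambda>x. frechet_derivative f (at x) v)"
  unfolding smooth_on_def by (rule allI, drule_tac x="Suc k" in spec) simp

lemma smooth_on_bounded_linear:
  "bounded_linear h \<Longrightarrow> open S \<Longrightarrow> smooth_on S f \<Longrightarrow> smooth_on S (\<lambda>x. h (f x))"
  unfolding smooth_on_def by (rule allI, rule ck_on_bounded_linear) auto

lemma smooth_on_add:
  "open S \<Longrightarrow> smooth_on S f \<Longrightarrow> smooth_on S g \<Longrightarrow> smooth_on S (\<lambda>x. f x + g x)"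
  unfolding smooth_on_def by (rule allI, rule ck_on_add) auto

lemma smooth_on_sum:
  "open S \<Longrightarrow> (\<And>i. i \<in> A \<Longrightarrow> smooth_on S (f i)) \<Longrightarrow> smooth_on S (\<lambda>x. \<Sum>i\<in>A. f i x)"
  unfolding smooth_on_def by (rule allI, rule ck_on_sum) auto

lemma smooth_on_bilinear:
  "bounded_bilinear h \<Longrightarrow> open S \<Longrightarrow> smooth_on S f \<Longrightarrow> smooth_on S g \<Longrightarrow>
    smooth_on S (\<lambda>x. h (f x) (g x))"
  unfolding smooth_on_def by (rule allI, rule ck_on_bilinear) auto

lemma smooth_on_Pair:
  "open S \<Longrightarrow> smooth_on S f \<Longrightarrow> smooth_on S g \<Longrightarrow> smooth_on S (\<lambda>x. (f x, g x))"
  unfolding smooth_on_def by (rule allI, rule ck_on_Pair) auto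

lemma smooth_on_compose:
  "open S \<Longrightarrow> open T \<Longrightarrow> smooth_on S f \<Longrightarrow> smooth_on T g \<Longrightarrow> (\<And>x. x \<in> S \<Longrightarrow> f x \<in> T) \<Longrightarrow>
    smooth_on S (\<lambda>x. g (f x))"
  unfolding smooth_on_def by (rule allI, rule ck_on_compose[of S T]) auto

lemma smooth_on_id: "open S \<Longrightarrow> smooth_on S (\<lambda>x. x)"
  unfolding smooth_on_def using ck_on_id by blast

lemma smooth_on_const: "smooth_on S (\<lambda>x. c)"
  unfolding smooth_on_def using ck_on_const by blast

lemma smooth_on_locally: "(\<And>x. x \<in> S \<Longrightarrow> \<exists>T. open T \<and> x \<in> T \<and> smooth_on T f) \<Longrightarrow> smooth_on S f"
  unfolding smooth_on_def by (intro allI ck_on_locally) blast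

lemma smooth_on_linear_family:
  fixes B :: "'a::euclidean_space \<Rightarrow> 'b::euclidean_space \<Rightarrow> 'c::euclidean_space"
  assumes S: "open S" and "\<And>x. x \<in> S \<Longrightarrow> linear (B x)"
    and "\<And>b. smooth_on S (\<lambda>x. B x b)" and "smooth_on S f"
  shows "smooth_on S (\<lambda>x. B x (f x))"
proof -
  have "smooth_on S (\<lambda>x. \<Sum>b\<in>Basis. (f x \<bullet> b) *\<^sub>R B x b)"
    by (intro smooth_on_sum smooth_on_bilinear[OF bounded_bilinear_scaleR] S assms(3)
        smooth_on_bounded_linear[OF bounded_linear_inner_left] assms(4))
  then show ?thesis
    by (rule smooth_on_cong[OF S, rotated]) (use linear_eq_sum_Basis assms(2) in metis)
qed

lemma smooth_on_fst: "open S \<Longrightarrow> smooth_on S (\<lambda>z. fst z)"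
  by (rule smooth_on_bounded_linear[OF bounded_linear_fst _ smooth_on_id])

lemma smooth_on_snd: "open S \<Longrightarrow> smooth_on S (\<lambda>z. snd z)"
  by (rule smooth_on_bounded_linear[OF bounded_linear_snd _ smooth_on_id])

lemma smooth_on_linear_family_pair:
  fixes B :: "'a::euclidean_space \<Rightarrow> 'b::euclidean_space \<Rightarrow> 'c::euclidean_space"
  assumes S: "open S" and B: "\<And>x. x \<in> S \<Longrightarrow> linear (B x)" and s: "\<And>b. smooth_on S (\<lambda>x. B x b)"
  shows "smooth_on (S \<times> UNIV) (\<lambda>z. B (fst z) (snd z))"
proof -
  have O: "open (S \<times> (UNIV :: 'b set))" using S by (simp add: open_Times)
  show ?thesis
  proof (rule smooth_on_linear_family[where B="\<lambda>z. B (fst z)" and f="\<lambda>z. snd z", OF O])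
    show "linear (B (fst z))" if "z \<in> S \<times> (UNIV :: 'b set)" for z using that by (intro B) auto
    show "smooth_on (S \<times> (UNIV :: 'b set)) (\<lambda>z. B (fst z) b)" for b
      by (rule smooth_on_compose[OF O S smooth_on_fst[OF O] s]) auto
    show "smooth_on (S \<times> (UNIV :: 'b set)) (\<lambda>z. snd z)" by (rule smooth_on_snd[OF O])
  qed
qed

lemma smooth_on_derivative_apply:
  assumes "open S" "smooth_on S f" "smooth_on S g"
  shows "smooth_on S (\<lambda>x. frechet_derivative f (at x) (g x))"
  by (rule smooth_on_linear_family)
    (use assms smooth_on_derivative[OF assms(2)] has_derivative_linear[OF smooth_on_has_derivative[OF assms(2)]] in auto)

text \<open>Solutions of an autonomous smooth equation are smooth: the equation expresses the derivative
  through the solution, so that each order of differentiability gives the next one.\<close>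

lemma ode_solution_smooth:
  fixes z :: "real \<Rightarrow> 'a::euclidean_space"
  assumes "open J" "open U" "smooth_on U f" "\<And>t. t \<in> J \<Longrightarrow> z t \<in> U"
    and z: "\<And>t. t \<in> J \<Longrightarrow> (z has_vector_derivative f (z t)) (at t)"
  shows "smooth_on J z"
proof -
  have "ck_on k J z" for k
  proof (induction k)
    case 0
    show ?case using z
      by (auto intro!: continuous_at_imp_continuous_on has_vector_derivative_continuous)
  next
    case (Suc k)
    show ?case
    proof (rule ck_on_SucI[OF \<open>open J\<close>, where f'="\<lambda>t h. h *\<^sub>R f (z t)"])
      show "(z has_derivative (\<lambda>h. h *\<^sub>R f (z t))) (at t)" if "t \<in> J" for t
        using z[OF that] by (simp add: has_vector_derivative_def)
      show "ck_on k J (\<lambda>t. v *\<^sub>R f (z t))" for v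
        by (rule ck_on_bounded_linear[OF bounded_linear_scaleR_right \<open>open J\<close>],
            rule ck_on_compose[OF \<open>open J\<close> \<open>open U\<close> Suc]) (use assms in \<open>auto simp: smooth_on_def\<close>)
    qed
  qed
  then show ?thesis by (simp add: smooth_on_def)
qed

text \<open>From \<open>C x w = C x0 w - C x0 ((B x - B x0) (C x w))\<close>: if \<open>K\<close> bounds \<open>C x0\<close> and \<open>B x\<close> is closer to
  \<open>B x0\<close> than \<open>1 / (2 K)\<close>, the last term is at most half of \<open>C x w\<close> and can be absorbed.\<close>

lemma linear_inverse_family_bounded:
  fixes B :: "'a::euclidean_space \<Rightarrow> 'b::euclidean_space \<Rightarrow> 'c::euclidean_space"
  assumes S: "open S" "x0 \<in> S" and B: "\<And>x. x \<in> S \<Longrightarrow> linear (B x)"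
    and C: "\<And>x. x \<in> S \<Longrightarrow> linear (C x)"
    and CB: "\<And>x e. x \<in> S \<Longrightarrow> C x (B x e) = e" and BC: "\<And>x e. x \<in> S \<Longrightarrow> B x (C x e) = e"
    and cont: "\<And>b. continuous_on S (\<lambda>x. B x b)"
  shows "\<exists>K. \<forall>\<^sub>F x in nhds x0. x \<in> S \<and> (\<forall>w. norm (C x w) \<le> K * norm w)"
proof -
  have "bounded_linear (C x0)" using C S by (simp add: linear_conv_bounded_linear)
  then obtain K where K: "K > 0" "\<And>w. norm (C x0 w) \<le> K * norm w"
    using bounded_linear.pos_bounded by (metis mult.commute)
  define g where "g = (\<lambda>x. \<Sum>b\<in>Basis. norm (B x b - B x0 b))"
  have g: "norm (B x e - B x0 e) \<le> g x * norm e" if "x \<in> S" for x e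
    unfolding g_def by (rule linear_diff_bound[OF B[OF that] B[OF S(2)]])
  have "isCont g x0"
    unfolding g_def using cont S by (auto intro!: continuous_intros simp: continuous_on_eq_continuous_at)
  moreover have "g x0 = 0" by (simp add: g_def)
  ultimately have "(g \<longlongrightarrow> 0) (nhds x0)" by (metis isCont_def tendsto_at_iff_tendsto_nhds)
  then have "\<forall>\<^sub>F x in nhds x0. g x < 1 / (2 * K)" using K by (intro order_tendstoD) auto
  moreover have "\<forall>\<^sub>F x in nhds x0. x \<in> S" using S eventually_nhds_in_open by blast
  ultimately have "\<forall>\<^sub>F x in nhds x0. x \<in> S \<and> (\<forall>w. norm (C x w) \<le> (2 * K) * norm w)"
  proof eventually_elim
    case (elim x)
    have "norm (C x w) \<le> 2 * K * norm w" for w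
    proof -
      have e: "C x w = C x0 w - C x0 (B x (C x w) - B x0 (C x w))"
        using elim S by (simp add: BC CB linear_diff[OF C])
      have "norm (C x0 (B x (C x w) - B x0 (C x w))) \<le> K * (g x * norm (C x w))"
        by (rule order_trans[OF K(2)]) (use g K elim in \<open>auto intro!: mult_left_mono\<close>)
      also have "\<dots> \<le> K * (1 / (2 * K) * norm (C x w))"
        using elim K by (intro mult_left_mono mult_right_mono) auto
      finally have "norm (C x w) \<le> K * norm w + norm (C x w) / 2"
        using K(1) K(2)[of w] norm_triangle_ineq4[of "C x0 w" "C x0 (B x (C x w) - B x0 (C x w))"] e
        by (simp add: field_simps)
      then show ?thesis by simp
    qed
    then show ?case using elim by blast
  qed
  then show ?thesis by blast
qed

text \<open>Put \<open>u = C x0 w\<close>. Then \<open>C x w - C x0 w = - C x (B x u - B x0 u)\<close>. The error of the linear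
  approximation is \<open>C x\<close> applied to the error for \<open>B x u\<close>, which is controlled because the \<open>C x\<close> are
  bounded near \<open>x0\<close>, plus \<open>C x - C x0\<close> applied to the derivative of \<open>B x u\<close>.\<close>

lemma linear_inverse_family_derivative:
  fixes B :: "'a::euclidean_space \<Rightarrow> 'b::euclidean_space \<Rightarrow> 'c::euclidean_space"
  assumes S: "open S" "x0 \<in> S" and B: "\<And>x. x \<in> S \<Longrightarrow> linear (B x)"
    and C: "\<And>x. x \<in> S \<Longrightarrow> linear (C x)"
    and CB: "\<And>x e. x \<in> S \<Longrightarrow> C x (B x e) = e" and BC: "\<And>x e. x \<in> S \<Longrightarrow> B x (C x e) = e"
    and dB: "\<And>x b. x \<in> S \<Longrightarrow> (\<lambda>x. B x b) differentiable (at x)"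
  shows "((\<lambda>x. C x w) has_derivative
     (\<lambda>v. - C x0 (frechet_derivative (\<lambda>x. B x (C x0 w)) (at x0) v))) (at x0)"
proof -
  have cont: "continuous_on S (\<lambda>x. B x b)" for b
    using dB by (auto intro!: continuous_at_imp_continuous_on differentiable_imp_continuous_within)
  obtain K where "\<forall>\<^sub>F x in nhds x0. x \<in> S \<and> (\<forall>w. norm (C x w) \<le> K * norm w)"
    using linear_inverse_family_bounded[of S x0 B C] S B C CB BC cont by blast
  then have K: "\<forall>\<^sub>F x in at x0. x \<in> S \<and> (\<forall>w. norm (C x w) \<le> K * norm w)"
    by (simp add: eventually_at_filter eventually_mono)
  have eq: "C x w - C x0 w = - C x (B x (C x0 w) - B x0 (C x0 w))" if "x \<in> S" for x w
    using that S by (simp add: BC CB linear_diff[OF C])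
  have lim: "((\<lambda>x. C x w) \<longlongrightarrow> C x0 w) (at x0)" for w
  proof -
    have "((\<lambda>x. B x (C x0 w)) \<longlongrightarrow> B x0 (C x0 w)) (at x0)"
      using cont[of "C x0 w"] S by (simp add: continuous_on_eq_continuous_at isCont_def)
    then have "((\<lambda>x. K * norm (B x (C x0 w) - B x0 (C x0 w))) \<longlongrightarrow> K * norm (B x0 (C x0 w) - B x0 (C x0 w))) (at x0)"
      by (intro tendsto_intros)
    then have l: "((\<lambda>x. K * norm (B x (C x0 w) - B x0 (C x0 w))) \<longlongrightarrow> 0) (at x0)" by simp
    have "\<forall>\<^sub>F x in at x0. norm (C x w - C x0 w) \<le> K * norm (B x (C x0 w) - B x0 (C x0 w))"
      using K by eventually_elim (simp add: eq)
    from Lim_null_comparison[OF this l] have "((\<lambda>x. C x w - C x0 w) \<longlongrightarrow> 0) (at x0)" .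
    then show ?thesis by (rule LIM_zero_cancel)
  qed
  define u where "u = C x0 w"
  define D where "D = frechet_derivative (\<lambda>x. B x u) (at x0)"
  have D: "((\<lambda>x. B x u) has_derivative D) (at x0)"
    unfolding D_def by (rule frechet_derivative_works[THEN iffD1, OF dB[OF S(2)]])
  have blD: "bounded_linear D" by (rule has_derivative_bounded_linear[OF D])
  define R where "R = (\<lambda>x. (1 / norm (x - x0)) *\<^sub>R (B x u - (B x0 u + D (x - x0))))"
  have R: "(R \<longlongrightarrow> 0) (at x0)"
    using D unfolding has_derivative_within R_def by simp
  \<comment> \<open>\<open>E x\<close> bounds the operator norm of \<open>C x - C x0\<close>\<close>
  define E where "E = (\<lambda>x. \<Sum>b\<in>Basis. norm (C x b - C x0 b))"
  have E: "(E \<longlongrightarrow> 0) (at x0)"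
    unfolding E_def by (rule tendsto_null_sum) (rule tendsto_norm_zero, rule LIM_zero, rule lim)
  have Ebd: "norm (C x e - C x0 e) \<le> E x * norm e" if "x \<in> S" for x e
    unfolding E_def by (rule linear_diff_bound[OF C[OF that] C[OF S(2)]])
  obtain KD where KD: "\<And>v. norm (D v) \<le> norm v * KD" using blD bounded_linear.bounded by blast
  have "((\<lambda>x. (1 / norm (x - x0)) *\<^sub>R (C x w - (C x0 w + - C x0 (D (x - x0))))) \<longlongrightarrow> 0) (at x0)"
  proof (rule Lim_null_comparison[where g="\<lambda>x. K * norm (R x) + \<bar>E x\<bar> * KD"])
    have ne: "\<forall>\<^sub>F x in at x0. x \<noteq> x0" by (simp add: eventually_at_filter)
    show "\<forall>\<^sub>F x in at x0. norm ((1 / norm (x - x0)) *\<^sub>R (C x w - (C x0 w + - C x0 (D (x - x0)))))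
      \<le> K * norm (R x) + \<bar>E x\<bar> * KD"
      using K ne
    proof eventually_elim
      case (elim x)
      have xS: "x \<in> S" using elim by blast
      have "C x w - (C x0 w + - C x0 (D (x - x0))) =
         - C x (B x u - (B x0 u + D (x - x0))) - (C x (D (x - x0)) - C x0 (D (x - x0)))"
        using eq[OF xS, of w] unfolding u_def
        by (simp add: linear_diff[OF C[OF xS]] linear_add[OF C[OF xS]] algebra_simps)
      also have "(1 / norm (x - x0)) *\<^sub>R \<dots> = - C x (R x) - (1 / norm (x - x0)) *\<^sub>R (C x (D (x - x0)) - C x0 (D (x - x0)))"
        by (simp add: R_def linear_cmul[OF C[OF xS]] linear_diff[OF C[OF xS]] linear_add[OF C[OF xS]] algebra_simps)
      also have "norm \<dots> \<le> norm (C x (R x)) + (1 / norm (x - x0)) * norm (C x (D (x - x0)) - C x0 (D (x - x0)))"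
        by (rule order_trans[OF norm_triangle_ineq4]) simp
      also have "\<dots> \<le> K * norm (R x) + (1 / norm (x - x0)) * (\<bar>E x\<bar> * (norm (x - x0) * KD))"
      proof (intro add_mono mult_left_mono)
        have "norm (C x (D (x - x0)) - C x0 (D (x - x0))) \<le> E x * norm (D (x - x0))" by (rule Ebd[OF xS])
        also have "\<dots> \<le> \<bar>E x\<bar> * (norm (x - x0) * KD)"
          using KD[of "x - x0"] by (intro mult_mono) auto
        finally show "norm (C x (D (x - x0)) - C x0 (D (x - x0))) \<le> \<bar>E x\<bar> * (norm (x - x0) * KD)" .
      qed (use elim in auto)
      also have "\<dots> = K * norm (R x) + \<bar>E x\<bar> * KD" using elim by simp
      finally show ?case .
    qed
    have "((\<lambda>x. K * norm (R x) + \<bar>E x\<bar> * KD) \<longlongrightarrow> K * norm (0::'c) + \<bar>0\<bar> * KD) (at x0)"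
      by (intro tendsto_intros R E)
    then show "((\<lambda>x. K * norm (R x) + \<bar>E x\<bar> * KD) \<longlongrightarrow> 0) (at x0)" by simp
  qed
  moreover have "bounded_linear (\<lambda>v. - C x0 (D v))"
    using bounded_linear_compose[OF _ blD, of "C x0"] C S
    by (auto intro!: bounded_linear_minus simp: linear_conv_bounded_linear)
  ultimately show ?thesis
    unfolding has_derivative_within D_def u_def by simp
qed

text \<open>The derivative of the inverse is made of the inverse itself and derivatives of \<open>B\<close>, so each
  order of differentiability of the inverse gives the next one.\<close>

lemma smooth_on_linear_inverse:
  fixes B :: "'a::euclidean_space \<Rightarrow> 'b::euclidean_space \<Rightarrow> 'c::euclidean_space"
  assumes S: "open S" and B: "\<And>x. x \<in> S \<Longrightarrow> linear (B x)"
    and C: "\<And>x. x \<in> S \<Longrightarrow> linear (C x)"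
    and CB: "\<And>x e. x \<in> S \<Longrightarrow> C x (B x e) = e" and BC: "\<And>x e. x \<in> S \<Longrightarrow> B x (C x e) = e"
    and sB: "\<And>b. smooth_on S (\<lambda>x. B x b)"
  shows "smooth_on S (\<lambda>x. C x w)"
proof -
  have dB: "(\<lambda>x. B x b) differentiable (at x)" if "x \<in> S" for x b
    using smooth_on_has_derivative[OF sB that] by (auto simp: differentiable_def)
  have d: "((\<lambda>x. C x w) has_derivative
     (\<lambda>v. - C x0 (frechet_derivative (\<lambda>x. B x (C x0 w)) (at x0) v))) (at x0)" if "x0 \<in> S" for x0 w
    using linear_inverse_family_derivative[of S x0 B C w] assms(1-5) dB that by blast
  have lin: "frechet_derivative (\<lambda>x. B x (C x0 w)) (at x0) v
      = (\<Sum>b\<in>Basis. (C x0 w \<bullet> b) *\<^sub>R frechet_derivative (\<lambda>x. B x b) (at x0) v)" if "x0 \<in> S" for x0 w v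
  proof -
    have "((\<lambda>x. \<Sum>b\<in>Basis. (C x0 w \<bullet> b) *\<^sub>R B x b) has_derivative
       (\<lambda>v. \<Sum>b\<in>Basis. (C x0 w \<bullet> b) *\<^sub>R frechet_derivative (\<lambda>x. B x b) (at x0) v)) (at x0)"
      by (intro has_derivative_sum has_derivative_scaleR_right)
        (rule frechet_derivative_works[THEN iffD1, OF dB[OF that]])
    then have "((\<lambda>x. B x (C x0 w)) has_derivative
       (\<lambda>v. \<Sum>b\<in>Basis. (C x0 w \<bullet> b) *\<^sub>R frechet_derivative (\<lambda>x. B x b) (at x0) v)) (at x0)"
      by (rule has_derivative_transform_within_open[OF _ S that])
        (use linear_eq_sum_Basis[OF B, symmetric] in auto)
    from fun_cong[OF frechet_derivative_at[OF this], of v] show ?thesis by simp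
  qed
  have "ck_on k S (\<lambda>x. C x w)" for k w
  proof (induction k arbitrary: w)
    case 0
    show ?case using d
      by (auto intro!: continuous_at_imp_continuous_on dest: has_derivative_continuous)
  next
    case (Suc k)
    have fam: "ck_on k S (\<lambda>x. C x (f x))" if "ck_on k S f" for f
    proof -
      have "ck_on k S (\<lambda>x. \<Sum>b\<in>Basis. (f x \<bullet> b) *\<^sub>R C x b)"
        by (intro ck_on_sum ck_on_bilinear[OF bounded_bilinear_scaleR] S Suc
            ck_on_bounded_linear[OF bounded_linear_inner_left] that)
      then show ?thesis
        by (rule ck_on_cong[OF S, rotated]) (use linear_eq_sum_Basis[OF C, symmetric] in auto)
    qed
    have "ck_on k S (\<lambda>x. \<Sum>b\<in>Basis. (C x w \<bullet> b) *\<^sub>R frechet_derivative (\<lambda>x. B x b) (at x) v)" for v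
      using smooth_on_derivative[OF sB]
      by (intro ck_on_sum ck_on_bilinear[OF bounded_bilinear_scaleR] S Suc
            ck_on_bounded_linear[OF bounded_linear_inner_left]) (auto simp: smooth_on_def)
    then have "ck_on k S (\<lambda>x. - C x (\<Sum>b\<in>Basis. (C x w \<bullet> b) *\<^sub>R frechet_derivative (\<lambda>x. B x b) (at x) v))" for v
      by (rule ck_on_bounded_linear[OF bounded_linear_minus[OF bounded_linear_ident] S fam])
    then show ?case
      by (intro ck_on_SucI[OF S, where f'="\<lambda>x v. - C x (\<Sum>b\<in>Basis. (C x w \<bullet> b) *\<^sub>R frechet_derivative (\<lambda>x. B x b) (at x) v)"])
        (use d lin in auto)
  qed
  then show ?thesis by (simp add: smooth_on_def)
qed

text \<open>Only the maps \<open>\<lambda>x. B x b\<close> are known to be smooth, so that the product rule for \<open>B x y\<close>, in which both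
  arguments vary, is obtained from an expansion of \<open>y\<close> in a basis.\<close>

lemma linear_family_has_derivative:
  fixes B :: "'a::euclidean_space \<Rightarrow> 'b::euclidean_space \<Rightarrow> 'c::euclidean_space"
  assumes S: "open S" "x \<in> S" and B: "\<And>x. x \<in> S \<Longrightarrow> linear (B x)" and s: "\<And>b. smooth_on S (\<lambda>x. B x b)"
  shows "((\<lambda>z. B (fst z) (snd z)) has_derivative
     (\<lambda>h. frechet_derivative (\<lambda>x. B x y) (at x) (fst h) + B x (snd h))) (at (x, y))"
proof -
  let ?D = "\<lambda>b. frechet_derivative (\<lambda>x. B x b) (at x)"
  have D: "((\<lambda>x. B x b) has_derivative ?D b) (at x)" for b by (rule smooth_on_has_derivative[OF s S(2)])
  have Dy: "?D y v = (\<Sum>b\<in>Basis. (y \<bullet> b) *\<^sub>R ?D b v)" for v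
  proof -
    have "((\<lambda>x. \<Sum>b\<in>Basis. (y \<bullet> b) *\<^sub>R B x b) has_derivative (\<lambda>v. \<Sum>b\<in>Basis. (y \<bullet> b) *\<^sub>R ?D b v)) (at x)"
      by (intro has_derivative_sum has_derivative_scaleR_right D)
    then have "((\<lambda>x. B x y) has_derivative (\<lambda>v. \<Sum>b\<in>Basis. (y \<bullet> b) *\<^sub>R ?D b v)) (at x)"
      by (rule has_derivative_transform_within_open[OF _ S]) (rule linear_eq_sum_Basis[OF B, symmetric])
    from fun_cong[OF frechet_derivative_at[OF this], of v] show ?thesis by simp
  qed
  have f: "(fst has_derivative fst) (at (x, y))" "(snd has_derivative snd) (at (x, y))" by (auto intro: derivative_intros)
  have "((\<lambda>z. B (fst z) b) has_derivative (\<lambda>h. ?D b (fst h))) (at (x, y))" for b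
    using diff_chain_at[OF f(1), of "\<lambda>x. B x b" "?D b"] D by (simp add: o_def)
  then have "((\<lambda>z. \<Sum>b\<in>Basis. (snd z \<bullet> b) *\<^sub>R B (fst z) b) has_derivative
     (\<lambda>h. \<Sum>b\<in>Basis. (snd (x, y) \<bullet> b) *\<^sub>R ?D b (fst h) + (snd h \<bullet> b) *\<^sub>R B (fst (x, y)) b)) (at (x, y))"
    by (intro has_derivative_sum has_derivative_scaleR has_derivative_inner_left f)
  moreover have "(\<Sum>b\<in>Basis. (snd (x, y) \<bullet> b) *\<^sub>R ?D b (fst h) + (snd h \<bullet> b) *\<^sub>R B (fst (x, y)) b)
     = ?D y (fst h) + B x (snd h)" for h
    using linear_eq_sum_Basis[OF B[OF S(2)], of "snd h"] by (simp add: sum.distrib Dy)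
  ultimately have "((\<lambda>z. \<Sum>b\<in>Basis. (snd z \<bullet> b) *\<^sub>R B (fst z) b) has_derivative (\<lambda>h. ?D y (fst h) + B x (snd h))) (at (x, y))"
    by simp
  then show ?thesis
  proof (rule has_derivative_transform_within_open)
    show "open (S \<times> (UNIV :: 'b set))" "(x, y) \<in> S \<times> UNIV" using S by (auto simp: open_Times)
    fix z :: "'a \<times> 'b" assume "z \<in> S \<times> UNIV"
    then show "(\<Sum>b\<in>Basis. (snd z \<bullet> b) *\<^sub>R B (fst z) b) = B (fst z) (snd z)"
      by (intro linear_eq_sum_Basis[OF B, symmetric]) auto
  qed
qed

text \<open>Near \<open>x0\<close> the map \<open>B x\<close> differs from the identity by less than \<open>1\<close> in norm.\<close>

lemma linear_family_injective_near:
  fixes B :: "'a::euclidean_space \<Rightarrow> 'b::euclidean_space \<Rightarrow> 'b"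
  assumes S: "open S" "x0 \<in> S" and B: "\<And>x. x \<in> S \<Longrightarrow> linear (B x)"
    and cont: "\<And>b. continuous_on S (\<lambda>x. B x b)" and id: "\<And>e. B x0 e = e"
  shows "\<exists>T. open T \<and> x0 \<in> T \<and> T \<subseteq> S \<and> (\<forall>x\<in>T. inj (B x))"
proof -
  define g where "g = (\<lambda>x. \<Sum>b\<in>Basis. norm (B x b - b))"
  have g: "norm (B x e - e) \<le> g x * norm e" if "x \<in> S" for x e
    unfolding g_def by (rule linear_diff_bound[OF B[OF that] linear_ident])
  have c: "continuous_on S g" unfolding g_def by (intro continuous_on_sum continuous_on_norm continuous_on_diff cont continuous_on_const)
  define T where "T = S \<inter> g -` {..<1}"
  have "open T" unfolding T_def by (rule continuous_open_preimage[OF c S(1)]) simp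
  moreover have "x0 \<in> T" using S by (simp add: T_def g_def id)
  moreover have "inj (B x)" if "x \<in> T" for x
  proof -
    have x: "x \<in> S" "g x < 1" using that by (auto simp: T_def)
    have "e = 0" if "B x e = 0" for e
    proof (rule ccontr)
      assume "e \<noteq> 0"
      then have "g x * norm e < 1 * norm e" using x by (intro mult_strict_right_mono) auto
      then show False using g[OF x(1), of e] that by simp
    qed
    then show ?thesis using linear_injective_0[OF B[OF x(1)]] by blast
  qed
  ultimately show ?thesis by (auto simp: T_def)
qed

text \<open>A linear right inverse of \<open>A x0\<close> with values in \<open>V x0\<close> extends to maps \<open>\<Lambda> x\<close> into
  \<open>V x\<close> by keeping its coefficients with respect to the generators. The composition of \<open>A x\<close> and \<open>\<Lambda> x\<close>
  is the identity at \<open>x0\<close>, hence invertible near \<open>x0\<close>, with inverse \<open>C x\<close> say, and then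
  \<open>Q x = \<Lambda> x \<circ> C x \<circ> A x\<close>, a composition of smooth families. In the application \<open>Q x\<close> is the projection
  onto \<open>V x\<close> along the kernel of \<open>A x\<close>.\<close>

lemma smooth_on_projection_family:
  fixes A :: "'f::euclidean_space \<Rightarrow> 'f \<Rightarrow> 'e::euclidean_space" and \<xi> :: "nat \<Rightarrow> 'f \<Rightarrow> 'f"
  assumes S: "open S" "x0 \<in> S" and A: "\<And>x. x \<in> S \<Longrightarrow> linear (A x)" and sA: "\<And>b. smooth_on S (\<lambda>x. A x b)"
    and \<xi>: "\<And>i. i < r \<Longrightarrow> smooth_on S (\<xi> i)"
    and V: "\<And>x. x \<in> S \<Longrightarrow> V x = range (\<lambda>a. \<Sum>i<r. a i *\<^sub>R \<xi> i x)"
    and surj: "\<And>e. \<exists>y\<in>V x0. A x0 y = e"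
    and Q: "\<And>x y l. x \<in> S \<Longrightarrow> l \<in> V x \<Longrightarrow> A x l = A x y \<Longrightarrow> Q x y = l"
  shows "\<exists>T. open T \<and> x0 \<in> T \<and> T \<subseteq> S \<and> smooth_on T (\<lambda>x. Q x y)"
proof -
  have "\<exists>a. A x0 (\<Sum>i<r. a i *\<^sub>R \<xi> i x0) = e" for e
    using surj[of e] unfolding V[OF S(2)] by auto
  then obtain a where a: "\<And>e. A x0 (\<Sum>i<r. a e i *\<^sub>R \<xi> i x0) = e" by metis
  define \<Lambda> where "\<Lambda> = (\<lambda>x e. \<Sum>b\<in>Basis. (e \<bullet> b) *\<^sub>R (\<Sum>i<r. a b i *\<^sub>R \<xi> i x))"
  have "linear (\<lambda>e::'e. \<Sum>b\<in>Basis. (e \<bullet> b) *\<^sub>R w b)" for w :: "'e \<Rightarrow> 'f"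
    by (rule linearI) (simp_all add: inner_add_left scaleR_add_left sum.distrib scaleR_sum_right)
  then have lin\<Lambda>: "linear (\<Lambda> x)" for x unfolding \<Lambda>_def .
  have \<Lambda>V: "\<Lambda> x e \<in> V x" if "x \<in> S" for x e
  proof -
    have "\<Lambda> x e = (\<Sum>i<r. (\<Sum>b\<in>Basis. (e \<bullet> b) * a b i) *\<^sub>R \<xi> i x)"
      unfolding \<Lambda>_def by (simp add: scaleR_sum_right scaleR_sum_left sum.swap[of _ "{..<r}"])
    then show ?thesis unfolding V[OF that] by (rule range_eqI[where x="\<lambda>i. \<Sum>b\<in>Basis. (e \<bullet> b) * a b i"])
  qed
  have s\<Lambda>: "smooth_on S (\<lambda>x. \<Lambda> x e)" for e
    unfolding \<Lambda>_def
    by (rule smooth_on_sum[OF S(1)], rule smooth_on_bounded_linear[OF bounded_linear_scaleR_right S(1)],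
        rule smooth_on_sum[OF S(1)], rule smooth_on_bounded_linear[OF bounded_linear_scaleR_right S(1)], rule \<xi>, simp)
  define B where "B = (\<lambda>x e. A x (\<Lambda> x e))"
  have linB: "linear (B x)" if "x \<in> S" for x
    using linear_compose[OF lin\<Lambda>[of x] A[OF that]] by (simp add: B_def o_def)
  have sB: "smooth_on S (\<lambda>x. B x e)" for e
    unfolding B_def by (rule smooth_on_linear_family[where B=A, OF S(1) A sA s\<Lambda>])
  have B0: "B x0 e = e" for e
  proof -
    have "B x0 e = (\<Sum>b\<in>Basis. (e \<bullet> b) *\<^sub>R A x0 (\<Sum>i<r. a b i *\<^sub>R \<xi> i x0))"
      unfolding B_def \<Lambda>_def by (simp add: linear_sum[OF A[OF S(2)]] linear_cmul[OF A[OF S(2)]])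
    also have "\<dots> = (\<Sum>b\<in>Basis. (e \<bullet> b) *\<^sub>R b)" unfolding a ..
    finally show ?thesis by (simp add: euclidean_representation)
  qed
  obtain T where T: "open T" "x0 \<in> T" "T \<subseteq> S" "\<forall>x\<in>T. inj (B x)"
    using linear_family_injective_near[of S x0 B] S linB smooth_on_imp_continuous_on[OF sB] B0 by blast
  have linT: "linear (B x)" if "x \<in> T" for x using linB that T by blast
  have surjB: "surj (B x)" if "x \<in> T" for x
    using linear_injective_imp_surjective[OF linT[OF that]] T(4) that by blast
  define C where "C = (\<lambda>x. inv (B x))"
  have CB: "C x (B x e) = e" and BC: "B x (C x e) = e" if "x \<in> T" for x e
    using T(4) surjB that by (auto simp: C_def surj_f_inv_f)
  have linC: "linear (C x)" if "x \<in> T" for x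
    unfolding C_def using linear_injective_left_inverse[OF linT[OF that]] T(4) that
    by (intro inj_linear_imp_inv_linear linT) auto
  have sC: "smooth_on T (\<lambda>x. C x w)" for w
    by (rule smooth_on_linear_inverse[OF T(1) linT linC CB BC]) (auto intro: smooth_on_subset[OF sB T(3)])
  have sm: "smooth_on T (\<lambda>x. \<Lambda> x (C x (A x y)))"
    by (rule smooth_on_linear_family[where B=\<Lambda>, OF T(1) lin\<Lambda> smooth_on_subset[OF s\<Lambda> T(3)]],
        rule smooth_on_linear_family[where B=C, OF T(1) linC sC], assumption, rule smooth_on_subset[OF sA T(3)])
  have eq: "\<Lambda> x (C x (A x y)) = Q x y" if "x \<in> T" for x
    using Q[of x "\<Lambda> x (C x (A x y))" y] \<Lambda>V[of x] BC[OF that, of "A x y"] that T(3) by (auto simp: B_def)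
  have "smooth_on T (\<lambda>x. Q x y)" by (rule smooth_on_cong[OF T(1) eq sm])
  then show ?thesis using T by blast
qed

section \<open>Symmetry of second derivatives and existence of solutions of differential equations\<close>

text \<open>The mean value theorem is applied twice: to the difference in direction \<open>v\<close> as a function of the
  step in direction \<open>u\<close>, and then to \<open>\<lambda>y. g' y u\<close> along \<open>v\<close>.\<close>

lemma second_difference_mean_value:
  fixes g :: "'a::real_normed_vector \<Rightarrow> real"
  assumes h: "h > 0" and S: "\<And>s t. s \<in> {0..h} \<Longrightarrow> t \<in> {0..h} \<Longrightarrow> x + s *\<^sub>R u + t *\<^sub>R v \<in> S"
    and g': "\<And>y. y \<in> S \<Longrightarrow> (g has_derivative g' y) (at y)"
    and g'': "\<And>y. y \<in> S \<Longrightarrow> ((\<lambda>y. g' y u) has_derivative g'' y) (at y)"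
  obtains s t where "s \<in> {0..h}" "t \<in> {0..h}"
    "g (x + h *\<^sub>R u + h *\<^sub>R v) - g (x + h *\<^sub>R u) - g (x + h *\<^sub>R v) + g x
      = h * h * g'' (x + s *\<^sub>R u + t *\<^sub>R v) v"
proof -
  have lin': "linear (g' y)" if "y \<in> S" for y using g'[OF that] by (rule has_derivative_linear)
  have lin'': "linear (g'' y)" if "y \<in> S" for y using g''[OF that] by (rule has_derivative_linear)
  define \<phi> where "\<phi> = (\<lambda>s. g (x + s *\<^sub>R u + h *\<^sub>R v) - g (x + s *\<^sub>R u))"
  have d: "((\<lambda>s. g (x + s *\<^sub>R u + t *\<^sub>R v)) has_real_derivative g' (x + s *\<^sub>R u + t *\<^sub>R v) u) (at s)"
    if "s \<in> {0..h}" "t \<in> {0..h}" for s t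
  proof -
    have "((\<lambda>s. x + s *\<^sub>R u + t *\<^sub>R v) has_derivative (\<lambda>k. k *\<^sub>R u)) (at s)"
      by (auto intro!: derivative_eq_intros)
    from diff_chain_at[OF this g'[OF S[OF that]]] show ?thesis
      by (simp add: has_field_derivative_def o_def linear_cmul[OF lin'[OF S[OF that]]] mult_commute_abs)
  qed
  have "DERIV \<phi> s :> g' (x + s *\<^sub>R u + h *\<^sub>R v) u - g' (x + s *\<^sub>R u) u" if "0 \<le> s" "s \<le> h" for s
    using DERIV_diff[OF d[of s h] d[of s 0]] that h unfolding \<phi>_def by simp
  from MVT2[OF h this] obtain s where s: "0 < s" "s < h"
    "\<phi> h - \<phi> 0 = (h - 0) * (g' (x + s *\<^sub>R u + h *\<^sub>R v) u - g' (x + s *\<^sub>R u) u)" by auto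
  have "DERIV (\<lambda>t. g' (x + s *\<^sub>R u + t *\<^sub>R v) u) t :> g'' (x + s *\<^sub>R u + t *\<^sub>R v) v"
    if "0 \<le> t" "t \<le> h" for t
  proof -
    have "x + s *\<^sub>R u + t *\<^sub>R v \<in> S" using that s S by simp
    have "((\<lambda>t. x + s *\<^sub>R u + t *\<^sub>R v) has_derivative (\<lambda>k. k *\<^sub>R v)) (at t)"
      by (auto intro!: derivative_eq_intros)
    from diff_chain_at[OF this g''[OF \<open>_ \<in> S\<close>]] show ?thesis
      by (simp add: has_field_derivative_def o_def linear_cmul[OF lin''[OF \<open>_ \<in> S\<close>]] mult_commute_abs)
  qed
  from MVT2[OF h this] obtain t where t: "0 < t" "t < h"
    "g' (x + s *\<^sub>R u + h *\<^sub>R v) u - g' (x + s *\<^sub>R u + 0 *\<^sub>R v) u = (h - 0) * g'' (x + s *\<^sub>R u + t *\<^sub>R v) v"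
    by auto
  show ?thesis
    by (rule that[of s t]) (use s t in \<open>auto simp: \<phi>_def\<close>)
qed

text \<open>The second difference of the preceding lemma is symmetric in \<open>u\<close> and \<open>v\<close>. Hence values of the two
  mixed derivatives at points arbitrarily close to \<open>x\<close> agree, and both derivatives are continuous.\<close>

lemma mixed_derivatives_equal_real:
  fixes g :: "'a::real_normed_vector \<Rightarrow> real"
  assumes S: "open S" "x \<in> S"
    and g': "\<And>y. y \<in> S \<Longrightarrow> (g has_derivative g' y) (at y)"
    and gu: "\<And>y. y \<in> S \<Longrightarrow> ((\<lambda>y. g' y u) has_derivative gu y) (at y)"
    and gv: "\<And>y. y \<in> S \<Longrightarrow> ((\<lambda>y. g' y v) has_derivative gv y) (at y)"
    and cu: "continuous_on S (\<lambda>y. gu y v)" and cv: "continuous_on S (\<lambda>y. gv y u)"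
  shows "gu x v = gv x u"
proof (rule ccontr)
  assume ne: "gu x v \<noteq> gv x u"
  define e where "e = \<bar>gu x v - gv x u\<bar> / 2"
  have e: "e > 0" using ne by (simp add: e_def)
  have "isCont (\<lambda>y. gu y v) x" "isCont (\<lambda>y. gv y u) x"
    using cu cv S by (auto simp: continuous_on_eq_continuous_at)
  then have lu: "((\<lambda>y. gu y v) \<longlongrightarrow> gu x v) (nhds x)" and lv: "((\<lambda>y. gv y u) \<longlongrightarrow> gv x u) (nhds x)"
    using tendsto_at_iff_tendsto_nhds[of "\<lambda>y. gu y v" x] tendsto_at_iff_tendsto_nhds[of "\<lambda>y. gv y u" x]
    by (simp_all add: isCont_def)
  note tendstoD[OF lu e] tendstoD[OF lv e]
  moreover have "\<forall>\<^sub>F y in nhds x. y \<in> S" using S eventually_nhds_in_open by blast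
  ultimately have "\<forall>\<^sub>F y in nhds x. y \<in> S \<and> dist (gu y v) (gu x v) < e \<and> dist (gv y u) (gv x u) < e"
    by eventually_elim auto
  then obtain d where d: "d > 0" and D: "\<And>y. dist y x < d \<Longrightarrow> y \<in> S \<and> dist (gu y v) (gu x v) < e \<and> dist (gv y u) (gv x u) < e"
    unfolding eventually_nhds_metric by blast
  define h where "h = d / (norm u + norm v + 1)"
  have h: "h > 0" unfolding h_def using d by (intro divide_pos_pos) (auto intro: add_nonneg_pos)
  have hd: "h * (norm u + norm v) < d"
  proof -
    have "norm u + norm v + 1 \<noteq> 0" using norm_ge_zero[of u] norm_ge_zero[of v] by linarith
    then have "h * (norm u + norm v + 1) = d" by (simp add: h_def)
    then show ?thesis using h by (simp add: algebra_simps)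
  qed
  have near: "dist (x + s *\<^sub>R u + t *\<^sub>R v) x < d" if "s \<in> {0..h}" "t \<in> {0..h}" for s t
  proof -
    have "norm (s *\<^sub>R u + t *\<^sub>R v) \<le> h * norm u + h * norm v"
      by (rule order_trans[OF norm_triangle_ineq]) (use that in \<open>auto intro!: add_mono mult_right_mono\<close>)
    also have "\<dots> < d" using hd by (simp add: algebra_simps)
    finally show ?thesis by (simp add: dist_norm add.assoc)
  qed
  obtain s t where 1: "s \<in> {0..h}" "t \<in> {0..h}"
    "g (x + h *\<^sub>R u + h *\<^sub>R v) - g (x + h *\<^sub>R u) - g (x + h *\<^sub>R v) + g x
      = h * h * gu (x + s *\<^sub>R u + t *\<^sub>R v) v"
    by (rule second_difference_mean_value[of h x u v S g g' gu, OF h _ g' gu]) (use near D in blast)+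
  have near': "dist (x + s *\<^sub>R v + t *\<^sub>R u) x < d" if "s \<in> {0..h}" "t \<in> {0..h}" for s t
    using near[OF that(2,1)] by (simp add: algebra_simps)
  obtain s' t' where 2: "s' \<in> {0..h}" "t' \<in> {0..h}"
    "g (x + h *\<^sub>R v + h *\<^sub>R u) - g (x + h *\<^sub>R v) - g (x + h *\<^sub>R u) + g x
      = h * h * gv (x + s' *\<^sub>R v + t' *\<^sub>R u) u"
    by (rule second_difference_mean_value[of h x v u S g g' gv, OF h _ g' gv]) (use near' D in blast)+
  have swap: "x + h *\<^sub>R v + h *\<^sub>R u = x + h *\<^sub>R u + h *\<^sub>R v" by (simp add: algebra_simps)
  have "h * h * gu (x + s *\<^sub>R u + t *\<^sub>R v) v = h * h * gv (x + s' *\<^sub>R v + t' *\<^sub>R u) u"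
    using 1(3) 2(3)[unfolded swap] by linarith
  then have "gu (x + s *\<^sub>R u + t *\<^sub>R v) v = gv (x + s' *\<^sub>R v + t' *\<^sub>R u) u" using h by simp
  moreover have "dist (gu (x + s *\<^sub>R u + t *\<^sub>R v) v) (gu x v) < e" using D[OF near[OF 1(1,2)]] by blast
  moreover have "dist (gv (x + s' *\<^sub>R v + t' *\<^sub>R u) u) (gv x u) < e" using D[OF near'[OF 2(1,2)]] by blast
  ultimately have "dist (gu x v) (gv x u) < 2 * e"
    using dist_triangle2[of "gu x v" "gv x u" "gu (x + s *\<^sub>R u + t *\<^sub>R v) v"] by (simp add: dist_commute)
  then show False unfolding e_def dist_real_def by simp
qed

text \<open>The theorem of Picard and Lindeloef: the integral operator is a contraction of the space of bounded
  continuous functions on the line. Functions on \<open>{-d..d}\<close> are extended to the line by composition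
  with the retraction \<open>m\<close>.\<close>

lemma ode_global_lipschitz:
  fixes f :: "'a::euclidean_space \<Rightarrow> 'a"
  assumes K: "K \<ge> 0" and lip: "\<And>x y. norm (f x - f y) \<le> K * norm (x - y)"
    and d: "d > 0" "4 * d * K < 1" and bd: "\<And>x. norm (f x) \<le> b"
  obtains z :: "real \<Rightarrow> 'a" where "z 0 = z0" "\<And>t. t \<in> {-d..d} \<Longrightarrow> norm (z t - z0) \<le> 4 * d * b"
    "\<And>t. t \<in> {-d<..<d} \<Longrightarrow> (z has_vector_derivative f (z t)) (at t)"
proof -
  have b: "b \<ge> 0" using bd[of 0] norm_ge_zero order_trans by blast
  have cf: "continuous_on UNIV f"
    by (rule lipschitz_on_continuous_on[of K]) (use K lip in \<open>auto simp: lipschitz_on_def dist_norm\<close>)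
  define J where "J = (\<lambda>(z::real \<Rightarrow>\<^sub>C 'a) t. integral {-d..t} (\<lambda>s. f (apply_bcontfun z s)))"
  define m where "m = (\<lambda>t::real. max (-d) (min d t))"
  have m: "m t \<in> {-d..d}" for t using d by (auto simp: m_def)
  have cm: "continuous_on UNIV m" unfolding m_def by (intro continuous_intros)
  have cz: "continuous_on A (\<lambda>s. f (apply_bcontfun z s))" for z A
    by (rule continuous_on_compose2[OF cf]) auto
  have cJ: "continuous_on {-d..d} (J z)" for z
    unfolding J_def by (intro indefinite_integral_continuous_1 integrable_continuous_real cz)
  have Jb: "norm (J z t) \<le> 2 * d * b" if "t \<in> {-d..d}" for z t
  proof -
    have "norm (J z t) \<le> b * (t - (-d))"
      unfolding J_def by (rule integral_bound) (use that cz bd in auto)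
    also have "\<dots> \<le> b * (2 * d)" using that b by (intro mult_left_mono) auto
    finally show ?thesis by (simp add: mult_ac)
  qed
  have Jl: "norm (J z t - J w t) \<le> 2 * d * K * dist z w" if "t \<in> {-d..d}" for z w t
  proof -
    have "J z t - J w t = integral {-d..t} (\<lambda>s. f (apply_bcontfun z s) - f (apply_bcontfun w s))"
      unfolding J_def by (rule Henstock_Kurzweil_Integration.integral_diff[symmetric]) (intro integrable_continuous_real cz)+
    also have "norm \<dots> \<le> (K * dist z w) * (t - (-d))"
    proof (rule integral_bound)
      show "norm (f (apply_bcontfun z s) - f (apply_bcontfun w s)) \<le> K * dist z w" for s
        by (rule order_trans[OF lip]) (use K dist_bounded[of z s w] in \<open>auto intro!: mult_left_mono simp: dist_norm\<close>)
    qed (use that in \<open>auto intro!: continuous_on_diff cz\<close>)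
    also have "\<dots> \<le> (K * dist z w) * (2 * d)" using that K by (intro mult_left_mono) auto
    finally show ?thesis by (simp add: mult_ac)
  qed
  have z0d: "0 \<in> {-d..d}" using d by simp
  \<comment> \<open>Integrating from \<open>-d\<close> and subtracting the value at \<open>0\<close> puts the initial time at \<open>0\<close>; each of the
    two terms contributes the length \<open>2 * d\<close>, whence the constants \<open>4 * d * K\<close> and \<open>4 * d * b\<close>.\<close>
  define F where "F = (\<lambda>z t. z0 + (J z (m t) - J z 0))"
  have Fb: "norm (F z t - z0) \<le> 4 * d * b" for z t
    using norm_triangle_ineq4[of "J z (m t)" "J z 0"] Jb[OF m, of z t] Jb[of 0 z] d by (simp add: F_def)
  have F: "F z \<in> bcontfun" for z
  proof (rule bcontfun_normI)
    show "continuous_on UNIV (F z)"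
      unfolding F_def by (intro continuous_intros continuous_on_compose2[OF cJ cm]) (use m in auto)
    show "norm (F z t) \<le> norm z0 + 4 * d * b" for t
      using Fb[of z t] norm_triangle_sub[of "F z t" z0] by linarith
  qed
  define T where "T = (\<lambda>z. Bcontfun (F z))"
  have T: "apply_bcontfun (T z) = F z" for z unfolding T_def using F by (rule Bcontfun_inverse)
  have "\<exists>!z. T z = z"
  proof (rule banach_fix_type[where c="4 * d * K"])
    show "\<forall>z w. dist (T z) (T w) \<le> 4 * d * K * dist z w"
    proof (intro allI dist_bound)
      fix z w t
      have "F z t - F w t = (J z (m t) - J w (m t)) - (J z 0 - J w 0)" by (simp add: F_def)
      also have "norm \<dots> \<le> 2 * d * K * dist z w + 2 * d * K * dist z w"
        using norm_triangle_ineq4[of "J z (m t) - J w (m t)" "J z 0 - J w 0"] Jl[OF m, of z t w] Jl[OF z0d, of z w]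
        by linarith
      finally show "dist (apply_bcontfun (T z) t) (apply_bcontfun (T w) t) \<le> 4 * d * K * dist z w"
        by (simp add: T dist_norm mult_ac)
    qed
  qed (use d K in auto)
  then obtain z where z: "T z = z" by blast
  then have zF: "apply_bcontfun z = F z" using T by metis
  show ?thesis
  proof (rule that[of "apply_bcontfun z"])
    show "apply_bcontfun z 0 = z0" unfolding zF F_def m_def using d by simp
    show "norm (apply_bcontfun z t - z0) \<le> 4 * d * b" for t unfolding zF by (rule Fb)
    show "(apply_bcontfun z has_vector_derivative f (apply_bcontfun z t)) (at t)" if t: "t \<in> {-d<..<d}" for t
    proof -
      have "(J z has_vector_derivative f (apply_bcontfun z t)) (at t within {-d..d})"
        unfolding J_def by (rule integral_has_vector_derivative) (use t cz in auto)
      then have "(J z has_vector_derivative f (apply_bcontfun z t)) (at t)"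
        using t by (simp add: at_within_Icc_at)
      then have "((\<lambda>t. z0 + (J z t - J z 0)) has_vector_derivative f (apply_bcontfun z t)) (at t)"
        by (auto intro!: derivative_eq_intros)
      then show ?thesis
        by (rule has_vector_derivative_transform_within_open[where S="{-d<..<d}"])
          (use t in \<open>auto simp: zF F_def m_def\<close>)
    qed
  qed
qed

lemma second_derivative_symmetric:
  fixes f :: "'a::euclidean_space \<Rightarrow> 'b::euclidean_space"
  assumes S: "open S" "x \<in> S" and f: "smooth_on S f"
  shows "frechet_derivative (\<lambda>y. frechet_derivative f (at y) u) (at x) v
    = frechet_derivative (\<lambda>y. frechet_derivative f (at y) v) (at x) u"
proof (rule euclidean_eqI)
  fix b :: 'b assume "b \<in> Basis"
  let ?D = "\<lambda>u y. frechet_derivative (\<lambda>y. frechet_derivative f (at y) u) (at y)"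
  have c: "continuous_on S (\<lambda>y. ?D u y v \<bullet> b)" for u v
    by (intro continuous_on_inner continuous_on_const smooth_on_imp_continuous_on smooth_on_derivative f)
  show "?D u x v \<bullet> b = ?D v x u \<bullet> b"
  proof (rule mixed_derivatives_equal_real[where g="\<lambda>y. f y \<bullet> b" and g'="\<lambda>y w. frechet_derivative f (at y) w \<bullet> b"
        and gu="\<lambda>y w. ?D u y w \<bullet> b" and gv="\<lambda>y w. ?D v y w \<bullet> b"])
    show "((\<lambda>y. f y \<bullet> b) has_derivative (\<lambda>w. frechet_derivative f (at y) w \<bullet> b)) (at y)" if "y \<in> S" for y
      by (rule has_derivative_inner_left, rule smooth_on_has_derivative[OF f that])
    show "((\<lambda>y. frechet_derivative f (at y) u \<bullet> b) has_derivative (\<lambda>w. ?D u y w \<bullet> b)) (at y)" if "y \<in> S" for y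
      by (rule has_derivative_inner_left, rule smooth_on_has_derivative[OF smooth_on_derivative[OF f] that])
    show "((\<lambda>y. frechet_derivative f (at y) v \<bullet> b) has_derivative (\<lambda>w. ?D v y w \<bullet> b)) (at y)" if "y \<in> S" for y
      by (rule has_derivative_inner_left, rule smooth_on_has_derivative[OF smooth_on_derivative[OF f] that])
  qed (use S c in auto)
qed

lemma smooth_on_lipschitz_cball:
  fixes f :: "'a::euclidean_space \<Rightarrow> 'b::euclidean_space"
  assumes f: "smooth_on U f" and r: "cball z0 r \<subseteq> U"
  obtains K where "K \<ge> 0" "\<And>x y. x \<in> cball z0 r \<Longrightarrow> y \<in> cball z0 r \<Longrightarrow> norm (f x - f y) \<le> K * norm (x - y)"
proof -
  define g where "g = (\<lambda>x. \<Sum>b\<in>Basis. norm (frechet_derivative f (at x) b))"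
  have "continuous_on (cball z0 r) g"
    unfolding g_def
    by (intro continuous_on_sum continuous_on_norm continuous_on_subset[OF _ r] smooth_on_imp_continuous_on
        smooth_on_derivative f)
  then have "bounded (g ` cball z0 r)" by (intro compact_imp_bounded compact_continuous_image) auto
  then obtain K where K: "K > 0" "\<And>x. x \<in> cball z0 r \<Longrightarrow> norm (g x) \<le> K" 
    unfolding bounded_pos by blast
  have on: "onorm (frechet_derivative f (at x)) \<le> K" if "x \<in> cball z0 r" for x
  proof (rule onorm_bound)
    have "linear (frechet_derivative f (at x))"
      using has_derivative_linear[OF smooth_on_has_derivative[OF f]] that r by blast
    then have "norm (frechet_derivative f (at x) v - 0) \<le> g x * norm v" for v
      unfolding g_def using linear_diff_bound[OF _ linear_zero, of "frechet_derivative f (at x)" v] by simp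
    moreover have "g x * norm v \<le> K * norm v" for v :: 'a
      using K(2)[OF that] by (intro mult_right_mono) auto
    ultimately show "norm (frechet_derivative f (at x) v) \<le> K * norm v" for v
      using order_trans by fastforce
  qed (use K in auto)
  have df: "(f has_derivative frechet_derivative f (at x)) (at x within cball z0 r)" if "x \<in> cball z0 r" for x
    by (rule has_derivative_at_withinI, rule smooth_on_has_derivative[OF f]) (use r that in blast)
  show ?thesis
  proof (rule that[of K])
    show "norm (f x - f y) \<le> K * norm (x - y)" if "x \<in> cball z0 r" "y \<in> cball z0 r" for x y
      by (rule differentiable_bound[OF convex_cball df on that])
  qed (use K in auto)
qed

text \<open>Composed with the nearest point retraction \<open>c\<close> onto a ball around \<open>z0\<close>, the vector field becomes bounded and
  Lipschitz on the whole space. For small \<open>d\<close> the solution stays in the ball, where \<open>c\<close> is the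
  identity.\<close>

lemma ode_local_existence:
  fixes f :: "'a::euclidean_space \<Rightarrow> 'a"
  assumes U: "open U" "z0 \<in> U" and f: "smooth_on U f"
  obtains d z where "d > 0" "z 0 = z0" "\<And>t. t \<in> {-d<..<d} \<Longrightarrow> z t \<in> U"
    "\<And>t. t \<in> {-d<..<d} \<Longrightarrow> (z has_vector_derivative f (z t)) (at t)"
proof -
  obtain r where r: "r > 0" "cball z0 r \<subseteq> U" using U open_contains_cball by blast
  obtain K where K: "K \<ge> 0" "\<And>x y. x \<in> cball z0 r \<Longrightarrow> y \<in> cball z0 r \<Longrightarrow> norm (f x - f y) \<le> K * norm (x - y)"
    using smooth_on_lipschitz_cball[OF f r(2)] by blast
  define c where "c = closest_point (cball z0 r)"
  have cin: "c x \<in> cball z0 r" for x unfolding c_def by (rule closest_point_in_set) (use r in auto)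
  have clip: "norm (c x - c y) \<le> norm (x - y)" for x y
    using closest_point_lipschitz[of "cball z0 r" x y] r by (auto simp: c_def dist_norm)
  have "continuous_on (cball z0 r) f" using smooth_on_imp_continuous_on[OF f] r continuous_on_subset by blast
  then have "bounded (f ` cball z0 r)" by (intro compact_imp_bounded compact_continuous_image) auto
  then obtain b where b: "b > 0" "\<And>x. x \<in> cball z0 r \<Longrightarrow> norm (f x) \<le> b" 
    unfolding bounded_pos by blast
  define d where "d = min (1 / (8 * (K + 1))) (r / (4 * b))"
  have d: "d > 0" using K b r by (simp add: d_def)
  have "4 * d * K \<le> 4 * (1 / (8 * (K + 1))) * K" using K r b by (intro mult_mono) (auto simp: d_def)
  also have "\<dots> < 1" using K by (simp add: field_simps)
  finally have dK: "4 * d * K < 1" .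
  have "4 * d * b \<le> 4 * (r / (4 * b)) * b" using b by (intro mult_mono) (use r K in \<open>auto simp: d_def\<close>)
  also have "\<dots> = r" using b by simp
  finally have db: "4 * d * b \<le> r" .
  have flip: "norm (f (c x) - f (c y)) \<le> K * norm (x - y)" for x y
    using K(2)[OF cin cin, of x y] mult_left_mono[OF clip[of x y] K(1)] by linarith
  obtain z where z: "z 0 = z0" "\<And>t. t \<in> {-d..d} \<Longrightarrow> norm (z t - z0) \<le> 4 * d * b"
    "\<And>t. t \<in> {-d<..<d} \<Longrightarrow> (z has_vector_derivative f (c (z t))) (at t)"
    using ode_global_lipschitz[OF K(1) flip d dK b(2)[OF cin], where ?z0.0=z0] by blast
  have zin: "z t \<in> cball z0 r" if "t \<in> {-d<..<d}" for t
    using z(2)[of t] db that by (auto simp: dist_norm norm_minus_commute)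
  show ?thesis
  proof (rule that[of d z, OF d z(1)])
    show "z t \<in> U" if "t \<in> {-d<..<d}" for t using zin[OF that] r by blast
    show "(z has_vector_derivative f (z t)) (at t)" if "t \<in> {-d<..<d}" for t
      using z(3)[OF that] closest_point_self[OF zin[OF that]] by (simp add: c_def)
  qed
qed

section \<open>Differentiable maps between manifolds\<close>

lemma topspace_atlas_topology [simp]: "topspace (atlas_topology A) = points A"
proof -
  have "dom_of c \<subseteq> \<Union>{dom_of c \<inter> coord c -` V | c V. c \<in> A \<and> open V}" if "c \<in> A" for c
  proof (rule Union_upper)
    have "dom_of c = dom_of c \<inter> coord c -` UNIV" by simp
    then show "dom_of c \<in> {dom_of c \<inter> coord c -` V | c V. c \<in> A \<and> open V}"
      using that open_UNIV by blast
  qed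
  then have "(\<Union>c\<in>A. dom_of c) \<subseteq> \<Union>{dom_of c \<inter> coord c -` V | c V. c \<in> A \<and> open V}" by blast
  moreover have "\<Union>{dom_of c \<inter> coord c -` V | c V. c \<in> A \<and> open V} \<subseteq> (\<Union>c\<in>A. dom_of c)" by blast
  ultimately show ?thesis unfolding atlas_topology_def points_def topology_generated_by_topspace
    by (rule equalityI[rotated])
qed

lemma smooth_atlas_inj: "smooth_atlas A \<Longrightarrow> c \<in> A \<Longrightarrow> inj_on (coord c) (dom_of c)"
  by (simp add: smooth_atlas_def)

lemma smooth_atlas_open: "smooth_atlas A \<Longrightarrow> c \<in> A \<Longrightarrow> d \<in> A \<Longrightarrow> open (coord c ` (dom_of c \<inter> dom_of d))"
  by (simp add: smooth_atlas_def)

lemma smooth_atlas_open_chart: "smooth_atlas A \<Longrightarrow> c \<in> A \<Longrightarrow> open (coord c ` dom_of c)"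
  using smooth_atlas_open[of A c c] by simp

lemma smooth_atlas_transition:
  "smooth_atlas A \<Longrightarrow> c \<in> A \<Longrightarrow> d \<in> A \<Longrightarrow>
    smooth_on (coord c ` (dom_of c \<inter> dom_of d)) (local_rep c d (\<lambda>p. p))"
  by (simp add: smooth_atlas_def)

lemma param_coord: "smooth_atlas A \<Longrightarrow> c \<in> A \<Longrightarrow> p \<in> dom_of c \<Longrightarrow> param c (coord c p) = p"
  unfolding param_def by (rule inv_into_f_f[OF smooth_atlas_inj])

lemma coord_param: "x \<in> coord c ` dom_of c \<Longrightarrow> coord c (param c x) = x"
  unfolding param_def by (rule f_inv_into_f)

lemma param_in_dom: "x \<in> coord c ` dom_of c \<Longrightarrow> param c x \<in> dom_of c"
  unfolding param_def by (rule inv_into_into)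

text \<open>It is enough to consider the generating sets, whose images in another chart are preimages of open
  sets under a transition map.\<close>

lemma openin_atlas_imp:
  assumes A: "smooth_atlas A" and "openin (atlas_topology A) U" and c: "c \<in> A"
  shows "open (coord c ` (U \<inter> dom_of c))"
proof -
  have "generate_topology_on {dom_of c \<inter> coord c -` V | c V. c \<in> A \<and> open V} U"
    using assms(2) unfolding atlas_topology_def by (rule openin_topology_generated_by)
  then show ?thesis
  proof induction
    case Empty
    then show ?case by simp
  next
    case (Int a b)
    have "coord c ` (a \<inter> b \<inter> dom_of c) = coord c ` (a \<inter> dom_of c) \<inter> coord c ` (b \<inter> dom_of c)"
      using inj_on_image_Int[OF smooth_atlas_inj[OF A c], of "a \<inter> dom_of c" "b \<inter> dom_of c"]
      by (simp add: Int_ac)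
    then show ?case using Int.IH by auto
  next
    case (UN K)
    have "coord c ` (\<Union>K \<inter> dom_of c) = (\<Union>k\<in>K. coord c ` (k \<inter> dom_of c))" by auto
    then show ?case using UN.IH by auto
  next
    case (Basis s)
    then obtain d V where d: "s = dom_of d \<inter> coord d -` V" "d \<in> A" "open V" by blast
    let ?S = "coord c ` (dom_of c \<inter> dom_of d)"
    have "coord c ` (s \<inter> dom_of c) = ?S \<inter> local_rep c d (\<lambda>p. p) -` V"
      by (auto simp: d(1) local_rep_def param_coord[OF A c])
    moreover have "open (?S \<inter> local_rep c d (\<lambda>p. p) -` V)"
      by (rule continuous_open_preimage[OF smooth_on_imp_continuous_on[OF smooth_atlas_transition[OF A c d(2)]]
          smooth_atlas_open[OF A c d(2)] d(3)])
    ultimately show ?case by simp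
  qed
qed

lemma openin_atlas_iff:
  assumes A: "smooth_atlas A"
  shows "openin (atlas_topology A) U \<longleftrightarrow> U \<subseteq> points A \<and> (\<forall>c\<in>A. open (coord c ` (U \<inter> dom_of c)))"
proof
  assume "openin (atlas_topology A) U"
  then show "U \<subseteq> points A \<and> (\<forall>c\<in>A. open (coord c ` (U \<inter> dom_of c)))"
    using openin_atlas_imp[OF A] openin_subset by fastforce
next
  assume U: "U \<subseteq> points A \<and> (\<forall>c\<in>A. open (coord c ` (U \<inter> dom_of c)))"
  have *: "U = (\<Union>c\<in>A. dom_of c \<inter> coord c -` (coord c ` (U \<inter> dom_of c)))"
  proof (intro equalityI subsetI)
    fix p assume "p \<in> U"
    then show "p \<in> (\<Union>c\<in>A. dom_of c \<inter> coord c -` (coord c ` (U \<inter> dom_of c)))"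
      using U by (force simp: points_def)
  next
    fix p assume "p \<in> (\<Union>c\<in>A. dom_of c \<inter> coord c -` (coord c ` (U \<inter> dom_of c)))"
    then obtain c q where "c \<in> A" "p \<in> dom_of c" "q \<in> U" "q \<in> dom_of c" "coord c p = coord c q" by auto
    then show "p \<in> U" using inj_onD[OF smooth_atlas_inj[OF A \<open>c \<in> A\<close>]] by auto
  qed
  have "openin (atlas_topology A) (\<Union>c\<in>A. dom_of c \<inter> coord c -` (coord c ` (U \<inter> dom_of c)))"
  proof (intro openin_Union, safe)
    fix c assume "c \<in> A"
    then show "openin (atlas_topology A) (dom_of c \<inter> coord c -` (coord c ` (U \<inter> dom_of c)))"
      unfolding atlas_topology_def using U by (intro topology_generated_by_Basis) blast
  qed
  then show "openin (atlas_topology A) U" using * by simp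
qed

lemma openin_chart_dom: "smooth_atlas A \<Longrightarrow> c \<in> A \<Longrightarrow> openin (atlas_topology A) (dom_of c)"
  by (subst openin_atlas_iff) (auto simp: points_def Int_commute intro!: smooth_atlas_open)

lemma eventually_in_chart_image:
  assumes "smooth_atlas A" "c \<in> A" "openin (atlas_topology A) U" "p \<in> U" "p \<in> dom_of c"
  shows "\<forall>\<^sub>F x in nhds (coord c p). x \<in> coord c ` dom_of c \<and> param c x \<in> U"
proof -
  have "\<forall>\<^sub>F x in nhds (coord c p). x \<in> coord c ` (U \<inter> dom_of c)"
    by (rule eventually_nhds_in_open[OF openin_atlas_imp[OF assms(1,3,2)]]) (use assms in auto)
  then show ?thesis by (rule eventually_mono) (auto simp: param_coord[OF assms(1,2)])
qed

text \<open>The representation of \<open>f\<close> in a chart \<open>d\<close> has no meaning at points that \<open>f\<close> does not map into the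
  domain of \<open>d\<close>. Continuity of \<open>f\<close> at \<open>p\<close> therefore enters in the form that \<open>f\<close> maps a neighbourhood of \<open>p\<close> into
  every chart domain around \<open>f p\<close>.\<close>

definition mdifferentiable ::
  "('a, 'e::euclidean_space) atlas \<Rightarrow> ('b, 'f::euclidean_space) atlas \<Rightarrow> ('a \<Rightarrow> 'b) \<Rightarrow> 'a \<Rightarrow> bool" where
  "mdifferentiable A B f p \<longleftrightarrow> p \<in> points A \<and> f p \<in> points B \<and>
    (\<forall>c\<in>A. \<forall>d\<in>B. p \<in> dom_of c \<longrightarrow> f p \<in> dom_of d \<longrightarrow>
       (\<forall>\<^sub>F x in nhds (coord c p). f (param c x) \<in> dom_of d) \<and>
       local_rep c d f differentiable (at (coord c p)))"

abbreviation mderiv ::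
  "('a, 'e::euclidean_space) chart \<Rightarrow> ('b, 'f::euclidean_space) chart \<Rightarrow> ('a \<Rightarrow> 'b) \<Rightarrow> 'a \<Rightarrow> 'e \<Rightarrow> 'f" where
  "mderiv c d f p \<equiv> frechet_derivative (local_rep c d f) (at (coord c p))"

lemma mdifferentiable_has_derivative:
  "mdifferentiable A B f p \<Longrightarrow> c \<in> A \<Longrightarrow> d \<in> B \<Longrightarrow> p \<in> dom_of c \<Longrightarrow> f p \<in> dom_of d \<Longrightarrow>
    (local_rep c d f has_derivative mderiv c d f p) (at (coord c p))"
  by (simp add: mdifferentiable_def frechet_derivative_works)

lemma mdifferentiable_eventually:
  "mdifferentiable A B f p \<Longrightarrow> c \<in> A \<Longrightarrow> d \<in> B \<Longrightarrow> p \<in> dom_of c \<Longrightarrow> f p \<in> dom_of d \<Longrightarrow>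
    \<forall>\<^sub>F x in nhds (coord c p). f (param c x) \<in> dom_of d"
  by (simp add: mdifferentiable_def)

lemma has_derivative_transform_eventually_nhds:
  assumes "(f has_derivative D) (at x)" "\<forall>\<^sub>F y in nhds x. f y = g y"
  shows "(g has_derivative D) (at x)"
  using has_derivative_transform_eventually[OF assms(1), of g] assms(2)
    eventually_nhds_x_imp_x[OF assms(2)] by (simp add: eventually_at_filter eventually_mono)

lemma local_rep_coord: "smooth_atlas A \<Longrightarrow> c \<in> A \<Longrightarrow> p \<in> dom_of c \<Longrightarrow> local_rep c d f (coord c p) = coord d (f p)"
  by (simp add: local_rep_def param_coord)

lemma local_rep_compose:
  "smooth_atlas B \<Longrightarrow> d \<in> B \<Longrightarrow> f (param c x) \<in> dom_of d \<Longrightarrow>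
    local_rep d e g (local_rep c d f x) = local_rep c e (\<lambda>q. g (f q)) x"
  by (simp add: local_rep_def param_coord)

lemma mderiv_chain:
  assumes A: "smooth_atlas A" and B: "smooth_atlas B" and c: "c \<in> A" "p \<in> dom_of c" and d: "d \<in> B" "f p \<in> dom_of d"
    and f: "(local_rep c d f has_derivative Df) (at (coord c p))"
    and ev: "\<forall>\<^sub>F x in nhds (coord c p). f (param c x) \<in> dom_of d"
    and g: "(local_rep d e g has_derivative Dg) (at (coord d (f p)))"
  shows "(local_rep c e (\<lambda>q. g (f q)) has_derivative (\<lambda>v. Dg (Df v))) (at (coord c p))"
proof -
  have "((\<lambda>x. local_rep d e g (local_rep c d f x)) has_derivative (\<lambda>v. Dg (Df v))) (at (coord c p))"
    using diff_chain_at[OF f, of "local_rep d e g" Dg] g by (simp add: local_rep_coord[OF A c] o_def)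
  then show ?thesis
    by (rule has_derivative_transform_eventually_nhds)
      (use ev in \<open>rule eventually_mono\<close>, simp add: local_rep_compose[OF B d(1)])
qed

lemma eventually_local_rep:
  assumes A: "smooth_atlas A" and B: "smooth_atlas B" and c: "c \<in> A" "p \<in> dom_of c" and d: "d \<in> B" "f p \<in> dom_of d"
    and f: "isCont (local_rep c d f) (coord c p)"
    and ev: "\<forall>\<^sub>F x in nhds (coord c p). f (param c x) \<in> dom_of d"
    and P: "\<forall>\<^sub>F y in nhds (coord d (f p)). P (param d y)"
  shows "\<forall>\<^sub>F x in nhds (coord c p). P (f (param c x))"
proof -
  have "(local_rep c d f \<longlongrightarrow> coord d (f p)) (nhds (coord c p))"
    using f tendsto_at_iff_tendsto_nhds[of "local_rep c d f" "coord c p"] local_rep_coord[OF A c, of d f]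
    by (simp add: isCont_def)
  then have "\<forall>\<^sub>F x in nhds (coord c p). P (param d (local_rep c d f x))"
    using P by (rule eventually_compose_filterlim[rotated])
  then show ?thesis using ev
    by eventually_elim (simp add: local_rep_def param_coord[OF B d(1)])
qed

lemma mdifferentiable_compose:
  assumes A: "smooth_atlas A" and B: "smooth_atlas B"
    and f: "mdifferentiable A B f p" and g: "mdifferentiable B C g (f p)"
  shows "mdifferentiable A C (\<lambda>q. g (f q)) p"
  unfolding mdifferentiable_def
proof (intro conjI ballI impI)
  show "p \<in> points A" "g (f p) \<in> points C" using f g by (auto simp: mdifferentiable_def)
  fix c e assume c: "c \<in> A" "p \<in> dom_of c" and e: "e \<in> C" "g (f p) \<in> dom_of e"
  obtain d where d: "d \<in> B" "f p \<in> dom_of d" using f by (auto simp: mdifferentiable_def points_def)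
  note df = mdifferentiable_has_derivative[OF f c(1) d(1) c(2) d(2)]
  note evf = mdifferentiable_eventually[OF f c(1) d(1) c(2) d(2)]
  note dg = mdifferentiable_has_derivative[OF g d(1) e(1) d(2) e(2)]
  note evg = mdifferentiable_eventually[OF g d(1) e(1) d(2) e(2)]
  show "local_rep c e (\<lambda>q. g (f q)) differentiable at (coord c p)"
    using mderiv_chain[of A B c p d f, OF A B c d df evf dg] by (auto simp: differentiable_def)
  show "\<forall>\<^sub>F x in nhds (coord c p). g (f (param c x)) \<in> dom_of e"
    by (rule eventually_local_rep[of A B c p d f "\<lambda>q. g q \<in> dom_of e", OF A B c d has_derivative_continuous[OF df] evf evg])
qed

lemma mdifferentiable_transition:
  assumes A: "smooth_atlas A" and p: "p \<in> points A"
  shows "mdifferentiable A A (\<lambda>q. q) p"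
  unfolding mdifferentiable_def
proof (intro conjI ballI impI p)
  fix c d assume c: "c \<in> A" "p \<in> dom_of c" and d: "d \<in> A" "p \<in> dom_of d"
  show "local_rep c d (\<lambda>q. q) differentiable at (coord c p)"
    using smooth_on_has_derivative[OF smooth_atlas_transition[OF A c(1) d(1)], of "coord c p"] c d
    by (auto simp: differentiable_def)
  show "\<forall>\<^sub>F x in nhds (coord c p). param c x \<in> dom_of d"
    using eventually_in_chart_image[OF A c(1) openin_chart_dom[OF A d(1)] d(2) c(2)]
    by (rule eventually_mono) simp
qed

text \<open>One pair of charts suffices: the representations in two pairs of charts differ by transition maps,
  which are differentiable.\<close>

lemma mdifferentiableI:
  assumes A: "smooth_atlas A" and B: "smooth_atlas B" and c: "c \<in> A" "p \<in> dom_of c" and d: "d \<in> B" "f p \<in> dom_of d"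
    and f: "(local_rep c d f has_derivative Df) (at (coord c p))"
    and ev: "\<forall>\<^sub>F x in nhds (coord c p). f (param c x) \<in> dom_of d"
  shows "mdifferentiable A B f p"
  unfolding mdifferentiable_def
proof (intro conjI ballI impI)
  show p: "p \<in> points A" "f p \<in> points B" using c d by (auto simp: points_def)
  fix c' d' assume c': "c' \<in> A" "p \<in> dom_of c'" and d': "d' \<in> B" "f p \<in> dom_of d'"
  note idA = mdifferentiable_transition[OF A p(1)] and idB = mdifferentiable_transition[OF B p(2)]
  note dA = mdifferentiable_has_derivative[OF idA c'(1) c(1) c'(2) c(2)]
  note eA = mdifferentiable_eventually[OF idA c'(1) c(1) c'(2) c(2)]
  note dB = mdifferentiable_has_derivative[OF idB d(1) d'(1) d(2) d'(2)]
  note eB = mdifferentiable_eventually[OF idB d(1) d'(1) d(2) d'(2)]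
  have 1: "(local_rep c' d f has_derivative (\<lambda>v. Df (mderiv c' c (\<lambda>q. q) p v))) (at (coord c' p))"
    by (rule mderiv_chain[OF A A c' c dA eA f])
  have 2: "\<forall>\<^sub>F x in nhds (coord c' p). f (param c' x) \<in> dom_of d"
    by (rule eventually_local_rep[of A A c' p c "\<lambda>q. q" "\<lambda>q. f q \<in> dom_of d", OF A A c' c has_derivative_continuous[OF dA] eA ev])
  show "local_rep c' d' f differentiable at (coord c' p)"
    using mderiv_chain[of A B c' p d f, OF A B c' d 1 2 dB] by (auto simp: differentiable_def)
  show "\<forall>\<^sub>F x in nhds (coord c' p). f (param c' x) \<in> dom_of d'"
    by (rule eventually_local_rep[of A B c' p d f "\<lambda>q. q \<in> dom_of d'", OF A B c' d has_derivative_continuous[OF 1] 2 eB])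
qed

lemma smooth_map_in_points: "smooth_map A B f \<Longrightarrow> p \<in> points A \<Longrightarrow> f p \<in> points B"
  unfolding smooth_map_def using continuous_map_funspace by fastforce

lemma smooth_map_openin:
  assumes "smooth_atlas B" "smooth_map A B f" "d \<in> B"
  shows "openin (atlas_topology A) {p \<in> points A. f p \<in> dom_of d}"
  using openin_continuous_map_preimage[OF _ openin_chart_dom[OF assms(1,3)], of "atlas_topology A" f] assms(2)
  by (simp add: smooth_map_def)

lemma smooth_map_open_image:
  assumes A: "smooth_atlas A" and B: "smooth_atlas B" and f: "smooth_map A B f" and c: "c \<in> A" and d: "d \<in> B"
  shows "open (coord c ` (dom_of c \<inter> f -` dom_of d))"
proof -
  have "{p \<in> points A. f p \<in> dom_of d} \<inter> dom_of c = dom_of c \<inter> f -` dom_of d"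
    using c by (auto simp: points_def)
  then show ?thesis using openin_atlas_imp[OF A smooth_map_openin[OF B f d] c] by simp
qed

lemma smooth_map_smooth_on:
  "smooth_map A B f \<Longrightarrow> c \<in> A \<Longrightarrow> d \<in> B \<Longrightarrow> smooth_on (coord c ` (dom_of c \<inter> f -` dom_of d)) (local_rep c d f)"
  by (simp add: smooth_map_def)

lemma smooth_map_imp_mdifferentiable:
  assumes A: "smooth_atlas A" and B: "smooth_atlas B" and f: "smooth_map A B f" and p: "p \<in> points A"
  shows "mdifferentiable A B f p"
  unfolding mdifferentiable_def
proof (intro conjI ballI impI p smooth_map_in_points[OF f p])
  fix c d assume c: "c \<in> A" "p \<in> dom_of c" and d: "d \<in> B" "f p \<in> dom_of d"
  show "local_rep c d f differentiable at (coord c p)"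
    using smooth_on_has_derivative[OF smooth_map_smooth_on[OF f c(1) d(1)], of "coord c p"] c d
    by (auto simp: differentiable_def)
  show "\<forall>\<^sub>F x in nhds (coord c p). f (param c x) \<in> dom_of d"
    using eventually_in_chart_image[OF A c(1) smooth_map_openin[OF B f d(1)] _ c(2)] p d(2)
    by (simp add: eventually_mono)
qed

section \<open>Tangent vectors and tangent maps\<close>

subsection \<open>tangent\<close>

lemma tangent_space_base: "u \<in> tangent_space A p \<Longrightarrow> base u = p"
  by (simp add: tangent_space_def)

lemma tangent_space_points: "u \<in> tangent_space A p \<Longrightarrow> p \<in> points A"
  by (simp add: tangent_space_def)

lemma tangent_space_comp:
  "u \<in> tangent_space A p \<Longrightarrow> c \<in> A \<Longrightarrow> d \<in> A \<Longrightarrow> p \<in> dom_of c \<Longrightarrow> p \<in> dom_of d \<Longrightarrow>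
    comp_in u d = mderiv c d (\<lambda>q. q) p (comp_in u c)"
  unfolding tangent_space_def by blast

lemma tangent_space_comp_zero:
  "u \<in> tangent_space A p \<Longrightarrow> \<not> (c \<in> A \<and> p \<in> dom_of c) \<Longrightarrow> comp_in u c = 0"
  unfolding tangent_space_def by blast

text \<open>The transformation law determines all components from those in one chart.\<close>

lemma tangent_eqI:
  assumes u: "u \<in> tangent_space A p" and v: "v \<in> tangent_space A p" and c: "c \<in> A" "p \<in> dom_of c"
    and eq: "comp_in u c = comp_in v c"
  shows "u = v"
proof (rule prod_eqI)
  show "base u = base v" using u v by (simp add: tangent_space_base)
  show "comp_in u = comp_in v"
  proof
    fix d show "comp_in u d = comp_in v d"
    proof (cases "d \<in> A \<and> p \<in> dom_of d")
      case True
      then show ?thesis using tangent_space_comp[OF u c(1) _ c(2), of d] tangent_space_comp[OF v c(1) _ c(2), of d] eq by simp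
    next
      case False
      then show ?thesis using tangent_space_comp_zero[OF u] tangent_space_comp_zero[OF v] by simp
    qed
  qed
qed

lemma mderiv_chain_eq:
  assumes "smooth_atlas A" "smooth_atlas B" "c \<in> A" "p \<in> dom_of c" "d \<in> B" "f p \<in> dom_of d" "e \<in> C" "g (f p) \<in> dom_of e"
    and f: "mdifferentiable A B f p" and g: "mdifferentiable B C g (f p)"
  shows "mderiv c e (\<lambda>q. g (f q)) p v = mderiv d e g (f p) (mderiv c d f p v)"
proof -
  have df: "(local_rep c d f has_derivative mderiv c d f p) (at (coord c p))"
    using assms by (simp add: mdifferentiable_has_derivative)
  have ev: "\<forall>\<^sub>F x in nhds (coord c p). f (param c x) \<in> dom_of d"
    using assms by (simp add: mdifferentiable_eventually)
  have dg: "(local_rep d e g has_derivative mderiv d e g (f p)) (at (coord d (f p)))"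
    using mdifferentiable_has_derivative[OF g assms(5,7,6,8)] .
  have h: "(local_rep c e (\<lambda>q. g (f q)) has_derivative (\<lambda>v. mderiv d e g (f p) (mderiv c d f p v))) (at (coord c p))"
    using mderiv_chain[where f=f and g=g and p=p and c=c and d=d and e=e and A=A and B=B and Df="mderiv c d f p" and Dg="mderiv d e g (f p)"]
     df ev dg assms(1-6) by blast
  have "(\<lambda>v. mderiv d e g (f p) (mderiv c d f p v)) = frechet_derivative (local_rep c e (\<lambda>q. g (f q))) (at (coord c p))"
    using h by (rule frechet_derivative_at)
  then show ?thesis by (rule fun_cong[symmetric])
qed

lemma mderiv_eq_of_eventually:
  assumes ev: "\<forall>\<^sub>F x in nhds (coord c p). local_rep c d f x = local_rep c d g x"
    and "(local_rep c d f has_derivative D) (at (coord c p))"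
  shows "mderiv c d g p = D"
proof -
  have "(local_rep c d g has_derivative D) (at (coord c p))"
    by (rule has_derivative_transform_eventually_nhds[of "local_rep c d f"]) (use assms in auto)
  then show ?thesis by (rule frechet_derivative_at[symmetric])
qed

lemma mderiv_same_chart:
  assumes A: "smooth_atlas A" and c: "c \<in> A" "p \<in> dom_of c"
  shows "mderiv c c (\<lambda>q. q) p = (\<lambda>v. v)"
proof -
  have "\<forall>\<^sub>F x in nhds (coord c p). x \<in> coord c ` dom_of c"
    by (rule eventually_nhds_in_open[OF smooth_atlas_open_chart[OF A c(1)]]) (use c in auto)
  then have "\<forall>\<^sub>F x in nhds (coord c p). x = local_rep c c (\<lambda>q. q) x"
    unfolding local_rep_def by (rule eventually_mono) (rule coord_param[symmetric])
  with has_derivative_ident have "(local_rep c c (\<lambda>q. q) has_derivative (\<lambda>v. v)) (at (coord c p))"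
    by (rule has_derivative_transform_eventually_nhds)
  then show ?thesis by (rule frechet_derivative_at[symmetric])
qed

lemma coord_vector_base [simp]: "base (coord_vector A c p a) = p"
  by (simp add: coord_vector_def)

lemma tangent_spaceI:
  assumes "base u = p" "p \<in> points A"
    and "\<And>c d. c \<in> A \<Longrightarrow> d \<in> A \<Longrightarrow> p \<in> dom_of c \<Longrightarrow> p \<in> dom_of d \<Longrightarrow>
      comp_in u d = mderiv c d (\<lambda>q. q) p (comp_in u c)"
    and "\<And>c. \<not> (c \<in> A \<and> p \<in> dom_of c) \<Longrightarrow> comp_in u c = 0"
  shows "u \<in> tangent_space A p"
  unfolding tangent_space_def
  by (intro CollectI conjI ballI impI allI assms(1,2); (elim conjE)?; (rule assms(3) assms(4)); assumption)

lemma coord_vector_in_tangent_space: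
  assumes A: "smooth_atlas A" and c: "c \<in> A" "p \<in> dom_of c"
  shows "coord_vector A c p a \<in> tangent_space A p"
proof -
  have p: "p \<in> points A" using c by (auto simp: points_def)
  have 1: "mderiv c e (\<lambda>q. q) p a = mderiv d e (\<lambda>q. q) p (mderiv c d (\<lambda>q. q) p a)"
    if "d \<in> A" "e \<in> A" "p \<in> dom_of d" "p \<in> dom_of e" for d e
    using mderiv_chain_eq[OF A A c that(1) _ that(2), of "\<lambda>q. q" "\<lambda>q. q" a] that mdifferentiable_transition[OF A p]
    by simp
  show ?thesis
  proof (rule tangent_spaceI)
    fix d e assume "d \<in> A" "e \<in> A" "p \<in> dom_of d" "p \<in> dom_of e"
    from this 1[OF this] show "comp_in (coord_vector A c p a) e = mderiv d e (\<lambda>q. q) p (comp_in (coord_vector A c p a) d)"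
      by (simp only: coord_vector_def snd_conv if_True simp_thms)
  qed (auto simp: p coord_vector_def)
qed

lemma coord_vector_comp:
  assumes "smooth_atlas A" "c \<in> A" "p \<in> dom_of c"
  shows "comp_in (coord_vector A c p a) c = a"
  by (simp only: coord_vector_def snd_conv if_True simp_thms assms mderiv_same_chart[OF assms])

lemma coord_vector_of_comp:
  assumes "smooth_atlas A" "c \<in> A" "p \<in> dom_of c" "u \<in> tangent_space A p"
  shows "coord_vector A c p (comp_in u c) = u"
proof (rule tangent_eqI)
  show "coord_vector A c p (comp_in u c) \<in> tangent_space A p"
    by (rule coord_vector_in_tangent_space[OF assms(1-3)])
  show "comp_in (coord_vector A c p (comp_in u c)) c = comp_in u c"
    by (rule coord_vector_comp[OF assms(1-3)])
qed (use assms in auto)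

lemma chart_at: "p \<in> points A \<Longrightarrow> chart_at A p \<in> A \<and> p \<in> dom_of (chart_at A p)"
  unfolding chart_at_def by (rule someI_ex) (auto simp: points_def)

lemma tangent_map_base [simp]: "base (tangent_map A B f u) = f (base u)"
  by (simp add: tangent_map_def Let_def)

text \<open>The definition of \<open>tangent_map\<close> uses the chart selected by \<open>chart_at\<close>; by the chain rule and the
  transformation law every other chart gives the same result.\<close>

lemma tangent_map_comp:
  assumes A: "smooth_atlas A" and f: "mdifferentiable A B f p" and u: "u \<in> tangent_space A p"
    and c: "c \<in> A" "p \<in> dom_of c" and d: "d \<in> B" "f p \<in> dom_of d"
  shows "comp_in (tangent_map A B f u) d = mderiv c d f p (comp_in u c)"
proof -
  have b: "base u = p" and p: "p \<in> points A" using tangent_space_base[OF u] tangent_space_points[OF u] by auto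
  let ?c = "chart_at A p"
  have "mderiv c d f p (comp_in u c) = mderiv ?c d f p (mderiv c ?c (\<lambda>q. q) p (comp_in u c))"
    using mderiv_chain_eq[OF A A c _ _ d(1), of ?c "\<lambda>q. q" f "comp_in u c"] chart_at[OF p] d(2)
      mdifferentiable_transition[OF A p] f by simp
  then show ?thesis
    using tangent_space_comp[OF u c(1) _ c(2), of ?c] chart_at[OF p] d by (simp add: tangent_map_def Let_def b)
qed

lemma tangent_map_in_tangent_space:
  assumes A: "smooth_atlas A" and B: "smooth_atlas B" and f: "mdifferentiable A B f p" and u: "u \<in> tangent_space A p"
  shows "tangent_map A B f u \<in> tangent_space B (f p)"
proof -
  have b: "base u = p" and p: "p \<in> points A" using tangent_space_base[OF u] tangent_space_points[OF u] by auto
  have fp: "f p \<in> points B" using f by (simp add: mdifferentiable_def)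
  obtain c where c: "c \<in> A" "p \<in> dom_of c" using p by (auto simp: points_def)
  have 1: "comp_in (tangent_map A B f u) e = mderiv d e (\<lambda>q. q) (f p) (comp_in (tangent_map A B f u) d)"
    if "d \<in> B" "e \<in> B" "f p \<in> dom_of d" "f p \<in> dom_of e" for d e
    using mderiv_chain_eq[where A=A and B=B and C=B and p=p and f=f and g="\<lambda>q. q" and v="comp_in u c" and c=c and d=d and e=e,
        OF A B c that(1) that(3) that(2) that(4) f mdifferentiable_transition[OF B fp]]
      tangent_map_comp[OF A f u c that(1) that(3)] tangent_map_comp[OF A f u c that(2) that(4)] by simp
  have 2: "comp_in (tangent_map A B f u) d = 0" if "\<not> (d \<in> B \<and> f p \<in> dom_of d)" for d
    using that by (auto simp: tangent_map_def Let_def b)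
  show ?thesis by (rule tangent_spaceI[OF _ fp 1 2]) (simp add: b)
qed

text \<open>Functoriality, proved in components: it is the chain rule in charts around \<open>p\<close>, \<open>f p\<close> and \<open>g (f p)\<close>.\<close>

lemma tangent_map_compose:
  assumes A: "smooth_atlas A" and B: "smooth_atlas B" and C: "smooth_atlas C"
    and f: "mdifferentiable A B f p" and g: "mdifferentiable B C g (f p)" and u: "u \<in> tangent_space A p"
  shows "tangent_map B C g (tangent_map A B f u) = tangent_map A C (\<lambda>q. g (f q)) u"
proof -
  obtain c where c: "c \<in> A" "p \<in> dom_of c" using tangent_space_points[OF u] by (auto simp: points_def)
  obtain d where d: "d \<in> B" "f p \<in> dom_of d" using f by (auto simp: mdifferentiable_def points_def)
  obtain e where e: "e \<in> C" "g (f p) \<in> dom_of e" using g by (auto simp: mdifferentiable_def points_def)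
  note fu = tangent_map_in_tangent_space[OF A B f u]
  note gf = mdifferentiable_compose[OF A B f g]
  show ?thesis
    by (rule tangent_eqI[OF tangent_map_in_tangent_space[OF B C g fu] tangent_map_in_tangent_space[OF A C gf u] e])
      (simp add: tangent_map_comp[OF B g fu d e] tangent_map_comp[OF A gf u c e] tangent_map_comp[OF A f u c d]
        mderiv_chain_eq[where A=A and B=B and C=C and p=p and f=f and g=g and c=c and d=d and e=e, OF A B c d e f g])
qed

lemma local_rep_cong_eventually:
  assumes A: "smooth_atlas A" and c: "c \<in> A" "p \<in> dom_of c" and eq: "\<And>q. q \<in> points A \<Longrightarrow> f q = g q"
  shows "\<forall>\<^sub>F x in nhds (coord c p). x \<in> coord c ` dom_of c \<and> f (param c x) = g (param c x)"
  using eventually_in_chart_image[OF A c(1) openin_chart_dom[OF A c(1)] c(2) c(2)]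
  by (rule eventually_mono) (use c eq in \<open>auto simp: points_def\<close>)

lemma tangent_map_cong:
  assumes A: "smooth_atlas A" and f: "mdifferentiable A B f p" and u: "u \<in> tangent_space A p"
    and eq: "\<And>q. q \<in> points A \<Longrightarrow> f q = g q"
  shows "tangent_map A B f u = tangent_map A B g u"
proof -
  have b: "base u = p" and p: "p \<in> points A" using tangent_space_base[OF u] tangent_space_points[OF u] by auto
  note c = chart_at[OF p]
  have "mderiv (chart_at A p) d f p = mderiv (chart_at A p) d g p" if "d \<in> B" "f p \<in> dom_of d" for d
  proof -
    have "\<forall>\<^sub>F x in nhds (coord (chart_at A p) p). local_rep (chart_at A p) d f x = local_rep (chart_at A p) d g x"
      by (rule eventually_mono[OF local_rep_cong_eventually[OF A _ _ eq, where c="chart_at A p" and p=p]])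
        (use c in \<open>auto simp: local_rep_def\<close>)
    from mderiv_eq_of_eventually[OF this mdifferentiable_has_derivative[OF f _ that(1) _ that(2)]] c
    show ?thesis by simp
  qed
  then show ?thesis using eq[OF p] by (auto simp: tangent_map_def Let_def b)
qed

lemma tangent_map_ident:
  assumes A: "smooth_atlas A" and u: "u \<in> tangent_space A p"
  shows "tangent_map A A (\<lambda>q. q) u = u"
proof -
  have p: "p \<in> points A" by (rule tangent_space_points[OF u])
  then obtain c where c: "c \<in> A" "p \<in> dom_of c" by (auto simp: points_def)
  note i = mdifferentiable_transition[OF A p]
  show ?thesis
    by (rule tangent_eqI[OF tangent_map_in_tangent_space[OF A A i u] u c])
     (simp add: tangent_map_comp[OF A i u c c] mderiv_same_chart[OF A c])
qed

section \<open>The tangent bundle and its open submanifolds\<close>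

lemma points_tangent_bundle: "u \<in> points (tangent_bundle A) \<longleftrightarrow> u \<in> tangent_space A (base u)"
proof
  assume "u \<in> points (tangent_bundle A)"
  then obtain p where u: "u \<in> tangent_space A p" by (auto simp: points_def tangent_bundle_def tangent_chart_def)
  then show "u \<in> tangent_space A (base u)" using tangent_space_base[OF u] by simp
next
  assume u: "u \<in> tangent_space A (base u)"
  then obtain c where "c \<in> A" "base u \<in> dom_of c" using tangent_space_points[OF u] unfolding points_def by blast
  then show "u \<in> points (tangent_bundle A)"
    using u by (auto simp: points_def tangent_bundle_def tangent_chart_def)
qed

lemma tangent_chart_dom: "u \<in> dom_of (tangent_chart A c) \<longleftrightarrow> base u \<in> dom_of c \<and> u \<in> tangent_space A (base u)"
proof
  assume "u \<in> dom_of (tangent_chart A c)"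
  then obtain p where "p \<in> dom_of c" "u \<in> tangent_space A p" by (auto simp: tangent_chart_def)
  then show "base u \<in> dom_of c \<and> u \<in> tangent_space A (base u)" using tangent_space_base[of u A p] by simp
qed (auto simp: tangent_chart_def)

lemma tangent_chart_coord [simp]: "coord (tangent_chart A c) u = (coord c (base u), comp_in u c)"
  by (simp add: tangent_chart_def)

lemma tangent_chart_in_bundle: "c \<in> A \<Longrightarrow> tangent_chart A c \<in> tangent_bundle A"
  by (simp add: tangent_bundle_def)

lemma tangent_chart_inj:
  assumes A: "smooth_atlas A" and c: "c \<in> A"
  shows "inj_on (coord (tangent_chart A c)) (dom_of (tangent_chart A c))"
proof (rule inj_onI)
  fix u v assume u: "u \<in> dom_of (tangent_chart A c)" and v: "v \<in> dom_of (tangent_chart A c)"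
    and eq: "coord (tangent_chart A c) u = coord (tangent_chart A c) v"
  have b: "base u = base v"
    using inj_onD[OF smooth_atlas_inj[OF A c], of "base u" "base v"] u v eq by (simp add: tangent_chart_dom)
  have "u \<in> tangent_space A (base u)" "v \<in> tangent_space A (base u)" "base u \<in> dom_of c"
    using u v unfolding tangent_chart_dom b by simp_all
  then show "u = v"
    using tangent_eqI[of u A "base u" v c] c eq by simp
qed

lemma tangent_chart_image:
  fixes A :: "('a, 'e::euclidean_space) atlas"
  assumes A: "smooth_atlas A" and c: "c \<in> A" and U: "U \<subseteq> dom_of c"
  shows "coord (tangent_chart A c) ` {u. base u \<in> U \<and> u \<in> tangent_space A (base u)} = coord c ` U \<times> UNIV"
proof (intro equalityI subsetI)
  fix z :: "'e \<times> 'e" assume "z \<in> coord c ` U \<times> UNIV"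
  then obtain p y where p: "p \<in> U" "z = (coord c p, y)" by auto
  have "coord_vector A c p y \<in> tangent_space A p" using coord_vector_in_tangent_space[OF A c] U p by blast
  moreover have "coord (tangent_chart A c) (coord_vector A c p y) = z"
    using coord_vector_comp[OF A c] U p by auto
  ultimately show "z \<in> coord (tangent_chart A c) ` {u. base u \<in> U \<and> u \<in> tangent_space A (base u)}"
    using p by (intro image_eqI[of _ _ "coord_vector A c p y"]) auto
qed auto

lemma tangent_chart_image_dom:
  assumes A: "smooth_atlas A" and c: "c \<in> A"
  shows "coord (tangent_chart A c) ` dom_of (tangent_chart A c) = coord c ` dom_of c \<times> UNIV"
proof -
  have "dom_of (tangent_chart A c) = {u. base u \<in> dom_of c \<and> u \<in> tangent_space A (base u)}"
    by (simp add: set_eq_iff tangent_chart_dom)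
  then show ?thesis using tangent_chart_image[OF A c, of "dom_of c"] by simp
qed

lemma tangent_chart_param:
  assumes A: "smooth_atlas A" and c: "c \<in> A" and x: "x \<in> coord c ` dom_of c"
  shows "param (tangent_chart A c) (x, y) = coord_vector A c (param c x) y"
proof -
  note p = param_in_dom[OF x]
  let ?u = "coord_vector A c (param c x) y"
  have u: "?u \<in> dom_of (tangent_chart A c)"
    using coord_vector_in_tangent_space[OF A c p] p by (simp add: tangent_chart_dom)
  have "coord (tangent_chart A c) ?u = (x, y)" using coord_vector_comp[OF A c p] coord_param[OF x] by simp
  then show ?thesis unfolding param_def[of "tangent_chart A c"] using inv_into_f_f[OF tangent_chart_inj[OF A c] u] by simp
qed

lemma smooth_on_tangent:
  fixes f :: "'a::euclidean_space \<Rightarrow> 'b::euclidean_space"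
  assumes S: "open S" and f: "smooth_on S f"
  shows "smooth_on (S \<times> UNIV) (\<lambda>z. (f (fst z), frechet_derivative f (at (fst z)) (snd z)))"
proof -
  have O: "open (S \<times> (UNIV :: 'a set))" using S by (simp add: open_Times)
  have 1: "smooth_on (S \<times> UNIV) (\<lambda>z::'a \<times> 'a. f (fst z))"
    by (rule smooth_on_compose[OF O S smooth_on_fst[OF O] f]) auto
  have "linear (frechet_derivative f (at x))" if "x \<in> S" for x
    by (rule has_derivative_linear[OF smooth_on_has_derivative[OF f that]])
  from smooth_on_Pair[OF O 1 smooth_on_linear_family_pair[OF S this smooth_on_derivative[OF f]]]
  show ?thesis .
qed

lemma local_rep_tangent_map:
  assumes A: "smooth_atlas A" and c: "c \<in> A" and d: "d \<in> B" and x: "x \<in> coord c ` dom_of c" and fx: "f (param c x) \<in> dom_of d"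
    and f: "mdifferentiable A B f (param c x)"
  shows "local_rep (tangent_chart A c) (tangent_chart B d) (tangent_map A B f) (x, y)
    = (local_rep c d f x, frechet_derivative (local_rep c d f) (at x) y)"
proof -
  note p = param_in_dom[OF x]
  note u = coord_vector_in_tangent_space[OF A c p, of y]
  have "comp_in (tangent_map A B f (coord_vector A c (param c x) y)) d = frechet_derivative (local_rep c d f) (at x) y"
    unfolding tangent_map_comp[OF A f u c p d fx] coord_vector_comp[OF A c p] coord_param[OF x] ..
  then show ?thesis
    unfolding local_rep_def[of "tangent_chart A c"] tangent_chart_param[OF A c x] by (simp add: local_rep_def)
qed

lemma transition_tangent:
  assumes A: "smooth_atlas A" and c: "c \<in> A" and d: "d \<in> A" and x: "x \<in> coord c ` dom_of c" and dx: "param c x \<in> dom_of d"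
  shows "local_rep (tangent_chart A c) (tangent_chart A d) (\<lambda>u. u) (x, y)
    = (local_rep c d (\<lambda>p. p) x, frechet_derivative (local_rep c d (\<lambda>p. p)) (at x) y)"
proof -
  note p = param_in_dom[OF x]
  note u = coord_vector_in_tangent_space[OF A c p, of y]
  have "comp_in (coord_vector A c (param c x) y) d = frechet_derivative (local_rep c d (\<lambda>p. p)) (at x) y"
    unfolding tangent_space_comp[OF u c d p dx] coord_vector_comp[OF A c p] coord_param[OF x] ..
  then show ?thesis
    unfolding local_rep_def[of "tangent_chart A c"] tangent_chart_param[OF A c x] by (simp add: local_rep_def)
qed

text \<open>A transition map of the natural charts is \<open>(x, y) \<mapsto> (\<tau> x, D\<tau>(x) y)\<close> for a transition map \<open>\<tau>\<close> of the
  base, and therefore smooth.\<close>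

lemma smooth_atlas_tangent_bundle:
  assumes A: "smooth_atlas A"
  shows "smooth_atlas (tangent_bundle A)"
  unfolding smooth_atlas_def tangent_bundle_def
proof (intro conjI ballI; elim imageE; hypsubst)
  fix c assume c: "c \<in> A"
  show "inj_on (coord (tangent_chart A c)) (dom_of (tangent_chart A c))" by (rule tangent_chart_inj[OF A c])
next
  fix c d assume c: "c \<in> A" and d: "d \<in> A"
  have "dom_of (tangent_chart A c) \<inter> dom_of (tangent_chart A d)
    = {u. base u \<in> dom_of c \<inter> dom_of d \<and> u \<in> tangent_space A (base u)}"
    by (auto simp only: tangent_chart_dom Int_iff mem_Collect_eq)
  then have im: "coord (tangent_chart A c) ` (dom_of (tangent_chart A c) \<inter> dom_of (tangent_chart A d))
    = coord c ` (dom_of c \<inter> dom_of d) \<times> UNIV"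
    using tangent_chart_image[OF A c, of "dom_of c \<inter> dom_of d"] by simp
  note S = smooth_atlas_open[OF A c d]
  show "open (coord (tangent_chart A c) ` (dom_of (tangent_chart A c) \<inter> dom_of (tangent_chart A d)))"
    unfolding im using S by (simp add: open_Times)
  show "smooth_on (coord (tangent_chart A c) ` (dom_of (tangent_chart A c) \<inter> dom_of (tangent_chart A d)))
     (local_rep (tangent_chart A c) (tangent_chart A d) (\<lambda>p. p))"
    unfolding im
  proof (rule smooth_on_cong[OF _ _ smooth_on_tangent[OF S smooth_atlas_transition[OF A c d]]])
    fix z :: "'b \<times> 'b" assume z: "z \<in> coord c ` (dom_of c \<inter> dom_of d) \<times> UNIV"
    then have x: "fst z \<in> coord c ` dom_of c" "param c (fst z) \<in> dom_of d" by (auto simp: param_coord[OF A c])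
    show "(local_rep c d (\<lambda>p. p) (fst z), frechet_derivative (local_rep c d (\<lambda>p. p)) (at (fst z)) (snd z)) =
         local_rep (tangent_chart A c) (tangent_chart A d) (\<lambda>p. p) z"
      using transition_tangent[OF A c d x, of "snd z"] by simp
  qed (use S in \<open>simp add: open_Times\<close>)
qed

text \<open>In natural coordinates the tangent map of a smooth map with representation \<open>f\<close> is
  \<open>(x, y) \<mapsto> (f x, Df(x) y)\<close>, which is smooth.\<close>

lemma mdifferentiable_tangent_map:
  assumes A: "smooth_atlas A" and B: "smooth_atlas B" and f: "smooth_map A B f" and u: "u \<in> tangent_space A p"
  shows "mdifferentiable (tangent_bundle A) (tangent_bundle B) (tangent_map A B f) u"
proof -
  note p = tangent_space_points[OF u] and b = tangent_space_base[OF u]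
  note fp = smooth_map_imp_mdifferentiable[OF A B f p]
  obtain c where c: "c \<in> A" "p \<in> dom_of c" using p by (auto simp: points_def)
  obtain d where d: "d \<in> B" "f p \<in> dom_of d" using smooth_map_in_points[OF f p] by (auto simp: points_def)
  let ?S = "coord c ` (dom_of c \<inter> f -` dom_of d)"
  let ?F = "\<lambda>z. (local_rep c d f (fst z), frechet_derivative (local_rep c d f) (at (fst z)) (snd z))"
  note S = smooth_map_open_image[OF A B f c(1) d(1)]
  note T = smooth_on_tangent[OF S smooth_map_smooth_on[OF f c(1) d(1)]]
  have x: "x \<in> coord c ` dom_of c" "f (param c x) \<in> dom_of d" "param c x \<in> points A" if "x \<in> ?S" for x
    using that c by (auto simp: param_coord[OF A c(1)] points_def)
  have zS: "coord (tangent_chart A c) u \<in> ?S \<times> UNIV" using c d by (simp add: b)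
  have ev: "\<forall>\<^sub>F z in nhds (coord (tangent_chart A c) u). z \<in> ?S \<times> UNIV"
    using S zS by (intro eventually_nhds_in_open) (auto simp: open_Times)
  have D: "(?F has_derivative frechet_derivative ?F (at (coord (tangent_chart A c) u))) (at (coord (tangent_chart A c) u))"
    by (rule smooth_on_has_derivative[OF T zS])
  have eq: "?F z = local_rep (tangent_chart A c) (tangent_chart B d) (tangent_map A B f) z" if "z \<in> ?S \<times> UNIV" for z
    using local_rep_tangent_map[OF A c(1) d(1) x(1) x(2) smooth_map_imp_mdifferentiable[OF A B f x(3)], of "fst z" "snd z"] that
    by auto
  show ?thesis
  proof (rule mdifferentiableI[OF smooth_atlas_tangent_bundle[OF A] smooth_atlas_tangent_bundle[OF B]])
    show "tangent_chart A c \<in> tangent_bundle A" "tangent_chart B d \<in> tangent_bundle B"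
      using c d by (auto intro: tangent_chart_in_bundle)
    show "u \<in> dom_of (tangent_chart A c)" using c u by (simp add: tangent_chart_dom b)
    show "tangent_map A B f u \<in> dom_of (tangent_chart B d)"
      using tangent_map_in_tangent_space[OF A B fp u] d by (simp add: tangent_chart_dom b)
    have "\<forall>\<^sub>F z in nhds (coord (tangent_chart A c) u). ?F z = local_rep (tangent_chart A c) (tangent_chart B d) (tangent_map A B f) z"
      using ev by (rule eventually_mono) (rule eq)
    with D show "(local_rep (tangent_chart A c) (tangent_chart B d) (tangent_map A B f)
        has_derivative frechet_derivative ?F (at (coord (tangent_chart A c) u))) (at (coord (tangent_chart A c) u))"
      by (rule has_derivative_transform_eventually_nhds)
    show "\<forall>\<^sub>F z in nhds (coord (tangent_chart A c) u). tangent_map A B f (param (tangent_chart A c) z) \<in> dom_of (tangent_chart B d)"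
      using ev
    proof (rule eventually_mono)
      fix z :: "'b \<times> 'b" assume z: "z \<in> ?S \<times> UNIV"
      then have xz: "fst z \<in> ?S" by auto
      have "param (tangent_chart A c) z = coord_vector A c (param c (fst z)) (snd z)"
        using tangent_chart_param[OF A c(1) x(1)[OF xz], of "snd z"] by simp
      moreover have "tangent_map A B f (coord_vector A c (param c (fst z)) (snd z)) \<in> tangent_space B (f (param c (fst z)))"
        by (rule tangent_map_in_tangent_space[OF A B smooth_map_imp_mdifferentiable[OF A B f x(3)[OF xz]]
            coord_vector_in_tangent_space[OF A c(1) param_in_dom[OF x(1)[OF xz]]]])
      ultimately show "tangent_map A B f (param (tangent_chart A c) z) \<in> dom_of (tangent_chart B d)"
        using x(2)[OF xz] by (simp add: tangent_chart_dom)
    qed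
  qed
qed

lemma points_open_submanifold: "points (open_submanifold A W) = points A \<inter> W"
  by (auto simp: points_def open_submanifold_def)

lemma param_open_submanifold:
  assumes A: "smooth_atlas A" and c: "c \<in> A" and x: "x \<in> coord c ` (dom_of c \<inter> W)"
  shows "param (dom_of c \<inter> W, coord c) x = param c x"
proof -
  obtain p where p: "p \<in> dom_of c \<inter> W" "x = coord c p" using x by auto
  have "inj_on (coord c) (dom_of c \<inter> W)" using smooth_atlas_inj[OF A c] by (rule inj_on_subset) auto
  then show ?thesis using p inv_into_f_f[of "coord c" "dom_of c \<inter> W" p] by (simp add: param_def[of "(dom_of c \<inter> W, coord c)"] param_coord[OF A c])
qed

lemma smooth_atlas_open_submanifold:
  assumes A: "smooth_atlas A" and W: "\<And>c. c \<in> A \<Longrightarrow> open (coord c ` (dom_of c \<inter> W))"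
  shows "smooth_atlas (open_submanifold A W)"
  unfolding smooth_atlas_def open_submanifold_def
proof (intro conjI ballI; elim imageE; hypsubst; unfold fst_conv snd_conv)
  fix c assume c: "c \<in> A"
  show "inj_on (coord c) (dom_of c \<inter> W)" using smooth_atlas_inj[OF A c] by (rule inj_on_subset) auto
next
  fix c d assume c: "c \<in> A" and d: "d \<in> A"
  have im: "coord c ` (dom_of c \<inter> W \<inter> (dom_of d \<inter> W)) = coord c ` (dom_of c \<inter> W) \<inter> coord c ` (dom_of c \<inter> dom_of d)"
  proof -
    have "dom_of c \<inter> W \<inter> (dom_of d \<inter> W) = (dom_of c \<inter> W) \<inter> (dom_of c \<inter> dom_of d)" by auto
    then show ?thesis using inj_on_image_Int[OF smooth_atlas_inj[OF A c], of "dom_of c \<inter> W" "dom_of c \<inter> dom_of d"] by simp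
  qed
  show o: "open (coord c ` (dom_of c \<inter> W \<inter> (dom_of d \<inter> W)))"
    unfolding im by (intro open_Int W[OF c] smooth_atlas_open[OF A c d])
  have s: "smooth_on (coord c ` (dom_of c \<inter> W \<inter> (dom_of d \<inter> W))) (local_rep c d (\<lambda>p. p))"
    by (rule smooth_on_subset[OF smooth_atlas_transition[OF A c d]]) auto
  show "smooth_on (coord c ` (dom_of c \<inter> W \<inter> (dom_of d \<inter> W))) (local_rep (dom_of c \<inter> W, coord c) (dom_of d \<inter> W, coord d) (\<lambda>p. p))"
  proof (rule smooth_on_cong[OF o _ s])
    fix x assume "x \<in> coord c ` (dom_of c \<inter> W \<inter> (dom_of d \<inter> W))"
    then have "param (dom_of c \<inter> W, coord c) x = param c x" by (intro param_open_submanifold[OF A c]) auto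
    then show "local_rep c d (\<lambda>p. p) x = local_rep (dom_of c \<inter> W, coord c) (dom_of d \<inter> W, coord d) (\<lambda>p. p) x"
      by (simp add: local_rep_def)
  qed
qed

lemma mdifferentiable_open_submanifold_target:
  assumes f: "mdifferentiable A (open_submanifold B W) f p"
  shows "mdifferentiable A B f p"
  unfolding mdifferentiable_def
proof (intro conjI ballI impI)
  have fp: "f p \<in> points B \<inter> W" using f unfolding mdifferentiable_def points_open_submanifold by blast
  show "p \<in> points A" "f p \<in> points B" using f fp by (auto simp: mdifferentiable_def)
  fix c d assume c: "c \<in> A" "p \<in> dom_of c" and d: "d \<in> B" "f p \<in> dom_of d"
  let ?d = "(dom_of d \<inter> W, coord d)"
  have "?d \<in> open_submanifold B W" using d by (simp add: open_submanifold_def)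
  moreover have "f p \<in> dom_of ?d" using d fp by simp
  ultimately have *: "\<forall>\<^sub>F x in nhds (coord c p). f (param c x) \<in> dom_of ?d" "local_rep c ?d f differentiable (at (coord c p))"
    using f c unfolding mdifferentiable_def by blast+
  show "\<forall>\<^sub>F x in nhds (coord c p). f (param c x) \<in> dom_of d"
    using *(1) by (rule eventually_mono) simp
  have "local_rep c ?d f = local_rep c d f" by (simp add: local_rep_def)
  then show "local_rep c d f differentiable (at (coord c p))" using *(2) by simp
qed

lemma tangent_zero_in_tangent_space:
  assumes A: "smooth_atlas A" and p: "p \<in> points A"
  shows "tangent_zero p \<in> tangent_space A p"
proof (rule tangent_spaceI)
  fix c d assume "c \<in> A" "d \<in> A" "p \<in> dom_of c" "p \<in> dom_of d"
  from has_derivative_linear[OF mdifferentiable_has_derivative[OF mdifferentiable_transition[OF A p] this]]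
  show "comp_in (tangent_zero p) d = mderiv c d (\<lambda>q. q) p (comp_in (tangent_zero p) c)"
    by (simp add: tangent_zero_def linear_0)
qed (auto simp: tangent_zero_def p)

lemma tangent_zero_iff:
  assumes A: "smooth_atlas A" and u: "u \<in> tangent_space A p" and c: "c \<in> A" "p \<in> dom_of c"
  shows "u = tangent_zero p \<longleftrightarrow> comp_in u c = 0"
  using tangent_eqI[OF u tangent_zero_in_tangent_space[OF A tangent_space_points[OF u]] c]
  by (auto simp: tangent_zero_def)

lemma slit_chart_image:
  assumes A: "smooth_atlas A" and c: "c \<in> A"
  shows "coord (tangent_chart A c) ` (dom_of (tangent_chart A c) \<inter> nonzero_vectors) = coord c ` dom_of c \<times> (- {0})"
proof -
  have n: "comp_in u c \<noteq> 0 \<longleftrightarrow> u \<noteq> tangent_zero (base u)" if "u \<in> dom_of (tangent_chart A c)" for u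
    using tangent_zero_iff[OF A _ c, of u "base u"] that unfolding tangent_chart_dom by blast
  have "coord (tangent_chart A c) ` (dom_of (tangent_chart A c) \<inter> nonzero_vectors)
     = coord (tangent_chart A c) ` dom_of (tangent_chart A c) \<inter> UNIV \<times> (- {0})"
    using n by (auto simp: image_iff) 
  then show ?thesis unfolding tangent_chart_image_dom[OF A c] by auto
qed

lemma smooth_atlas_slit_bundle:
  assumes A: "smooth_atlas A"
  shows "smooth_atlas (slit_bundle A)"
  unfolding slit_bundle_def
proof (rule smooth_atlas_open_submanifold[OF smooth_atlas_tangent_bundle[OF A]])
  fix C assume "C \<in> tangent_bundle A"
  then obtain c where c: "c \<in> A" "C = tangent_chart A c" by (auto simp: tangent_bundle_def)
  show "open (coord C ` (dom_of C \<inter> nonzero_vectors))"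
    unfolding c(2) slit_chart_image[OF A c(1)] using smooth_atlas_open_chart[OF A c(1)] by (simp add: open_Times open_Compl)
qed

section \<open>Curves and embedded submanifolds\<close>

lemma smooth_atlas_interval: "open I \<Longrightarrow> smooth_atlas {(I, \<lambda>t::real. t)}"
  unfolding smooth_atlas_def
proof (intro conjI ballI)
  assume I: "open I"
  fix c d :: "(real, real) chart" assume "c \<in> {(I, \<lambda>t. t)}" "d \<in> {(I, \<lambda>t. t)}"
  then have [simp]: "c = (I, \<lambda>t. t)" "d = (I, \<lambda>t. t)" by auto
  show "open (coord c ` (dom_of c \<inter> dom_of d))" using I by simp
  have "param c x = x" if "x \<in> I" for x
    unfolding param_def using that by (auto intro!: inv_into_f_eq)
  then have "smooth_on I (local_rep c d (\<lambda>p. p))"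
    by (intro smooth_on_cong[OF I _ smooth_on_id[OF I]]) (simp add: local_rep_def)
  then show "smooth_on (coord c ` (dom_of c \<inter> dom_of d)) (local_rep c d (\<lambda>p. p))" by simp
qed auto

lemma param_interval: "t \<in> I \<Longrightarrow> param (I, \<lambda>t. t) t = t"
  unfolding param_def by (auto intro!: inv_into_f_eq)

lemma points_interval [simp]: "points {(I, \<lambda>t. t)} = I"
  by (simp add: points_def)

lemma smooth_curve_in_points: "smooth_curve A I c \<Longrightarrow> t \<in> I \<Longrightarrow> c t \<in> points A"
  unfolding smooth_curve_def using smooth_map_in_points[of "{(I, \<lambda>t. t)}" A c t] by simp

lemma smooth_curve_chart:
  assumes A: "smooth_atlas A" and c: "smooth_curve A I c" and d: "d \<in> A"
  shows "open {t \<in> I. c t \<in> dom_of d}" "smooth_on {t \<in> I. c t \<in> dom_of d} (\<lambda>t. coord d (c t))"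
proof -
  have I: "open I" and sm: "smooth_map {(I, \<lambda>t. t)} A c" using c by (auto simp: smooth_curve_def)
  have e: "I \<inter> c -` dom_of d = {t \<in> I. c t \<in> dom_of d}" by auto
  show o: "open {t \<in> I. c t \<in> dom_of d}"
    using smooth_map_open_image[OF smooth_atlas_interval[OF I] A sm, of "(I, \<lambda>t. t)" d] d by (simp add: e)
  have "smooth_on {t \<in> I. c t \<in> dom_of d} (local_rep (I, \<lambda>t. t) d c)"
    using smooth_map_smooth_on[OF sm, of "(I, \<lambda>t. t)" d] d by (simp add: e)
  then show "smooth_on {t \<in> I. c t \<in> dom_of d} (\<lambda>t. coord d (c t))"
    by (rule smooth_on_cong[OF o, rotated]) (simp add: local_rep_def param_interval)
qed

lemma smooth_curve_eventually:
  assumes A: "smooth_atlas A" and c: "smooth_curve A I c" and d: "d \<in> A" and t: "t \<in> I" "c t \<in> dom_of d"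
  shows "\<forall>\<^sub>F s in nhds t. s \<in> I \<and> c s \<in> dom_of d"
proof -
  have "\<forall>\<^sub>F s in nhds t. s \<in> {t \<in> I. c t \<in> dom_of d}"
    by (rule eventually_nhds_in_open[OF smooth_curve_chart(1)[OF A c d]]) (use t in simp)
  then show ?thesis by (simp add: conj_commute)
qed

lemma smooth_on_real_vector_derivative:
  assumes "smooth_on J f" "t \<in> J"
  shows "(f has_vector_derivative vector_derivative f (at t)) (at t)"
  using smooth_on_has_derivative[OF assms] differentiableI vector_derivative_works by blast

lemma velocity_base [simp]: "base (velocity A c t) = c t"
  by (simp add: velocity_def)

lemma velocity_comp: "d \<in> A \<Longrightarrow> c t \<in> dom_of d \<Longrightarrow> comp_in (velocity A c t) d = vector_derivative (\<lambda>s. coord d (c s)) (at t)"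
  by (simp add: velocity_def)

lemma smooth_curve_has_vector_derivative:
  assumes A: "smooth_atlas A" and c: "smooth_curve A I c" and d: "d \<in> A" and t: "t \<in> I" "c t \<in> dom_of d"
  shows "((\<lambda>s. coord d (c s)) has_vector_derivative comp_in (velocity A c t) d) (at t)"
  unfolding velocity_comp[of d A c t, OF d t(2)]
  by (rule smooth_on_real_vector_derivative[OF smooth_curve_chart(2)[OF A c d]]) (use t in simp)

lemma curve_chain:
  assumes A: "smooth_atlas A" and k: "k \<in> A" "\<gamma> t \<in> dom_of k"
    and v: "((\<lambda>s. coord k (\<gamma> s)) has_vector_derivative v) (at t)"
    and ev: "\<forall>\<^sub>F s in nhds t. \<gamma> s \<in> dom_of k"
    and D: "(local_rep k d f has_derivative D) (at (coord k (\<gamma> t)))"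
  shows "((\<lambda>s. coord d (f (\<gamma> s))) has_vector_derivative D v) (at t)"
proof -
  have "((\<lambda>s. local_rep k d f (coord k (\<gamma> s))) has_derivative (\<lambda>h. D (h *\<^sub>R v))) (at t)"
    using diff_chain_at[OF v[unfolded has_vector_derivative_def] D] by (simp add: o_def)
  then have 1: "((\<lambda>s. local_rep k d f (coord k (\<gamma> s))) has_derivative (\<lambda>h. h *\<^sub>R D v)) (at t)"
    using has_derivative_linear[OF D] by (simp add: linear_cmul)
  have "\<forall>\<^sub>F s in nhds t. local_rep k d f (coord k (\<gamma> s)) = coord d (f (\<gamma> s))"
    using ev by (rule eventually_mono) (rule local_rep_coord[OF A k(1)])
  from has_derivative_transform_eventually_nhds[OF 1 this] show ?thesis
    unfolding has_vector_derivative_def .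
qed

lemma velocity_in_tangent_space:
  assumes A: "smooth_atlas A" and c: "smooth_curve A I c" and t: "t \<in> I"
  shows "velocity A c t \<in> tangent_space A (c t)"
proof (rule tangent_spaceI)
  show p: "c t \<in> points A" by (rule smooth_curve_in_points[OF c t])
  fix k d assume k: "k \<in> A" and d: "d \<in> A" and tk: "c t \<in> dom_of k" and td: "c t \<in> dom_of d"
  have "\<forall>\<^sub>F s in nhds t. c s \<in> dom_of k"
    using smooth_curve_eventually[OF A c k t tk] by (rule eventually_mono) simp
  from curve_chain[OF A k tk smooth_curve_has_vector_derivative[OF A c k t tk] this
    mdifferentiable_has_derivative[OF mdifferentiable_transition[OF A p] k d tk td]]
  show "comp_in (velocity A c t) d = mderiv k d (\<lambda>q. q) (c t) (comp_in (velocity A c t) k)"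
    unfolding velocity_comp[of d A c t, OF d td] by (rule vector_derivative_at)
qed (auto simp: velocity_def)

text \<open>Curves on a manifold are produced by solving differential equations in a chart; this makes them
  smooth curves in the sense of all charts.\<close>

lemma smooth_curveI:
  assumes A: "smooth_atlas A" and k: "k \<in> A" and J: "open J" "is_interval J" and \<xi>: "smooth_on J \<xi>"
    and im: "\<And>t. t \<in> J \<Longrightarrow> \<xi> t \<in> coord k ` dom_of k"
  shows "smooth_curve A J (\<lambda>t. param k (\<xi> t))"
proof -
  note J' = smooth_atlas_interval[OF J(1)]
  have pre: "open {t \<in> J. param k (\<xi> t) \<in> U}" if U: "openin (atlas_topology A) U" for U
  proof -
    have "{t \<in> J. param k (\<xi> t) \<in> U} = J \<inter> \<xi> -` (coord k ` (U \<inter> dom_of k))"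
    proof (intro equalityI subsetI)
      fix t assume "t \<in> {t \<in> J. param k (\<xi> t) \<in> U}"
      then show "t \<in> J \<inter> \<xi> -` (coord k ` (U \<inter> dom_of k))"
        using coord_param[OF im, of t] param_in_dom[OF im, of t]
        by (auto intro!: image_eqI[of _ _ "param k (\<xi> t)"])
    next
      fix t assume "t \<in> J \<inter> \<xi> -` (coord k ` (U \<inter> dom_of k))"
      then obtain q where "t \<in> J" "q \<in> U" "q \<in> dom_of k" "\<xi> t = coord k q" by auto
      then show "t \<in> {t \<in> J. param k (\<xi> t) \<in> U}" using param_coord[OF A k] by simp
    qed
    moreover have "open (J \<inter> \<xi> -` (coord k ` (U \<inter> dom_of k)))"
      by (rule continuous_open_preimage[OF smooth_on_imp_continuous_on[OF \<xi>] J(1) openin_atlas_imp[OF A U k]])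
    ultimately show ?thesis by simp
  qed
  have cont: "continuous_map (atlas_topology {(J, \<lambda>t. t)}) (atlas_topology A) (\<lambda>t. param k (\<xi> t))"
    unfolding continuous_map
  proof (intro conjI allI impI)
    show "(\<lambda>t. param k (\<xi> t)) ` topspace (atlas_topology {(J, \<lambda>t. t)}) \<subseteq> topspace (atlas_topology A)"
      using param_in_dom[OF im] k by (auto simp: points_def)
    fix U assume U: "openin (atlas_topology A) U"
    show "openin (atlas_topology {(J, \<lambda>t. t)}) {t \<in> topspace (atlas_topology {(J, \<lambda>t. t)}). param k (\<xi> t) \<in> U}"
      unfolding openin_atlas_iff[OF J'] using pre[OF U] by (auto simp: Int_absorb2)
  qed
  have "smooth_on {t \<in> J. param k (\<xi> t) \<in> dom_of d} (local_rep (J, \<lambda>t. t) d (\<lambda>t. param k (\<xi> t)))"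
    if d: "d \<in> A" for d
  proof -
    note o = pre[OF openin_chart_dom[OF A d]]
    have "smooth_on {t \<in> J. param k (\<xi> t) \<in> dom_of d} (\<lambda>t. local_rep k d (\<lambda>p. p) (\<xi> t))"
    proof (rule smooth_on_compose[OF o smooth_atlas_open[OF A k d] _ smooth_atlas_transition[OF A k d]])
      show "smooth_on {t \<in> J. param k (\<xi> t) \<in> dom_of d} \<xi>" by (rule smooth_on_subset[OF \<xi>]) auto
      fix t assume t: "t \<in> {t \<in> J. param k (\<xi> t) \<in> dom_of d}"
      then show "\<xi> t \<in> coord k ` (dom_of k \<inter> dom_of d)"
        using coord_param[OF im, of t] param_in_dom[OF im, of t] by (intro image_eqI[of _ _ "param k (\<xi> t)"]) auto
    qed
    then show ?thesis
      by (rule smooth_on_cong[OF o, rotated]) (simp add: local_rep_def param_interval)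
  qed
  then have "smooth_map {(J, \<lambda>t. t)} A (\<lambda>t. param k (\<xi> t))"
    unfolding smooth_map_def using cont by (auto simp: vimage_def Int_def)
  then show ?thesis using J by (simp add: smooth_curve_def)
qed

text \<open>Since \<open>D\<close> is injective, it is bounded below, and this bounds the difference quotients \<open>q\<close> of \<open>\<tau>\<close> by
  those of \<open>\<lambda>s. i (\<tau> s)\<close>, written \<open>dq\<close>. Hence \<open>D (q s)\<close> and \<open>dq s\<close> have the same limit \<open>v\<close>, and the range of \<open>D\<close> is
  closed.\<close>

lemma derivative_in_range_of_immersion:
  fixes i :: "'k::euclidean_space \<Rightarrow> 'e::euclidean_space" and \<tau> :: "real \<Rightarrow> 'k"
  assumes i: "(i has_derivative D) (at (\<tau> 0))" and inj: "inj D" and \<tau>: "isCont \<tau> 0"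
    and \<sigma>: "((\<lambda>s. i (\<tau> s)) has_vector_derivative v) (at 0)"
  shows "v \<in> range D"
proof -
  have lin: "linear D" by (rule has_derivative_linear[OF i])
  obtain m where m: "m > 0" "\<And>h. m * norm h \<le> norm (D h)"
    using linear_inj_bounded_below_pos[OF lin inj] by (metis mult.commute)
  define r where "r = (\<lambda>h. norm (i (\<tau> 0 + h) - i (\<tau> 0) - D h) / norm h)"
  have req: "norm (i (\<tau> 0 + h) - i (\<tau> 0) - D h) = r h * norm h" for h
    by (cases "h = 0") (simp_all add: r_def linear_0[OF lin])
  have "(r \<longlongrightarrow> 0) (at 0)" using i unfolding has_derivative_at r_def by (rule conjunct2)
  then have Rc: "(r \<longlongrightarrow> 0) (nhds 0)"
    using tendsto_at_iff_tendsto_nhds[of r 0] by (simp add: r_def)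
  have "((\<lambda>s. \<tau> s - \<tau> 0) \<longlongrightarrow> 0) (at 0)" by (rule LIM_zero[OF \<tau>[unfolded isCont_def]])
  then have Rt: "((\<lambda>s. r (\<tau> s - \<tau> 0)) \<longlongrightarrow> 0) (at 0)" by (rule filterlim_compose[OF Rc])
  define q where "q = (\<lambda>s. (1 / s) *\<^sub>R (\<tau> s - \<tau> 0))"
  define dq where "dq = (\<lambda>s. (1 / s) *\<^sub>R (i (\<tau> s) - i (\<tau> 0)))"
  have ne: "\<forall>\<^sub>F s::real in at 0. s \<noteq> 0" by (simp add: eventually_at_filter)
  have dq: "(dq \<longlongrightarrow> v) (at 0)"
  proof (rule LIM_zero_cancel, rule tendsto_norm_zero_cancel, rule Lim_transform_eventually)
    show "((\<lambda>s. norm (i (\<tau> (0 + s)) - i (\<tau> 0) - s *\<^sub>R v) / norm s) \<longlongrightarrow> 0) (at 0)"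
      using \<sigma> unfolding has_vector_derivative_def has_derivative_at by (rule conjunct2)
    show "\<forall>\<^sub>F s in at 0. norm (i (\<tau> (0 + s)) - i (\<tau> 0) - s *\<^sub>R v) / norm s = norm (dq s - v)"
      using ne
    proof eventually_elim
      case (elim s)
      have "dq s - v = (1 / s) *\<^sub>R (i (\<tau> (0 + s)) - i (\<tau> 0) - s *\<^sub>R v)"
        using elim by (simp add: dq_def scaleR_diff_right)
      then show ?case by simp
    qed
  qed
  have Dq: "norm (D (q s) - dq s) = r (\<tau> s - \<tau> 0) * norm (q s)" if "s \<noteq> 0" for s
  proof -
    have "dq s - D (q s) = (1 / s) *\<^sub>R (i (\<tau> 0 + (\<tau> s - \<tau> 0)) - i (\<tau> 0) - D (\<tau> s - \<tau> 0))"
      by (simp add: dq_def q_def linear_cmul[OF lin] linear_diff[OF lin] scaleR_diff_right)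
    then have "norm (dq s - D (q s)) = (1 / \<bar>s\<bar>) * (r (\<tau> s - \<tau> 0) * norm (\<tau> s - \<tau> 0))"
      unfolding req[symmetric] by simp
    then show ?thesis by (simp add: q_def norm_minus_commute)
  qed
  have "((\<lambda>s. norm (dq s)) \<longlongrightarrow> norm v) (at 0)" by (rule tendsto_norm[OF dq])
  then have ev1: "\<forall>\<^sub>F s in at 0. norm (dq s) < norm v + 1" by (rule order_tendstoD) simp
  have ev2: "\<forall>\<^sub>F s in at 0. r (\<tau> s - \<tau> 0) < m / 2" using Rt by (rule order_tendstoD) (use m in simp)
  have "\<forall>\<^sub>F s in at 0. norm (D (q s) - dq s) \<le> r (\<tau> s - \<tau> 0) * (2 / m * (norm v + 1))"
    using ev1 ev2 ne
  proof eventually_elim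
    case (elim s)
    have r0: "r (\<tau> s - \<tau> 0) \<ge> 0" by (simp add: r_def)
    have "m * norm (q s) \<le> norm (dq s) + norm (D (q s) - dq s)"
      using m(2)[of "q s"] norm_triangle_sub[of "D (q s)" "dq s"] by linarith
    also have "\<dots> \<le> (norm v + 1) + m / 2 * norm (q s)"
      unfolding Dq[OF elim(3)] using elim by (intro add_mono mult_right_mono) auto
    finally have "norm (q s) \<le> 2 / m * (norm v + 1)" using m(1) by (simp add: field_simps)
    then show ?case unfolding Dq[OF elim(3)] by (rule mult_left_mono[OF _ r0])
  qed
  moreover have "((\<lambda>s. r (\<tau> s - \<tau> 0) * (2 / m * (norm v + 1))) \<longlongrightarrow> 0) (at 0)"
    by (rule tendsto_mult_left_zero[OF Rt])
  ultimately have "((\<lambda>s. D (q s) - dq s) \<longlongrightarrow> 0) (at 0)" by (rule Lim_null_comparison)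
  from tendsto_add[OF this dq] have lim: "((\<lambda>s. D (q s)) \<longlongrightarrow> v) (at 0)" by simp
  have "closed (range D)" by (intro closed_subspace linear_subspace_image lin subspace_UNIV)
  then show ?thesis by (rule Lim_in_closed_set[OF _ _ _ lim]) auto
qed

lemma eventually_in_openin_of_chart:
  assumes A: "smooth_atlas A" and U: "openin (atlas_topology A) U" "\<sigma> t \<in> U" and d: "d \<in> A" "\<sigma> t \<in> dom_of d"
    and ev: "\<forall>\<^sub>F s in nhds t. \<sigma> s \<in> dom_of d" and cont: "isCont (\<lambda>s. coord d (\<sigma> s)) t"
  shows "\<forall>\<^sub>F s in nhds (t::real). \<sigma> s \<in> U"
proof -
  have "((\<lambda>s. coord d (\<sigma> s)) \<longlongrightarrow> coord d (\<sigma> t)) (nhds t)"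
    using cont tendsto_at_iff_tendsto_nhds[of "\<lambda>s. coord d (\<sigma> s)" t] by (simp add: isCont_def)
  from eventually_compose_filterlim[OF eventually_in_chart_image[OF A d(1) U d(2)] this]
  have "\<forall>\<^sub>F s in nhds t. param d (coord d (\<sigma> s)) \<in> U" by (rule eventually_mono) simp
  with ev show ?thesis by eventually_elim (simp add: param_coord[OF A d(1)])
qed

text \<open>In charts of \<open>N\<close> and \<open>A\<close> the curve \<open>\<sigma>\<close> is the composition of the representation of the inclusion, which
  is an immersion, with a curve that is continuous for the topology of \<open>N\<close>. The preceding lemma
  therefore produces the components of \<open>\<zeta>\<close>.\<close>

lemma velocity_tangent_to_embedded:
  assumes N: "smooth_atlas N" and A: "smooth_atlas A" and x: "\<sigma> 0 \<in> points N"
    and i: "mdifferentiable N A (\<lambda>q. q) (\<sigma> 0)"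
    and inj: "inj_on (tangent_map N A (\<lambda>q. q)) (tangent_space N (\<sigma> 0))"
    and d: "d \<in> A" "\<sigma> 0 \<in> dom_of d"
    and cont: "\<And>U. openin (atlas_topology N) U \<Longrightarrow> \<sigma> 0 \<in> U \<Longrightarrow> \<forall>\<^sub>F s in nhds (0::real). \<sigma> s \<in> U"
    and v: "((\<lambda>s. coord d (\<sigma> s)) has_vector_derivative v) (at 0)"
  shows "\<exists>\<zeta>\<in>tangent_space N (\<sigma> 0). comp_in (tangent_map N A (\<lambda>q. q) \<zeta>) d = v"
proof -
  obtain c where c: "c \<in> N" "\<sigma> 0 \<in> dom_of c" using x by (auto simp: points_def)
  let ?D = "mderiv c d (\<lambda>q. q) (\<sigma> 0)"
  note D = mdifferentiable_has_derivative[OF i c(1) d(1) c(2) d(2)]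
  have comp: "comp_in (tangent_map N A (\<lambda>q. q) (coord_vector N c (\<sigma> 0) h)) d = ?D h" for h
    unfolding tangent_map_comp[OF N i coord_vector_in_tangent_space[OF N c] c d] coord_vector_comp[OF N c] ..
  have "inj ?D"
  proof (rule injI)
    fix h k assume hk: "?D h = ?D k"
    note th = coord_vector_in_tangent_space[OF N c, of h] and tk = coord_vector_in_tangent_space[OF N c, of k]
    have "tangent_map N A (\<lambda>q. q) (coord_vector N c (\<sigma> 0) h) = tangent_map N A (\<lambda>q. q) (coord_vector N c (\<sigma> 0) k)"
      using tangent_eqI[OF tangent_map_in_tangent_space[OF N A i th] tangent_map_in_tangent_space[OF N A i tk] d] hk comp by simp
    then have "coord_vector N c (\<sigma> 0) h = coord_vector N c (\<sigma> 0) k" by (rule inj_onD[OF inj _ th tk])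
    from arg_cong[OF this, of "\<lambda>u. comp_in u c"] show "h = k" unfolding coord_vector_comp[OF N c] .
  qed
  define \<tau> where "\<tau> = (\<lambda>s. coord c (\<sigma> s))"
  have evc: "\<forall>\<^sub>F s in nhds 0. \<sigma> s \<in> dom_of c" by (rule cont[OF openin_chart_dom[OF N c(1)] c(2)])
  have "isCont \<tau> 0"
    unfolding isCont_def tendsto_def
  proof (intro allI impI)
    fix V assume V: "open V" "\<tau> 0 \<in> V"
    have "openin (atlas_topology N) (dom_of c \<inter> coord c -` V)"
      unfolding atlas_topology_def using c V by (intro topology_generated_by_Basis) blast
    from cont[OF this] have "\<forall>\<^sub>F s in nhds 0. \<tau> s \<in> V" using c V by (auto simp: \<tau>_def elim: eventually_mono)
    then show "\<forall>\<^sub>F s in at 0. \<tau> s \<in> V" by (simp add: eventually_at_filter eventually_mono)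
  qed
  moreover have "((\<lambda>s. local_rep c d (\<lambda>q. q) (\<tau> s)) has_vector_derivative v) (at 0)"
    unfolding has_vector_derivative_def
  proof (rule has_derivative_transform_eventually_nhds[OF v[unfolded has_vector_derivative_def]])
    show "\<forall>\<^sub>F s in nhds 0. coord d (\<sigma> s) = local_rep c d (\<lambda>q. q) (\<tau> s)"
      using evc by (rule eventually_mono) (simp add: \<tau>_def local_rep_coord[OF N c(1)])
  qed
  moreover have "(local_rep c d (\<lambda>q. q) has_derivative ?D) (at (\<tau> 0))" unfolding \<tau>_def by (rule D)
  ultimately have "v \<in> range ?D"
    by (intro derivative_in_range_of_immersion[of "local_rep c d (\<lambda>q. q)" ?D \<tau> v] \<open>inj ?D\<close>)
  then obtain h where "v = ?D h" by blast
  with comp[of h] have "comp_in (tangent_map N A (\<lambda>q. q) (coord_vector N c (\<sigma> 0) h)) d = v" by (simp only:)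
  then show ?thesis by (rule bexI[OF _ coord_vector_in_tangent_space[OF N c]])
qed

section \<open>Adapted charts of a submersion with a distribution\<close>

lemma distribution_frame:
  assumes "distribution Mb L" "p \<in> points Mb"
  obtains r W X where "openin (atlas_topology Mb) W" "p \<in> W"
    "\<forall>i<r. smooth_map (open_submanifold Mb W) (tangent_bundle Mb) (X i) \<and> (\<forall>q\<in>W. base (X i q) = q)"
    "\<forall>q\<in>W. bij_betw (\<lambda>a. (q, \<lambda>c. \<Sum>i<r. a i *\<^sub>R comp_in (X i q) c))
                  (PiE {..<r::nat} (\<lambda>_. UNIV :: real set)) (fiber L q)"
  using assms unfolding distribution_def
  by (elim conjE exE) (drule (1) bspec, elim exE conjE, erule (3) that)

locale submersion_charts =
  fixes Mb :: "('b, 'f::euclidean_space) atlas" and M :: "('a, 'e::euclidean_space) atlas"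
    and \<pi> :: "'b \<Rightarrow> 'a" and L :: "('b, 'f) tangent set" and kb :: "('b, 'f) chart" and k :: "('a, 'e) chart"
  assumes Mb: "smooth_atlas Mb" and M: "smooth_atlas M" and sub: "submersion Mb M \<pi>"
    and dist: "distribution Mb L" and compl: "complements_vertical Mb M \<pi> L"
    and kb: "kb \<in> Mb" and k: "k \<in> M"
begin

text \<open>The set \<open>S\<close> is the part of the coordinate domain of \<open>kb\<close> over which \<open>k\<close> can be used as well. The tangent vector
  \<open>vec x y\<close> has natural coordinates \<open>(x, y)\<close>, and \<open>Lspace x\<close> is the fiber of \<open>L\<close> as a subset of the
  model space.\<close>

definition S :: "'f set" where "S = coord kb ` (dom_of kb \<inter> \<pi> -` dom_of k)"
definition P :: "'f \<Rightarrow> 'e" where "P = local_rep kb k \<pi>"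
definition dP :: "'f \<Rightarrow> 'f \<Rightarrow> 'e" where "dP x = frechet_derivative P (at x)"
definition vec :: "'f \<Rightarrow> 'f \<Rightarrow> ('b, 'f) tangent" where "vec x y = coord_vector Mb kb (param kb x) y"
definition Lspace :: "'f \<Rightarrow> 'f set" where "Lspace x = {y. vec x y \<in> L}"
definition Q :: "'f \<Rightarrow> 'f \<Rightarrow> 'f" where "Q x y = comp_in (distribution_projection Mb M \<pi> L (vec x y)) kb"

lemma smooth_\<pi>: "smooth_map Mb M \<pi>" using sub by (simp add: submersion_def)

lemma open_S: "open S" unfolding S_def by (rule smooth_map_open_image[OF Mb M smooth_\<pi> kb k])

lemma coord_in_S: "p \<in> dom_of kb \<Longrightarrow> \<pi> p \<in> dom_of k \<Longrightarrow> coord kb p \<in> S" by (auto simp: S_def)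

lemma S_point:
  assumes "x \<in> S"
  shows "x \<in> coord kb ` dom_of kb" "param kb x \<in> dom_of kb" "\<pi> (param kb x) \<in> dom_of k"
    "coord kb (param kb x) = x" "param kb x \<in> points Mb" "\<pi> (param kb x) \<in> points M"
    "coord k (\<pi> (param kb x)) = P x"
  using assms kb k by (auto simp: S_def param_coord[OF Mb kb] points_def P_def local_rep_def)

lemma smooth_P: "smooth_on S P" unfolding S_def P_def by (rule smooth_map_smooth_on[OF smooth_\<pi> kb k])

lemma P_has_derivative: "x \<in> S \<Longrightarrow> (P has_derivative dP x) (at x)"
  unfolding dP_def by (rule smooth_on_has_derivative[OF smooth_P])

lemma linear_dP: "x \<in> S \<Longrightarrow> linear (dP x)" by (rule has_derivative_linear[OF P_has_derivative])

lemma smooth_dP: "smooth_on S (\<lambda>x. dP x v)" unfolding dP_def by (rule smooth_on_derivative[OF smooth_P])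

lemma vec_base [simp]: "base (vec x y) = param kb x" by (simp add: vec_def)

lemma vec_in_tangent_space: "x \<in> S \<Longrightarrow> vec x y \<in> tangent_space Mb (param kb x)"
  unfolding vec_def by (rule coord_vector_in_tangent_space[OF Mb kb S_point(2)])

lemma vec_comp: "x \<in> S \<Longrightarrow> comp_in (vec x y) kb = y"
  unfolding vec_def by (rule coord_vector_comp[OF Mb kb S_point(2)])

lemma vec_of_comp: "x \<in> S \<Longrightarrow> u \<in> tangent_space Mb (param kb x) \<Longrightarrow> vec x (comp_in u kb) = u"
  unfolding vec_def by (rule coord_vector_of_comp[OF Mb kb S_point(2)])

lemma vec_coord: "p \<in> dom_of kb \<Longrightarrow> u \<in> tangent_space Mb p \<Longrightarrow> vec (coord kb p) (comp_in u kb) = u"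
  unfolding vec_def param_coord[OF Mb kb] by (rule coord_vector_of_comp[OF Mb kb])

lemma vec_inject: "x \<in> S \<Longrightarrow> vec x y = vec x z \<Longrightarrow> y = z"
  by (drule arg_cong[of "vec x y" "vec x z" "\<lambda>u. comp_in u kb"]) (simp only: vec_comp)

lemma \<pi>_mdifferentiable: "p \<in> points Mb \<Longrightarrow> mdifferentiable Mb M \<pi> p"
  by (rule smooth_map_imp_mdifferentiable[OF Mb M smooth_\<pi>])

lemma mderiv_\<pi>: "x \<in> S \<Longrightarrow> mderiv kb k \<pi> (param kb x) = dP x"
  unfolding dP_def P_def by (simp add: S_point(4))

lemma tangent_map_\<pi>_vec: "x \<in> S \<Longrightarrow> comp_in (tangent_map Mb M \<pi> (vec x y)) k = dP x y"
  unfolding tangent_map_comp[OF Mb \<pi>_mdifferentiable[OF S_point(5)] vec_in_tangent_space kb S_point(2) k S_point(3)] mderiv_\<pi> vec_comp ..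

lemma tangent_map_\<pi>_in_tangent_space: "x \<in> S \<Longrightarrow> tangent_map Mb M \<pi> (vec x y) \<in> tangent_space M (\<pi> (param kb x))"
  by (rule tangent_map_in_tangent_space[OF Mb M \<pi>_mdifferentiable[OF S_point(5)] vec_in_tangent_space])

lemma vertical_iff: "x \<in> S \<Longrightarrow> vec x y \<in> vertical_space Mb M \<pi> (param kb x) \<longleftrightarrow> dP x y = 0"
  using tangent_zero_iff[OF M tangent_map_\<pi>_in_tangent_space k S_point(3)] vec_in_tangent_space
  by (simp add: vertical_space_def tangent_map_\<pi>_vec)

lemma dP_surj: assumes x: "x \<in> S" shows "\<exists>y. dP x y = e"
proof -
  have "tangent_map Mb M \<pi> ` tangent_space Mb (param kb x) = tangent_space M (\<pi> (param kb x))"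
    using sub S_point(5)[OF x] by (simp add: submersion_def)
  moreover have "coord_vector M k (\<pi> (param kb x)) e \<in> tangent_space M (\<pi> (param kb x))"
    by (rule coord_vector_in_tangent_space[OF M k S_point(3)[OF x]])
  ultimately obtain u where u: "u \<in> tangent_space Mb (param kb x)"
    "tangent_map Mb M \<pi> u = coord_vector M k (\<pi> (param kb x)) e" by (metis imageE)
  have "dP x (comp_in u kb) = comp_in (tangent_map Mb M \<pi> u) k"
    using tangent_map_\<pi>_vec[OF x, of "comp_in u kb"] vec_of_comp[OF x u(1)] by simp
  also have "\<dots> = e" unfolding u(2) by (rule coord_vector_comp[OF M k S_point(3)[OF x]])
  finally show ?thesis by blast
qed

lemma L_in_tangent_space: "u \<in> L \<Longrightarrow> u \<in> tangent_space Mb (base u)"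
  using dist points_tangent_bundle unfolding distribution_def by blast

lemma fiber_L: "x \<in> S \<Longrightarrow> fiber L (param kb x) = vec x ` Lspace x"
proof (intro equalityI subsetI)
  assume x: "x \<in> S"
  fix u assume u: "u \<in> fiber L (param kb x)"
  then have "u = vec x (comp_in u kb)" using vec_of_comp[OF x, of u] L_in_tangent_space[of u] by auto
  then show "u \<in> vec x ` Lspace x" using u by (auto simp: Lspace_def)
qed (auto simp: Lspace_def)

text \<open>In coordinates the linear combinations of the frame fields are those of the functions \<open>\<xi> i\<close>.
  Coefficients in the definition of a distribution are functions on \<open>{..<r}\<close> that are undefined
  elsewhere, hence the use of \<open>restrict\<close>.\<close>

lemma local_frame:
  assumes x: "x \<in> S"
  shows "\<exists>T r \<xi>. open T \<and> x \<in> T \<and> T \<subseteq> S \<and> (\<forall>i<r::nat. smooth_on T (\<xi> i)) \<and>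
    (\<forall>z\<in>T. Lspace z = range (\<lambda>a. \<Sum>i<r. a i *\<^sub>R \<xi> i z))"
proof -
  obtain r W X where W: "openin (atlas_topology Mb) W" "param kb x \<in> W"
    and X0: "\<forall>i<r. smooth_map (open_submanifold Mb W) (tangent_bundle Mb) (X i) \<and> (\<forall>q\<in>W. base (X i q) = q)"
    and bij0: "\<forall>q\<in>W. bij_betw (\<lambda>a. (q, \<lambda>c. \<Sum>i<r. a i *\<^sub>R comp_in (X i q) c))
                  (PiE {..<r::nat} (\<lambda>_. UNIV :: real set)) (fiber L q)"
    by (rule distribution_frame[OF dist S_point(5)[OF x]])
  have X: "smooth_map (open_submanifold Mb W) (tangent_bundle Mb) (X i)" if "i < r" for i
    using X0 that by simp
  have Xb: "base (X i q) = q" if "i < r" "q \<in> W" for i q using X0 that by simp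
  note bij = bij0[rule_format]
  define T where "T = S \<inter> coord kb ` (W \<inter> dom_of kb)"
  have oT: "open T" unfolding T_def by (intro open_Int open_S openin_atlas_imp[OF Mb W(1) kb])
  have xT: "x \<in> T" using x W(2) S_point(2,4)[OF x] by (auto simp: T_def intro: image_eqI[of _ _ "param kb x"])
  define \<xi> where "\<xi> = (\<lambda>i z. comp_in (X i (param kb z)) kb)"
  have zW: "param kb z \<in> W" "z \<in> S" "z \<in> coord kb ` (dom_of kb \<inter> W)" if "z \<in> T" for z
    using that by (auto simp: T_def param_coord[OF Mb kb])
  have sm: "smooth_on T (\<xi> i)" if i: "i < r" for i
  proof -
    let ?c = "(dom_of kb \<inter> W, coord kb)" and ?d = "tangent_chart Mb kb"
    have c: "?c \<in> open_submanifold Mb W" using kb by (simp add: open_submanifold_def)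
    have dom: "X i q \<in> dom_of ?d" if q: "q \<in> dom_of kb \<inter> W" for q
    proof -
      have "q \<in> points (open_submanifold Mb W)" using q kb unfolding points_open_submanifold by (auto simp: points_def)
      from smooth_map_in_points[OF X[OF i] this] show ?thesis
        using Xb[OF i, of q] q unfolding points_tangent_bundle tangent_chart_dom by simp
    qed
    have "smooth_on T (local_rep ?c ?d (X i))"
      by (rule smooth_on_subset[OF smooth_map_smooth_on[OF X[OF i] c tangent_chart_in_bundle[OF kb]]])
        (use zW(3) dom in force)
    then have "smooth_on T (\<lambda>z. snd (local_rep ?c ?d (X i) z))" by (rule smooth_on_bounded_linear[OF bounded_linear_snd oT])
    then show ?thesis
      by (rule smooth_on_cong[OF oT, rotated])
        (simp add: local_rep_def \<xi>_def param_open_submanifold[OF Mb kb zW(3)])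
  qed
  have "Lspace z = range (\<lambda>a. \<Sum>i<r. a i *\<^sub>R \<xi> i z)" if z: "z \<in> T" for z
  proof (intro equalityI subsetI)
    let ?q = "param kb z"
    note im = bij_betw_imp_surj_on[OF bij[OF zW(1)[OF z]]]
    {
      fix y assume "y \<in> Lspace z"
      then have "vec z y \<in> fiber L ?q" by (simp add: Lspace_def)
      then obtain a where "vec z y = (?q, \<lambda>c. \<Sum>i<r. a i *\<^sub>R comp_in (X i ?q) c)" unfolding im[symmetric] by blast
      then have "comp_in (vec z y) kb = (\<Sum>i<r. a i *\<^sub>R \<xi> i z)" by (simp add: \<xi>_def)
      then show "y \<in> range (\<lambda>a. \<Sum>i<r. a i *\<^sub>R \<xi> i z)" unfolding vec_comp[OF zW(2)[OF z]] by blast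
    next
      fix y assume "y \<in> range (\<lambda>a. \<Sum>i<r. a i *\<^sub>R \<xi> i z)"
      then obtain a where a: "y = (\<Sum>i<r. a i *\<^sub>R \<xi> i z)" by blast
      let ?u = "(?q, \<lambda>c. \<Sum>i<r. restrict a {..<r} i *\<^sub>R comp_in (X i ?q) c)"
      have "restrict a {..<r} \<in> PiE {..<r} (\<lambda>_. UNIV)" by (rule PiE_I) (simp_all add: restrict_def)
      then have u: "?u \<in> fiber L ?q" unfolding im[symmetric] by (rule imageI)
      have "comp_in ?u kb = y" unfolding a \<xi>_def by simp
      moreover have "?u \<in> tangent_space Mb ?q" using u L_in_tangent_space[of ?u] by simp
      ultimately have "vec z y = ?u" using vec_of_comp[OF zW(2)[OF z], of ?u] by simp
      then show "y \<in> Lspace z" using u by (simp add: Lspace_def)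
    }
  qed
  then show ?thesis using oT xT sm by (intro exI[of _ T] exI[of _ r] exI[of _ \<xi>]) (auto simp: T_def)
qed

lemma subspace_Lspace:
  assumes x: "x \<in> S" shows "subspace (Lspace x)"
proof -
  obtain r and \<xi> :: "nat \<Rightarrow> 'f \<Rightarrow> 'f" where "Lspace x = range (\<lambda>a. \<Sum>i<r. a i *\<^sub>R \<xi> i x)"
    using local_frame[OF x] by blast
  note L = this
  show ?thesis
  proof (rule subspaceI)
    have "(\<Sum>i<r. 0 *\<^sub>R \<xi> i x) \<in> Lspace x" unfolding L by (rule range_eqI[where x="\<lambda>i. 0"]) simp
    then show "0 \<in> Lspace x" by simp
    fix y assume "y \<in> Lspace x"
    then obtain a where a: "y = (\<Sum>i<r. a i *\<^sub>R \<xi> i x)" unfolding L by blast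
    show "c *\<^sub>R y \<in> Lspace x" for c
      unfolding L a by (rule range_eqI[where x="\<lambda>i. c * a i"]) (simp add: scaleR_sum_right)
    fix z assume "z \<in> Lspace x"
    then obtain b where b: "z = (\<Sum>i<r. b i *\<^sub>R \<xi> i x)" unfolding L by blast
    show "y + z \<in> Lspace x"
      unfolding L a b by (rule range_eqI[where x="\<lambda>i. a i + b i"]) (simp add: scaleR_add_left sum.distrib)
  qed
qed

lemma tangent_add_vec:
  assumes x: "x \<in> S" and u: "u \<in> tangent_space Mb (param kb x)" and v: "v \<in> tangent_space Mb (param kb x)"
    and eq: "tangent_add u v \<in> tangent_space Mb (param kb x)"
  shows "tangent_add u v = vec x (comp_in u kb + comp_in v kb)"
  using vec_of_comp[OF x eq] by (simp add: tangent_add_def)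

lemma tangent_add_in_tangent_space:
  assumes u: "u \<in> tangent_space Mb p" and v: "v \<in> tangent_space Mb p"
  shows "tangent_add u v \<in> tangent_space Mb p"
proof (rule tangent_spaceI)
  show "base (tangent_add u v) = p" using tangent_space_base[OF u] by (simp add: tangent_add_def)
  show p: "p \<in> points Mb" by (rule tangent_space_points[OF u])
  fix c d assume c: "c \<in> Mb" "d \<in> Mb" "p \<in> dom_of c" "p \<in> dom_of d"
  have "linear (mderiv c d (\<lambda>q. q) p)"
    by (rule has_derivative_linear[OF mdifferentiable_has_derivative[OF mdifferentiable_transition[OF Mb p] c]])
  then show "comp_in (tangent_add u v) d = mderiv c d (\<lambda>q. q) p (comp_in (tangent_add u v) c)"
    unfolding tangent_add_def snd_conv tangent_space_comp[OF u c] tangent_space_comp[OF v c] by (rule linear_add[symmetric])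
next
  fix c assume "\<not> (c \<in> Mb \<and> p \<in> dom_of c)"
  then show "comp_in (tangent_add u v) c = 0"
    using tangent_space_comp_zero[OF u] tangent_space_comp_zero[OF v] by (simp add: tangent_add_def)
qed

lemma vec_add:
  assumes x: "x \<in> S" shows "tangent_add (vec x y) (vec x z) = vec x (y + z)"
proof -
  note ty = vec_in_tangent_space[OF x, of y] and tz = vec_in_tangent_space[OF x, of z]
  show ?thesis using tangent_add_vec[OF x ty tz tangent_add_in_tangent_space[OF ty tz]] by (simp only: vec_comp[OF x])
qed

lemma vec_zero: "x \<in> S \<Longrightarrow> vec x y = tangent_zero (param kb x) \<longleftrightarrow> y = 0"
  using tangent_zero_iff[OF Mb vec_in_tangent_space kb S_point(2)] by (simp add: vec_comp)

lemma vertical_eq: "x \<in> S \<Longrightarrow> vertical_space Mb M \<pi> (param kb x) = vec x ` {y. dP x y = 0}"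
proof (intro equalityI subsetI)
  assume x: "x \<in> S"
  fix u assume u: "u \<in> vertical_space Mb M \<pi> (param kb x)"
  then have "u = vec x (comp_in u kb)" using vec_of_comp[OF x, of u] by (simp add: vertical_space_def)
  then show "u \<in> vec x ` {y. dP x y = 0}" using u vertical_iff[OF x, of "comp_in u kb"] by auto
qed (auto simp: vertical_iff)

lemma Lspace_kernel:
  assumes x: "x \<in> S" and l: "l \<in> Lspace x" "dP x l = 0" shows "l = 0"
proof -
  have "vec x l \<in> fiber L (param kb x) \<inter> vertical_space Mb M \<pi> (param kb x)"
    using l unfolding fiber_L[OF x] vertical_eq[OF x] by blast
  then have "vec x l = tangent_zero (param kb x)"
    using compl S_point(5)[OF x] unfolding complements_vertical_def by blast
  then show ?thesis using vec_zero[OF x] by simp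
qed

lemma decomposition:
  assumes x: "x \<in> S"
  obtains l z where "l \<in> Lspace x" "dP x z = 0" "y = l + z"
proof -
  have "vec x y \<in> {tangent_add l k | l k. l \<in> fiber L (param kb x) \<and> k \<in> vertical_space Mb M \<pi> (param kb x)}"
    using compl S_point(5)[OF x] vec_in_tangent_space[OF x] unfolding complements_vertical_def by blast
  then obtain l z where "l \<in> Lspace x" "dP x z = 0" "vec x y = tangent_add (vec x l) (vec x z)"
    unfolding fiber_L[OF x] vertical_eq[OF x] by blast
  then show ?thesis using that[of l z] vec_inject[OF x, of y "l + z"] by (simp add: vec_add[OF x])
qed

text \<open>The description in the definition of the projection is unique: two candidates for the component in \<open>L\<close> differ by
  an element of \<open>L\<close> and of the kernel of \<open>dP x\<close>.\<close>

lemma distribution_projection_vec: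
  assumes x: "x \<in> S" and l: "l \<in> Lspace x" "dP x l = dP x y"
  shows "distribution_projection Mb M \<pi> L (vec x y) = vec x l"
  unfolding distribution_projection_def vec_base
proof (rule the_equality)
  have "dP x (y - l) = 0" using l(2) by (simp add: linear_diff[OF linear_dP[OF x]])
  moreover have "vec x y = tangent_add (vec x l) (vec x (y - l))" by (simp add: vec_add[OF x])
  ultimately show "vec x l \<in> fiber L (param kb x) \<and>
      (\<exists>z\<in>vertical_space Mb M \<pi> (param kb x). vec x y = tangent_add (vec x l) z)"
    using l(1) unfolding fiber_L[OF x] vertical_eq[OF x] by blast
next
  fix u assume "u \<in> fiber L (param kb x) \<and> (\<exists>z\<in>vertical_space Mb M \<pi> (param kb x). vec x y = tangent_add u z)"
  then obtain m z where m: "u = vec x m" "m \<in> Lspace x" "dP x z = 0" "vec x y = tangent_add (vec x m) (vec x z)"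
    unfolding fiber_L[OF x] vertical_eq[OF x] by blast
  then have "y = m + z" using vec_inject[OF x, of y "m + z"] by (simp add: vec_add[OF x])
  then have "dP x (m - l) = 0" using m(3) l(2) by (simp add: linear_diff[OF linear_dP[OF x]] linear_add[OF linear_dP[OF x]])
  moreover have "m - l \<in> Lspace x" using m(2) l(1) by (intro subspace_diff[OF subspace_Lspace[OF x]])
  ultimately have "m = l" using Lspace_kernel[OF x, of "m - l"] by simp
  then show "u = vec x l" using m(1) by simp
qed

lemma Q_eq: "x \<in> S \<Longrightarrow> l \<in> Lspace x \<Longrightarrow> dP x l = dP x y \<Longrightarrow> Q x y = l"
  unfolding Q_def using distribution_projection_vec vec_comp by simp

lemma Q_in:
  assumes x: "x \<in> S" shows "Q x y \<in> Lspace x \<and> dP x (Q x y) = dP x y"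
proof -
  obtain l z where l: "l \<in> Lspace x" "dP x z = 0" "y = l + z" by (rule decomposition[OF x])
  then have "dP x l = dP x y" by (simp add: linear_add[OF linear_dP[OF x]])
  then show ?thesis using Q_eq[OF x l(1)] l(1) by simp
qed

lemmas Q_Lspace = Q_in[THEN conjunct1] and dP_Q = Q_in[THEN conjunct2]

lemma Q_fix: "x \<in> S \<Longrightarrow> l \<in> Lspace x \<Longrightarrow> Q x l = l"
  by (rule Q_eq) simp_all

lemma projection_vec: "x \<in> S \<Longrightarrow> distribution_projection Mb M \<pi> L (vec x y) = vec x (Q x y)"
  by (rule distribution_projection_vec[OF _ Q_Lspace dP_Q])

lemma linear_Q: assumes x: "x \<in> S" shows "linear (Q x)"
proof (rule linearI)
  note s = subspace_Lspace[OF x] and l = linear_dP[OF x]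
  show "Q x (y + z) = Q x y + Q x z" for y z
    by (rule Q_eq[OF x]) (simp_all add: subspace_add[OF s] Q_Lspace[OF x] linear_add[OF l] dP_Q[OF x])
  show "Q x (c *\<^sub>R y) = c *\<^sub>R Q x y" for c y
    by (rule Q_eq[OF x]) (simp_all add: subspace_scale[OF s] Q_Lspace[OF x] linear_cmul[OF l] dP_Q[OF x])
qed

lemma smooth_Q: "smooth_on S (\<lambda>x. Q x y)"
proof (rule smooth_on_locally)
  fix x0 assume x0: "x0 \<in> S"
  obtain T r and \<xi> :: "nat \<Rightarrow> 'f \<Rightarrow> 'f" where T: "open T" "x0 \<in> T" "T \<subseteq> S"
    and \<xi>: "\<And>i. i < r \<Longrightarrow> smooth_on T (\<xi> i)" and L: "\<And>z. z \<in> T \<Longrightarrow> Lspace z = range (\<lambda>a. \<Sum>i<r. a i *\<^sub>R \<xi> i z)"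
    using local_frame[OF x0] by blast
  have "\<exists>T'. open T' \<and> x0 \<in> T' \<and> T' \<subseteq> T \<and> smooth_on T' (\<lambda>x. Q x y)"
  proof (rule smooth_on_projection_family[OF T(1,2) _ smooth_on_subset[OF smooth_dP T(3)] \<xi> L])
    show "linear (dP x)" if "x \<in> T" for x using linear_dP that T(3) by blast
    show "\<exists>y\<in>Lspace x0. dP x0 y = e" for e
      using dP_surj[OF x0, of e] Q_in[OF x0] by metis
    show "Q x y = l" if "x \<in> T" "l \<in> Lspace x" "dP x l = dP x y" for x y l
      using Q_eq that T(3) by blast
  qed
  then show "\<exists>T. open T \<and> x0 \<in> T \<and> smooth_on T (\<lambda>x. Q x y)" by blast
qed

end

section \<open>Sprays in adapted charts\<close>

lemma spray_at:
  assumes M: "smooth_atlas M" and G: "spray M G" and k: "k \<in> M" "p \<in> dom_of k"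
    and u: "u \<in> tangent_space M p" "comp_in u k \<noteq> 0"
  shows "G u \<in> tangent_space (tangent_bundle M) u"
    "comp_in (G u) (tangent_chart M k) = (comp_in u k, - 2 *\<^sub>R spray_coeff M G k (coord k p) (comp_in u k))"
proof -
  have b: "base u = p" by (rule tangent_space_base[OF u(1)])
  have "u \<noteq> tangent_zero p" using tangent_zero_iff[OF M u(1) k] u(2) by simp
  then have us: "u \<in> points (slit_bundle M)"
    using u(1) by (simp add: slit_bundle_def points_open_submanifold points_tangent_bundle b)
  have bG: "base (G u) = u" using G us by (simp add: spray_def)
  have sm: "smooth_map (slit_bundle M) (tangent_bundle (tangent_bundle M)) G" using G by (simp add: spray_def)
  have "G u \<in> points (tangent_bundle (tangent_bundle M))" by (rule smooth_map_in_points[OF sm us])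
  then show "G u \<in> tangent_space (tangent_bundle M) u" by (simp add: points_tangent_bundle bG)
  have "fst (comp_in (G u) (tangent_chart M k)) = comp_in u k" using G us k by (simp add: spray_def b)
  moreover have "snd (comp_in (G u) (tangent_chart M k)) = - 2 *\<^sub>R spray_coeff M G k (coord k p) (comp_in u k)"
    by (simp add: spray_coeff_def param_coord[OF M k] coord_vector_of_comp[OF M k u(1)])
  ultimately show "comp_in (G u) (tangent_chart M k) = (comp_in u k, - 2 *\<^sub>R spray_coeff M G k (coord k p) (comp_in u k))"
    by (rule prod_eqI[of "comp_in (G u) (tangent_chart M k)" "(_, _)", unfolded fst_conv snd_conv])
qed

lemma smooth_on_spray_coeff:
  fixes M :: "('a, 'e::euclidean_space) atlas"
  assumes M: "smooth_atlas M" and G: "spray M G" and k: "k \<in> M"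
  shows "smooth_on (coord k ` dom_of k \<times> (- {0})) (\<lambda>z. spray_coeff M G k (fst z) (snd z))"
proof -
  let ?t = "tangent_chart M k" and ?T = "tangent_chart (tangent_bundle M) (tangent_chart M k)"
  let ?c = "(dom_of ?t \<inter> nonzero_vectors, coord ?t)"
  let ?U = "coord k ` dom_of k \<times> (- {0 :: 'e})"
  have sm: "smooth_map (slit_bundle M) (tangent_bundle (tangent_bundle M)) G" using G by (simp add: spray_def)
  have t: "?t \<in> tangent_bundle M" by (rule tangent_chart_in_bundle[OF k])
  have c: "?c \<in> slit_bundle M" using t by (simp add: slit_bundle_def open_submanifold_def)
  have T: "?T \<in> tangent_bundle (tangent_bundle M)" by (rule tangent_chart_in_bundle[OF t])
  have dom: "G u \<in> dom_of ?T" if "u \<in> dom_of ?t \<inter> nonzero_vectors" for u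
  proof -
    have us: "u \<in> points (slit_bundle M)" unfolding points_def by (rule UN_I[OF c]) (use that in simp)
    have bG: "base (G u) = u" using G us by (simp add: spray_def)
    have "G u \<in> points (tangent_bundle (tangent_bundle M))" by (rule smooth_map_in_points[OF sm us])
    then show ?thesis using that by (simp add: points_tangent_bundle tangent_chart_dom[of _ "tangent_bundle M"] bG)
  qed
  have O: "open ?U" using smooth_atlas_open_chart[OF M k] by (intro open_Times) (auto simp: open_Compl)
  have "dom_of ?c \<inter> G -` dom_of ?T = dom_of ?t \<inter> nonzero_vectors" using dom by auto
  then have "smooth_on ?U (local_rep ?c ?T G)"
    using smooth_map_smooth_on[OF sm c T] slit_chart_image[OF M k] by simp
  then have "smooth_on ?U (\<lambda>z. (- (1/2)) *\<^sub>R snd (snd (local_rep ?c ?T G z)))"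
    by (intro smooth_on_bounded_linear[OF bounded_linear_scaleR_right O]
        smooth_on_bounded_linear[OF bounded_linear_snd O])
  then show ?thesis
  proof (rule smooth_on_cong[OF O, rotated])
    fix z assume z: "z \<in> ?U"
    have "param ?c z = param ?t z"
      by (rule param_open_submanifold[OF smooth_atlas_tangent_bundle[OF M] t]) (use z slit_chart_image[OF M k] in simp)
    moreover have "param ?t z = coord_vector M k (param k (fst z)) (snd z)"
      using tangent_chart_param[OF M k, of "fst z" "snd z"] z by auto
    ultimately show "(- (1/2)) *\<^sub>R snd (snd (local_rep ?c ?T G z)) = spray_coeff M G k (fst z) (snd z)"
      by (simp add: local_rep_def spray_coeff_def)
  qed
qed

lemma velocity_cong:
  fixes A :: "('a, 'e::euclidean_space) atlas"
  assumes J: "open J" "t \<in> J" and eq: "\<And>s. s \<in> J \<Longrightarrow> \<gamma> s = \<gamma>' s"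
  shows "velocity A \<gamma> t = velocity A \<gamma>' t"
proof -
  have "((\<lambda>s. coord d (\<gamma> s)) has_vector_derivative D) (at t) \<longleftrightarrow> ((\<lambda>s. coord d (\<gamma>' s)) has_vector_derivative D) (at t)" for d :: "('a, 'e) chart" and D
    using has_vector_derivative_transform_within_open[of "\<lambda>s. coord d (\<gamma> s)" D t J "\<lambda>s. coord d (\<gamma>' s)"]
      has_vector_derivative_transform_within_open[of "\<lambda>s. coord d (\<gamma>' s)" D t J "\<lambda>s. coord d (\<gamma> s)"] J eq by auto
  then have vd: "vector_derivative (\<lambda>s. coord d (\<gamma> s)) (at t) = vector_derivative (\<lambda>s. coord d (\<gamma>' s)) (at t)" for d :: "('a, 'e) chart"
    unfolding vector_derivative_def by (simp only:)
  show ?thesis unfolding velocity_def vd eq[OF J(2)] ..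
qed

lemma has_vector_derivative_compose_frechet:
  assumes f: "(f has_vector_derivative v) (at t)" and g: "(g has_derivative D) (at (f t))"
  shows "((\<lambda>s. g (f s)) has_vector_derivative D v) (at t)"
  using diff_chain_at[OF f[unfolded has_vector_derivative_def] g] linear_cmul[OF has_derivative_linear[OF g]]
  by (simp add: has_vector_derivative_def o_def)

locale spray_submersion_charts = submersion_charts Mb M \<pi> L kb k
  for Mb :: "('b, 'f::euclidean_space) atlas" and M :: "('a, 'e::euclidean_space) atlas" and \<pi> L kb k +
  fixes G :: "('a, 'e) tangent \<Rightarrow> (('a, 'e) tangent, 'e \<times> 'e) tangent"
    and Gb :: "('b, 'f) tangent \<Rightarrow> (('b, 'f) tangent, 'f \<times> 'f) tangent"
  assumes G: "spray M G" and Gb: "spray Mb Gb"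
    and Gb_tangent: "u \<in> L \<Longrightarrow> u \<in> nonzero_vectors \<Longrightarrow> Gb u \<in> subset_tangent_space (tangent_bundle Mb) (L \<inter> nonzero_vectors) u"
    and geodesics: "geodesic Mb Gb I cb \<Longrightarrow> \<forall>t\<in>I. velocity Mb cb t \<in> L \<inter> nonzero_vectors \<Longrightarrow> geodesic M G I (\<lambda>t. \<pi> (cb t))"
begin

abbreviation (input) tb where "tb \<equiv> tangent_chart Mb kb"
abbreviation (input) Gs where "Gs \<equiv> spray_coeff Mb Gb kb"
abbreviation (input) DQ where "DQ x y \<equiv> frechet_derivative (\<lambda>x. Q x y) (at x)"

lemma TMb: "smooth_atlas (tangent_bundle Mb)" by (rule smooth_atlas_tangent_bundle[OF Mb])
lemma TM: "smooth_atlas (tangent_bundle M)" by (rule smooth_atlas_tangent_bundle[OF M])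
lemma tb: "tb \<in> tangent_bundle Mb" by (rule tangent_chart_in_bundle[OF kb])

lemma vec_in_tangent_chart: "x \<in> S \<Longrightarrow> vec x y \<in> dom_of tb" "x \<in> S \<Longrightarrow> coord tb (vec x y) = (x, y)"
  using vec_in_tangent_space[of x y] S_point(2,4)[of x] vec_comp[of x y] by (auto simp: tangent_chart_dom)

lemma vec_nonzero: "x \<in> S \<Longrightarrow> vec x y \<in> nonzero_vectors \<longleftrightarrow> y \<noteq> 0"
  using vec_zero by simp

text \<open>A curve \<open>(X, Y)\<close> in \<open>L\<close> that represents the value of \<open>Gb\<close> satisfies \<open>Y = Q X Y\<close>; the equation is the
  derivative of this identity at \<open>0\<close>.\<close>

lemma spray_tangency:
  assumes x: "x \<in> S" and y: "y \<in> Lspace x" "y \<noteq> 0"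
  shows "- 2 *\<^sub>R Gs x y = DQ x y y + Q x (- 2 *\<^sub>R Gs x y)"
proof -
  have "vec x y \<in> L" "vec x y \<in> nonzero_vectors" using y vec_nonzero[OF x] by (auto simp: Lspace_def)
  from Gb_tangent[OF this] obtain \<gamma> \<epsilon> where \<gamma>: "Gb (vec x y) = velocity (tangent_bundle Mb) \<gamma> 0" "0 < \<epsilon>"
    "smooth_curve (tangent_bundle Mb) {-\<epsilon><..<\<epsilon>} \<gamma>" "\<gamma> ` {-\<epsilon><..<\<epsilon>} \<subseteq> L \<inter> nonzero_vectors" "\<gamma> 0 = vec x y"
    unfolding subset_tangent_space_def by blast
  have 0: "0 \<in> {-\<epsilon><..<\<epsilon>}" using \<gamma>(2) by simp
  have d0: "\<gamma> 0 \<in> dom_of tb" unfolding \<gamma>(5) by (rule vec_in_tangent_chart(1)[OF x])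
  have c: "comp_in (velocity (tangent_bundle Mb) \<gamma> 0) tb = (y, - 2 *\<^sub>R Gs x y)"
    using spray_at(2)[OF Mb Gb kb S_point(2)[OF x] vec_in_tangent_space[OF x, of y]] y(2) unfolding \<gamma>(1)[symmetric] by (simp add: vec_comp[OF x] S_point(4)[OF x])
  have h: "((\<lambda>s. coord tb (\<gamma> s)) has_vector_derivative (y, - 2 *\<^sub>R Gs x y)) (at 0)"
    using smooth_curve_has_vector_derivative[OF TMb \<gamma>(3) tb 0 d0] unfolding c .
  have f0: "coord tb (\<gamma> 0) = (x, y)" unfolding \<gamma>(5) by (rule vec_in_tangent_chart(2)[OF x])
  have q: "((\<lambda>s. Q (fst (coord tb (\<gamma> s))) (snd (coord tb (\<gamma> s)))) has_vector_derivative
      DQ x y y + Q x (- 2 *\<^sub>R Gs x y)) (at 0)"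
    using has_vector_derivative_compose_frechet[OF h, of "\<lambda>z. Q (fst z) (snd z)"]
      linear_family_has_derivative[of S x Q y, OF open_S x linear_Q smooth_Q] unfolding f0 by fastforce
  have s: "((\<lambda>s. snd (coord tb (\<gamma> s))) has_vector_derivative - 2 *\<^sub>R Gs x y) (at 0)"
    using bounded_linear.has_vector_derivative[OF bounded_linear_snd h] by simp
  have "\<forall>\<^sub>F s in nhds 0. coord tb (\<gamma> s) \<in> S \<times> UNIV"
  proof -
    have "isCont (\<lambda>s. coord tb (\<gamma> s)) 0" using h by (rule has_vector_derivative_continuous)
    then have "((\<lambda>s. coord tb (\<gamma> s)) \<longlongrightarrow> (x, y)) (nhds 0)"
      using tendsto_at_iff_tendsto_nhds[of "\<lambda>s. coord tb (\<gamma> s)" 0] by (simp only: isCont_def f0)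
    from topological_tendstoD[OF this, of "S \<times> UNIV"] show ?thesis using open_S x by (simp add: open_Times)
  qed
  with smooth_curve_eventually[OF TMb \<gamma>(3) tb 0 d0]
  have "\<forall>\<^sub>F s in nhds 0. Q (fst (coord tb (\<gamma> s))) (snd (coord tb (\<gamma> s))) = snd (coord tb (\<gamma> s))"
  proof eventually_elim
    case (elim s)
    have b: "base (\<gamma> s) \<in> dom_of kb" "\<gamma> s \<in> tangent_space Mb (base (\<gamma> s))"
      using elim(1) unfolding tangent_chart_dom by auto
    have xs: "coord kb (base (\<gamma> s)) \<in> S" using elim(2) by simp
    have "vec (coord kb (base (\<gamma> s))) (comp_in (\<gamma> s) kb) = \<gamma> s" by (rule vec_coord[OF b])
    moreover have "\<gamma> s \<in> L" using elim(1) \<gamma>(4) by auto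
    ultimately have "comp_in (\<gamma> s) kb \<in> Lspace (coord kb (base (\<gamma> s)))" by (simp add: Lspace_def)
    then show ?case using Q_fix[OF xs] by simp
  qed
  from has_derivative_transform_eventually_nhds[OF q[unfolded has_vector_derivative_def] this]
  have "((\<lambda>s. snd (coord tb (\<gamma> s))) has_vector_derivative DQ x y y + Q x (- 2 *\<^sub>R Gs x y)) (at 0)"
    unfolding has_vector_derivative_def .
  from vector_derivative_unique_at[OF s this] show ?thesis .
qed

text \<open>The derivative of the identity \<open>Q x (Q x v) = Q x v\<close> in direction \<open>w\<close>.\<close>

lemma DQ_idempotent:
  assumes x: "x \<in> S"
  shows "DQ x v w = DQ x (Q x v) w + Q x (DQ x v w)"
proof -
  have D: "((\<lambda>x. Q x v) has_derivative DQ x v) (at x)" by (rule smooth_on_has_derivative[OF smooth_Q x])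
  have "((\<lambda>x'. (x', Q x' v)) has_derivative (\<lambda>h. (h, DQ x v h))) (at x)"
    by (intro has_derivative_Pair has_derivative_ident D)
  from diff_chain_at[OF this linear_family_has_derivative[of S x Q "Q x v", OF open_S x linear_Q smooth_Q]]
  have "((\<lambda>x'. Q x' (Q x' v)) has_derivative (\<lambda>h. DQ x (Q x v) h + Q x (DQ x v h))) (at x)"
    by (simp add: o_def)
  then have "((\<lambda>x'. Q x' v) has_derivative (\<lambda>h. DQ x (Q x v) h + Q x (DQ x v h))) (at x)"
    by (rule has_derivative_transform_within_open[OF _ open_S x]) (simp add: Q_fix Q_Lspace)
  from fun_cong[OF has_derivative_unique[OF D this], of w] show ?thesis .
qed

end

section \<open>Geodesics tangent to the distribution\<close>

context spray_submersion_charts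
begin

lemma smooth_Gs: "smooth_on (S \<times> (- {0})) (\<lambda>z. Gs (fst z) (snd z))"
  by (rule smooth_on_subset[OF smooth_on_spray_coeff[OF Mb Gb kb]]) (use S_point(1) in auto)

lemma smooth_Q_pair: "smooth_on (S \<times> UNIV) (\<lambda>z. Q (fst z) (snd z))"
  by (rule smooth_on_linear_family_pair[OF open_S linear_Q smooth_Q])

text \<open>The system \<open>x' = Q x v\<close>, \<open>v' = - 2 Gs(x, Q x v) - DQ x v (Q x v)\<close> is solved instead of the geodesic
  equation, and \<open>\<eta> = Q x v\<close>, which lies in \<open>L\<close> by construction. Its derivative is
  \<open>DQ x v \<eta> + Q x v'\<close>. The tangency of \<open>Gb\<close> to \<open>L\<close> and the identity \<open>DQ_idempotent\<close> reduce this to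
  \<open>- 2 Gs(x, \<eta>)\<close>, so that \<open>x\<close> is a geodesic with velocity \<open>\<eta>\<close>.\<close>

lemma geodesic_ode_solution:
  assumes x0: "x0 \<in> S" and y0: "y0 \<in> Lspace x0" "y0 \<noteq> 0"
  obtains d \<xi> \<eta> where "d > 0" "\<xi> 0 = x0" "\<eta> 0 = y0" "smooth_on {-d<..<d} \<xi>" "smooth_on {-d<..<d} \<eta>"
    "\<And>t. t \<in> {-d<..<d} \<Longrightarrow> \<xi> t \<in> S \<and> \<eta> t \<in> Lspace (\<xi> t) \<and> \<eta> t \<noteq> 0"
    "\<And>t. t \<in> {-d<..<d} \<Longrightarrow> (\<xi> has_vector_derivative \<eta> t) (at t)"
    "\<And>t. t \<in> {-d<..<d} \<Longrightarrow> (\<eta> has_vector_derivative - 2 *\<^sub>R Gs (\<xi> t) (\<eta> t)) (at t)"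
proof -
  let ?q = "\<lambda>z. Q (fst z) (snd z)"
  let ?U = "(S \<times> UNIV) \<inter> ?q -` (- {0})"
  \<comment> \<open>The derivative of \<open>?q\<close> in direction \<open>(w, 0)\<close> is \<open>DQ x v w\<close>, and in this form it is visibly smooth in
    the pair \<open>(x, v)\<close>.\<close>
  define F where "F = (\<lambda>z. (?q z, - 2 *\<^sub>R Gs (fst z) (?q z) - frechet_derivative ?q (at z) (?q z, 0)))"
  have O: "open (S \<times> (UNIV :: 'f set))" using open_S by (simp add: open_Times)
  have U: "open ?U"
    by (rule continuous_open_preimage[OF smooth_on_imp_continuous_on[OF smooth_Q_pair] O]) (simp add: open_Compl)
  have z0: "(x0, y0) \<in> ?U" using x0 y0 Q_fix[OF x0 y0(1)] by simp
  have q: "smooth_on ?U ?q" by (rule smooth_on_subset[OF smooth_Q_pair]) auto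
  have OS: "open (S \<times> (- {0 :: 'f}))" using open_S by (intro open_Times) (auto simp: open_Compl)
  have g: "smooth_on ?U (\<lambda>z. Gs (fst z) (?q z))"
    using smooth_on_compose[OF U OS smooth_on_Pair[OF U smooth_on_fst[OF U] q] smooth_Gs] by auto
  have h: "smooth_on ?U (\<lambda>z. frechet_derivative ?q (at z) (?q z, 0))"
    by (rule smooth_on_derivative_apply[OF U q smooth_on_Pair[OF U q smooth_on_const]])
  have F: "smooth_on ?U F"
    unfolding F_def diff_conv_add_uminus
    by (rule smooth_on_Pair[OF U q smooth_on_add[OF U smooth_on_bounded_linear[OF bounded_linear_scaleR_right U g]
          smooth_on_bounded_linear[OF bounded_linear_minus[OF bounded_linear_ident] U h]]])
  obtain d z where d: "d > 0" "z 0 = (x0, y0)" and zU: "\<And>t. t \<in> {-d<..<d} \<Longrightarrow> z t \<in> ?U"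
    and z': "\<And>t. t \<in> {-d<..<d} \<Longrightarrow> (z has_vector_derivative F (z t)) (at t)"
    by (rule ode_local_existence[OF U z0 F]) blast
  have sz: "smooth_on {-d<..<d} z" by (rule ode_solution_smooth[OF _ U F zU z']) auto
  define \<xi> where "\<xi> = (\<lambda>t. fst (z t))"
  define \<eta> where "\<eta> = (\<lambda>t. Q (fst (z t)) (snd (z t)))"
  have J: "open {-d<..<d}" by simp
  show ?thesis
  proof (rule that[of d \<xi> \<eta>])
    show "d > 0" by fact
    show "\<xi> 0 = x0" "\<eta> 0 = y0" using d(2) Q_fix[OF x0 y0(1)] by (auto simp: \<xi>_def \<eta>_def)
    show "smooth_on {-d<..<d} \<xi>" unfolding \<xi>_def by (rule smooth_on_bounded_linear[OF bounded_linear_fst J sz])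
    show "smooth_on {-d<..<d} \<eta>" unfolding \<eta>_def by (rule smooth_on_compose[OF J U sz q zU])
    fix t assume t: "t \<in> {-d<..<d}"
    define x where "x = \<xi> t"
    define v where "v = snd (z t)"
    have zt: "z t = (x, v)" by (simp add: x_def \<xi>_def v_def)
    have x: "x \<in> S" and nz: "Q x v \<noteq> 0" using zU[OF t] by (auto simp: zt)
    have \<eta>t: "\<eta> t = Q x v" by (simp add: \<eta>_def zt)
    show in_L: "\<xi> t \<in> S \<and> \<eta> t \<in> Lspace (\<xi> t) \<and> \<eta> t \<noteq> 0"
      using x nz Q_Lspace[OF x] by (simp add: \<eta>t x_def[symmetric])
    note Dq = linear_family_has_derivative[of S x Q v, OF open_S x linear_Q smooth_Q]
    have Fz: "F (z t) = (Q x v, - 2 *\<^sub>R Gs x (Q x v) - DQ x v (Q x v))"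
      unfolding F_def zt using fun_cong[OF frechet_derivative_at[OF Dq], of "(Q x v, 0)"] linear_0[OF linear_Q[OF x]] by simp
    note zd = z'[OF t, unfolded Fz]
    show "(\<xi> has_vector_derivative \<eta> t) (at t)"
      using bounded_linear.has_vector_derivative[OF bounded_linear_fst zd] by (simp add: \<xi>_def \<eta>t)
    have "(\<eta> has_vector_derivative DQ x v (Q x v) + Q x (- 2 *\<^sub>R Gs x (Q x v) - DQ x v (Q x v))) (at t)"
      using has_vector_derivative_compose_frechet[OF zd, of ?q] Dq unfolding \<eta>_def zt by fastforce
    moreover have "DQ x v (Q x v) + Q x (- 2 *\<^sub>R Gs x (Q x v) - DQ x v (Q x v)) = - 2 *\<^sub>R Gs x (Q x v)"
    proof -
      have alg: "g = a + qg \<Longrightarrow> d = a + qd \<Longrightarrow> d + (qg - qd) = g" for a d g qd qg :: 'f by simp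
      show ?thesis
        unfolding linear_diff[OF linear_Q[OF x]]
        by (rule alg[OF spray_tangency[OF x Q_Lspace[OF x] nz] DQ_idempotent[OF x, of v "Q x v"]])
    qed
    ultimately show "(\<eta> has_vector_derivative - 2 *\<^sub>R Gs (\<xi> t) (\<eta> t)) (at t)"
      by (simp add: \<eta>t x_def[symmetric])
  qed
qed

lemma velocity_param:
  assumes J: "open J" "is_interval J" and \<xi>: "smooth_on J \<xi>" and im: "\<And>t. t \<in> J \<Longrightarrow> \<xi> t \<in> S" and t: "t \<in> J"
    and d: "(\<xi> has_vector_derivative y) (at t)"
  shows "velocity Mb (\<lambda>t. param kb (\<xi> t)) t = vec (\<xi> t) y"
proof (rule tangent_eqI[OF velocity_in_tangent_space[OF Mb smooth_curveI[OF Mb kb J \<xi>] t] vec_in_tangent_space[OF im[OF t]] kb S_point(2)[OF im[OF t]]])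
  show "\<And>t. t \<in> J \<Longrightarrow> \<xi> t \<in> coord kb ` dom_of kb" by (rule S_point(1)[OF im])
  have "((\<lambda>s. coord kb (param kb (\<xi> s))) has_vector_derivative y) (at t)"
    by (rule has_vector_derivative_transform_within_open[OF d J(1) t]) (rule S_point(4)[OF im, symmetric])
  from vector_derivative_at[OF this]
  show "comp_in (velocity Mb (\<lambda>t. param kb (\<xi> t)) t) kb = comp_in (vec (\<xi> t) y) kb"
    unfolding velocity_comp[of kb Mb "\<lambda>t. param kb (\<xi> t)", OF kb S_point(2)[OF im[OF t]]] vec_comp[OF im[OF t]] .
qed

text \<open>The converse passage from coordinates: the velocity of the curve is \<open>vec (\<xi> t) (\<eta> t)\<close>, and its own
  velocity has the components that the spray prescribes.\<close>

lemma geodesic_param: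
  assumes J: "open J" "is_interval J" and \<xi>: "smooth_on J \<xi>" and \<eta>: "smooth_on J \<eta>"
    and im: "\<And>t. t \<in> J \<Longrightarrow> \<xi> t \<in> S \<and> \<eta> t \<in> Lspace (\<xi> t) \<and> \<eta> t \<noteq> 0"
    and d\<xi>: "\<And>t. t \<in> J \<Longrightarrow> (\<xi> has_vector_derivative \<eta> t) (at t)"
    and d\<eta>: "\<And>t. t \<in> J \<Longrightarrow> (\<eta> has_vector_derivative - 2 *\<^sub>R Gs (\<xi> t) (\<eta> t)) (at t)"
  shows "geodesic Mb Gb J (\<lambda>t. param kb (\<xi> t))"
    and "\<forall>t\<in>J. velocity Mb (\<lambda>t. param kb (\<xi> t)) t \<in> L \<inter> nonzero_vectors"
proof -
  let ?c = "\<lambda>t. param kb (\<xi> t)"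
  have S: "\<xi> t \<in> S" if "t \<in> J" for t using im that by blast
  have c: "smooth_curve Mb J ?c" by (rule smooth_curveI[OF Mb kb J \<xi> S_point(1)[OF S]])
  have vel: "velocity Mb ?c t = vec (\<xi> t) (\<eta> t)" if "t \<in> J" for t
    by (rule velocity_param[OF J \<xi> S that d\<xi>[OF that]])
  show vL: "\<forall>t\<in>J. velocity Mb ?c t \<in> L \<inter> nonzero_vectors"
  proof
    fix t assume t: "t \<in> J"
    show "velocity Mb ?c t \<in> L \<inter> nonzero_vectors"
      unfolding vel[OF t] using im[OF t] vec_nonzero[OF S[OF t], of "\<eta> t"] by (simp add: Lspace_def)
  qed
  have sp: "smooth_on J (\<lambda>t. (\<xi> t, \<eta> t))" by (rule smooth_on_Pair[OF J(1) \<xi> \<eta>])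
  have tim: "(\<xi> t, \<eta> t) \<in> coord tb ` dom_of tb" if "t \<in> J" for t
    unfolding tangent_chart_image_dom[OF Mb kb] using S_point(1)[OF S[OF that]] by simp
  note sc = smooth_curveI[OF TMb tb J sp tim]
  have eq: "velocity Mb ?c t = param tb (\<xi> t, \<eta> t)" if "t \<in> J" for t
    unfolding vel[OF that] tangent_chart_param[OF Mb kb S_point(1)[OF S[OF that]]] vec_def ..
  have "velocity (tangent_bundle Mb) (velocity Mb ?c) t = Gb (velocity Mb ?c t)" if t: "t \<in> J" for t
  proof -
    note x = S[OF t]
    have v1: "velocity (tangent_bundle Mb) (velocity Mb ?c) t = velocity (tangent_bundle Mb) (\<lambda>t. param tb (\<xi> t, \<eta> t)) t"
      by (rule velocity_cong[OF J(1) t eq])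
    have "comp_in (velocity (tangent_bundle Mb) (\<lambda>t. param tb (\<xi> t, \<eta> t)) t) tb = (\<eta> t, - 2 *\<^sub>R Gs (\<xi> t) (\<eta> t))"
    proof -
      have "((\<lambda>t. (\<xi> t, \<eta> t)) has_vector_derivative (\<eta> t, - 2 *\<^sub>R Gs (\<xi> t) (\<eta> t))) (at t)"
        by (rule has_vector_derivative_Pair[OF d\<xi>[OF t] d\<eta>[OF t]])
      then have "((\<lambda>s. coord tb (param tb (\<xi> s, \<eta> s))) has_vector_derivative (\<eta> t, - 2 *\<^sub>R Gs (\<xi> t) (\<eta> t))) (at t)"
        by (rule has_vector_derivative_transform_within_open[OF _ J(1) t]) (rule coord_param[OF tim, symmetric])
      from vector_derivative_at[OF this] show ?thesis
        unfolding velocity_comp[of tb "tangent_bundle Mb" "\<lambda>t. param tb (\<xi> t, \<eta> t)", OF tb param_in_dom[OF tim[OF t]]] .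
    qed
    moreover have "comp_in (Gb (vec (\<xi> t) (\<eta> t))) tb = (\<eta> t, - 2 *\<^sub>R Gs (\<xi> t) (\<eta> t))"
      using spray_at(2)[OF Mb Gb kb S_point(2)[OF x] vec_in_tangent_space[OF x, of "\<eta> t"]] im[OF t] by (simp add: vec_comp[OF x] S_point(4)[OF x])
    moreover have "Gb (vec (\<xi> t) (\<eta> t)) \<in> tangent_space (tangent_bundle Mb) (vec (\<xi> t) (\<eta> t))"
      using spray_at(1)[OF Mb Gb kb S_point(2)[OF x] vec_in_tangent_space[OF x, of "\<eta> t"]] im[OF t] by (simp add: vec_comp[OF x])
    moreover have "velocity (tangent_bundle Mb) (\<lambda>t. param tb (\<xi> t, \<eta> t)) t \<in> tangent_space (tangent_bundle Mb) (vec (\<xi> t) (\<eta> t))"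
      using velocity_in_tangent_space[OF TMb sc t] unfolding eq[OF t, symmetric] vel[OF t] .
    ultimately show ?thesis
      unfolding v1 vel[OF t] using tangent_eqI[OF _ _ tb vec_in_tangent_chart(1)[OF x]] by simp
  qed
  then show "geodesic Mb Gb J ?c" using c vL by (auto simp: geodesic_def)
qed

text \<open>The image under \<open>\<pi>\<close> of the geodesic through \<open>(x, y)\<close> is a geodesic of \<open>G\<close>. Its velocity is \<open>dP (\<xi> s) (\<eta> s)\<close>;
  the derivative of this expression at \<open>0\<close> is computed by the product rule on one side and prescribed by \<open>G\<close> on the
  other.\<close>

lemma spray_relation:
  assumes x: "x \<in> S" and y: "y \<in> Lspace x" "y \<noteq> 0"
  shows "frechet_derivative (\<lambda>x. dP x y) (at x) y - 2 *\<^sub>R dP x (Gs x y) = - 2 *\<^sub>R spray_coeff M G k (P x) (dP x y)"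
proof -
  obtain d \<xi> \<eta> where d: "d > 0" and 0: "\<xi> 0 = x" "\<eta> 0 = y" and sm: "smooth_on {-d<..<d} \<xi>" "smooth_on {-d<..<d} \<eta>"
    and im: "\<And>t. t \<in> {-d<..<d} \<Longrightarrow> \<xi> t \<in> S \<and> \<eta> t \<in> Lspace (\<xi> t) \<and> \<eta> t \<noteq> 0"
    and d\<xi>: "\<And>t. t \<in> {-d<..<d} \<Longrightarrow> (\<xi> has_vector_derivative \<eta> t) (at t)"
    and d\<eta>: "\<And>t. t \<in> {-d<..<d} \<Longrightarrow> (\<eta> has_vector_derivative - 2 *\<^sub>R Gs (\<xi> t) (\<eta> t)) (at t)"
    by (rule geodesic_ode_solution[OF x y]) blast
  let ?J = "{-d<..<d}"
  let ?c = "\<lambda>t. \<pi> (param kb (\<xi> t))"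
  have J: "open ?J" "is_interval ?J" "0 \<in> ?J" using d by (auto simp: is_interval_oo)
  have S: "\<xi> t \<in> S" if "t \<in> ?J" for t using im that by blast
  have g: "geodesic M G ?J ?c" by (rule geodesics[OF geodesic_param[OF J(1,2) sm im d\<xi> d\<eta>]])
  then have sc: "smooth_curve M ?J ?c" by (simp add: geodesic_def)
  have vel: "comp_in (velocity M ?c t) k = dP (\<xi> t) (\<eta> t)" if t: "t \<in> ?J" for t
  proof -
    have "((\<lambda>s. P (\<xi> s)) has_vector_derivative dP (\<xi> t) (\<eta> t)) (at t)"
      by (rule has_vector_derivative_compose_frechet[OF d\<xi>[OF t] P_has_derivative[OF S[OF t]]])
    then have "((\<lambda>s. coord k (?c s)) has_vector_derivative dP (\<xi> t) (\<eta> t)) (at t)"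
      by (rule has_vector_derivative_transform_within_open[OF _ J(1) t]) (rule S_point(7)[OF S, symmetric])
    from vector_derivative_at[OF this] show ?thesis
      unfolding velocity_comp[of k M ?c, OF k S_point(3)[OF S[OF t]]] .
  qed
  let ?v = "velocity M ?c 0"
  let ?t = "tangent_chart M k"
  have tk: "?t \<in> tangent_bundle M" by (rule tangent_chart_in_bundle[OF k])
  have vts: "?v \<in> tangent_space M (\<pi> (param kb x))" using velocity_in_tangent_space[OF M sc J(3)] by (simp add: 0)
  have vk: "comp_in ?v k = dP x y" using vel[OF J(3)] by (simp add: 0)
  have nz: "dP x y \<noteq> 0" using Lspace_kernel[OF x y(1)] y(2) by blast
  have bv: "base ?v = \<pi> (param kb x)" by (simp add: 0)
  have vt: "?v \<in> dom_of ?t" unfolding tangent_chart_dom bv using vts S_point(3)[OF x] by simp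
  have "comp_in (velocity (tangent_bundle M) (velocity M ?c) 0) ?t
     = (dP x y, - 2 *\<^sub>R spray_coeff M G k (P x) (dP x y))"
    using g J(3) spray_at(2)[OF M G k S_point(3)[OF x] vts] nz unfolding geodesic_def vk S_point(7)[OF x] by simp
  moreover have "comp_in (velocity (tangent_bundle M) (velocity M ?c) 0) ?t
     = (dP x y, frechet_derivative (\<lambda>x. dP x y) (at x) y + dP x (- 2 *\<^sub>R Gs x y))"
  proof -
    have p: "((\<lambda>s. (\<xi> s, \<eta> s)) has_vector_derivative (y, - 2 *\<^sub>R Gs x y)) (at 0)"
      using has_vector_derivative_Pair[OF d\<xi>[OF J(3)] d\<eta>[OF J(3)]] by (simp add: 0)
    have a: "((\<lambda>s. dP (\<xi> s) (\<eta> s)) has_vector_derivative frechet_derivative (\<lambda>x. dP x y) (at x) y + dP x (- 2 *\<^sub>R Gs x y)) (at 0)"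
      using has_vector_derivative_compose_frechet[OF p, of "\<lambda>z. dP (fst z) (snd z)"]
        linear_family_has_derivative[of S x dP y, OF open_S x linear_dP smooth_dP] by (fastforce simp: 0)
    have b: "((\<lambda>s. P (\<xi> s)) has_vector_derivative dP x y) (at 0)"
      using has_vector_derivative_compose_frechet[OF d\<xi>[OF J(3)] P_has_derivative[OF S[OF J(3)]]] by (simp add: 0)
    have "((\<lambda>s. coord ?t (velocity M ?c s)) has_vector_derivative (dP x y, frechet_derivative (\<lambda>x. dP x y) (at x) y + dP x (- 2 *\<^sub>R Gs x y))) (at 0)"
      by (rule has_vector_derivative_transform_within_open[OF has_vector_derivative_Pair[OF b a] J(1,3)])
        (simp add: vel S_point(7)[OF S])
    from vector_derivative_at[OF this] show ?thesis
      unfolding velocity_comp[of ?t "tangent_bundle M" "velocity M ?c", OF tk vt] .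
  qed
  ultimately show ?thesis by (simp add: linear_cmul[OF linear_dP[OF x]] linear_neg[OF linear_dP[OF x]])
qed

text \<open>Polarisation of \<open>spray_relation\<close>: that equation holds at \<open>y + s *\<^sub>R v\<close> for all small \<open>s\<close>, and its derivative at \<open>s = 0\<close> is
  twice the claim because the second derivative of \<open>P\<close> is symmetric.\<close>

lemma connection_relation:
  assumes x: "x \<in> S" and y: "y \<in> Lspace x" "y \<noteq> 0" and v: "v \<in> Lspace x"
  shows "frechet_derivative (\<lambda>x. dP x y) (at x) v - dP x (spray_connection Mb Gb kb x y v)
    = - spray_connection M G k (P x) (dP x y) (dP x v)"
proof -
  let ?H = "\<lambda>a. frechet_derivative (\<lambda>x. dP x a) (at x)"
  let ?N = "spray_connection Mb Gb kb x y" and ?n = "spray_connection M G k (P x) (dP x y)"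
  let ?g = "spray_coeff M G k (P x)"
  note lin = linear_dP[OF x]
  have nz: "dP x y \<noteq> 0" using Lspace_kernel[OF x y(1)] y(2) by blast
  have Px: "P x \<in> coord k ` dom_of k" using S_point(3,7)[OF x] by (metis imageI)
  have GN: "(Gs x has_derivative ?N) (at y)"
  proof -
    have "smooth_on (- {0}) (Gs x)"
      using smooth_on_compose[OF _ _ smooth_on_Pair[OF _ smooth_on_const smooth_on_id] smooth_on_spray_coeff[OF Mb Gb kb], of "- {0}" x]
        smooth_atlas_open_chart[OF Mb kb] S_point(1)[OF x] by (simp add: open_Times open_Compl)
    then show ?thesis unfolding spray_connection_def using y(2) by (intro smooth_on_has_derivative) auto
  qed
  have gn: "(?g has_derivative ?n) (at (dP x y))"
  proof -
    have "smooth_on (- {0}) ?g"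
      using smooth_on_compose[OF _ _ smooth_on_Pair[OF _ smooth_on_const smooth_on_id] smooth_on_spray_coeff[OF M G k], of "- {0}" "P x"]
        smooth_atlas_open_chart[OF M k] Px by (simp add: open_Times open_Compl)
    then show ?thesis unfolding spray_connection_def using nz by (intro smooth_on_has_derivative) auto
  qed
  have Hlin: "linear (?H a)" for a by (rule has_derivative_linear[OF smooth_on_has_derivative[OF smooth_dP x]])
  have Hsym: "?H a b = ?H b a" for a b
    unfolding dP_def by (rule second_derivative_symmetric[OF open_S x smooth_P])
  have Hlin2: "linear (\<lambda>a. ?H a b)" for b unfolding Hsym[of _ b] by (rule Hlin)
  let ?l = "\<lambda>s::real. y + s *\<^sub>R v"
  have l: "(?l has_vector_derivative v) (at 0)" by (auto intro!: derivative_eq_intros simp: has_vector_derivative_def)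
  have f1: "((\<lambda>s. ?H y y + s *\<^sub>R (2 *\<^sub>R ?H y v) + s\<^sup>2 *\<^sub>R ?H v v - 2 *\<^sub>R dP x (Gs x (?l s)))
    has_vector_derivative 2 *\<^sub>R ?H y v - 2 *\<^sub>R dP x (?N v)) (at 0)"
  proof -
    have "((\<lambda>s. Gs x (?l s)) has_vector_derivative ?N v) (at 0)"
      by (rule has_vector_derivative_compose_frechet[OF l]) (simp add: GN)
    then have 1: "((\<lambda>s. dP x (Gs x (?l s))) has_vector_derivative dP x (?N v)) (at 0)"
      by (rule has_vector_derivative_compose_frechet[of _ _ _ "dP x" "dP x"])
        (use lin in \<open>simp add: linear_conv_bounded_linear bounded_linear_imp_has_derivative\<close>)
    have 2: "((\<lambda>s. ?H y y + s *\<^sub>R (2 *\<^sub>R ?H y v) + s\<^sup>2 *\<^sub>R ?H v v) has_vector_derivative 2 *\<^sub>R ?H y v) (at 0)"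
      unfolding has_vector_derivative_def by (auto intro!: derivative_eq_intros)
    have 3: "((\<lambda>s. 2 *\<^sub>R dP x (Gs x (?l s))) has_vector_derivative 2 *\<^sub>R dP x (?N v)) (at 0)"
      by (rule bounded_linear.has_vector_derivative[OF bounded_linear_scaleR_right 1])
    show ?thesis by (rule has_vector_derivative_diff[OF 2 3])
  qed
  have f2: "((\<lambda>s. - 2 *\<^sub>R ?g (dP x (?l s))) has_vector_derivative - 2 *\<^sub>R ?n (dP x v)) (at 0)"
  proof -
    have 1: "((\<lambda>s. dP x (?l s)) has_vector_derivative dP x v) (at 0)"
      by (rule has_vector_derivative_compose_frechet[OF l])
        (use lin in \<open>simp add: linear_conv_bounded_linear bounded_linear_imp_has_derivative\<close>)
    have "((\<lambda>s. ?g (dP x (?l s))) has_vector_derivative ?n (dP x v)) (at 0)"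
      by (rule has_vector_derivative_compose_frechet[OF 1]) (simp add: gn)
    then show ?thesis by (rule bounded_linear.has_vector_derivative[OF bounded_linear_scaleR_right])
  qed
  have f3: "\<forall>\<^sub>F s in nhds 0. ?H y y + s *\<^sub>R (2 *\<^sub>R ?H y v) + s\<^sup>2 *\<^sub>R ?H v v - 2 *\<^sub>R dP x (Gs x (?l s)) = - 2 *\<^sub>R ?g (dP x (?l s))"
  proof -
    have "isCont ?l 0" by (intro continuous_intros)
    then have "(?l \<longlongrightarrow> y) (nhds 0)" using tendsto_at_iff_tendsto_nhds[of ?l 0] by (simp add: isCont_def)
    from topological_tendstoD[OF this, of "- {0}"] have "\<forall>\<^sub>F s in nhds 0. ?l s \<noteq> 0" using y(2) by (simp add: open_Compl)
    then show ?thesis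
    proof eventually_elim
      case (elim s)
      have "?l s \<in> Lspace x"
        by (intro subspace_add subspace_scale subspace_Lspace x y v)
      from spray_relation[OF x this elim]
      have "?H (?l s) (?l s) - 2 *\<^sub>R dP x (Gs x (?l s)) = - 2 *\<^sub>R ?g (dP x (?l s))" .
      moreover have "?H (?l s) (?l s) = ?H y y + s *\<^sub>R (2 *\<^sub>R ?H y v) + s\<^sup>2 *\<^sub>R ?H v v"
        unfolding linear_add[OF Hlin] linear_cmul[OF Hlin] linear_add[OF Hlin2] linear_cmul[OF Hlin2] Hsym[of v y]
        by (simp add: power2_eq_square scaleR_2 scaleR_add_right)
      ultimately show ?case by simp
    qed
  qed
  note f4 = has_derivative_transform_eventually_nhds[OF f1[unfolded has_vector_derivative_def] f3, folded has_vector_derivative_def]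
  have "2 *\<^sub>R ?H y v - 2 *\<^sub>R dP x (?N v) = - 2 *\<^sub>R ?n (dP x v)"
    by (rule vector_derivative_unique_at[OF f4 f2])
  then have "2 *\<^sub>R (?H y v - dP x (?N v)) = 2 *\<^sub>R (- ?n (dP x v))" by (simp add: scaleR_diff_right)
  then show ?thesis by (simp only: scaleR_cancel_left) simp
qed

end

section \<open>The projected horizontal lift\<close>

context spray_submersion_charts
begin

abbreviation (input) tk where "tk \<equiv> tangent_chart M k"
abbreviation (input) \<Phi> where "\<Phi> \<equiv> distribution_projection Mb M \<pi> L"
abbreviation (input) F where "F \<equiv> tangent_map Mb M \<pi>"

lemma tk: "tk \<in> tangent_bundle M" by (rule tangent_chart_in_bundle[OF k])

lemma param_tb: "x \<in> S \<Longrightarrow> param tb (x, y) = vec x y"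
  unfolding vec_def by (rule tangent_chart_param[OF Mb kb S_point(1)])

lemma eventually_S: "x \<in> S \<Longrightarrow> \<forall>\<^sub>F z in nhds (coord tb (vec x y)). z \<in> S \<times> UNIV"
  unfolding vec_in_tangent_chart(2) using open_S by (intro eventually_nhds_in_open) (auto simp: open_Times)

lemma F_dom: "x \<in> S \<Longrightarrow> F (vec x y) \<in> dom_of tk"
  using tangent_map_\<pi>_in_tangent_space[of x y] S_point(3)[of x] by (simp add: tangent_chart_dom)

lemma projection_derivative:
  assumes x: "x \<in> S" and \<eta>: "\<eta> \<in> Lspace x"
  shows "mdifferentiable (tangent_bundle Mb) (tangent_bundle Mb) \<Phi> (vec x \<eta>)"
    and "mderiv tb tb \<Phi> (vec x \<eta>) = (\<lambda>h. (fst h, DQ x \<eta> (fst h) + Q x (snd h)))"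
proof -
  let ?D = "\<lambda>h. (fst h, DQ x \<eta> (fst h) + Q x (snd h))"
  have 1: "((\<lambda>z. (fst z, Q (fst z) (snd z))) has_derivative ?D) (at (x, \<eta>))"
    by (rule has_derivative_Pair[OF bounded_linear_imp_has_derivative[OF bounded_linear_fst]
        linear_family_has_derivative[OF open_S x linear_Q smooth_Q]])
  have "\<forall>\<^sub>F z in nhds (coord tb (vec x \<eta>)). (fst z, Q (fst z) (snd z)) = local_rep tb tb \<Phi> z"
    using eventually_S[OF x]
  proof (rule eventually_mono)
    fix z :: "'f \<times> 'f" assume "z \<in> S \<times> UNIV"
    then have z: "fst z \<in> S" by auto
    show "(fst z, Q (fst z) (snd z)) = local_rep tb tb \<Phi> z"
      using param_tb[OF z, of "snd z"] projection_vec[OF z, of "snd z"] vec_in_tangent_chart(2)[OF z] by (simp add: local_rep_def)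
  qed
  from has_derivative_transform_eventually_nhds[OF 1[folded vec_in_tangent_chart(2)[OF x, of \<eta>]] this]
  have D: "(local_rep tb tb \<Phi> has_derivative ?D) (at (coord tb (vec x \<eta>)))" .
  from frechet_derivative_at[OF D, symmetric] show "mderiv tb tb \<Phi> (vec x \<eta>) = ?D" .
  have "\<forall>\<^sub>F z in nhds (coord tb (vec x \<eta>)). \<Phi> (param tb z) \<in> dom_of tb"
    using eventually_S[OF x]
  proof (rule eventually_mono)
    fix z :: "'f \<times> 'f" assume "z \<in> S \<times> UNIV"
    then have z: "fst z \<in> S" by auto
    show "\<Phi> (param tb z) \<in> dom_of tb"
      using param_tb[OF z, of "snd z"] projection_vec[OF z, of "snd z"] vec_in_tangent_chart(1)[OF z] by simp
  qed
  then show "mdifferentiable (tangent_bundle Mb) (tangent_bundle Mb) \<Phi> (vec x \<eta>)"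
    by (intro mdifferentiableI[OF TMb TMb tb vec_in_tangent_chart(1)[OF x] tb _ D])
      (simp_all only: projection_vec[OF x] Q_fix[OF x \<eta>] vec_in_tangent_chart(1)[OF x])
qed

lemma F_mdifferentiable: "x \<in> S \<Longrightarrow> mdifferentiable (tangent_bundle Mb) (tangent_bundle M) F (vec x y)"
  by (rule mdifferentiable_tangent_map[OF Mb M smooth_\<pi> vec_in_tangent_space])

lemma F_derivative:
  assumes x: "x \<in> S"
  shows "mderiv tb tk F (vec x \<eta>) = (\<lambda>h. (dP x (fst h), frechet_derivative (\<lambda>x. dP x \<eta>) (at x) (fst h) + dP x (snd h)))"
proof -
  let ?D = "\<lambda>h. (dP x (fst h), frechet_derivative (\<lambda>x. dP x \<eta>) (at x) (fst h) + dP x (snd h))"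
  have "((\<lambda>z. P (fst z)) has_derivative (\<lambda>h. dP x (fst h))) (at (x, \<eta>))"
    using diff_chain_at[of fst fst "(x, \<eta>)" P "dP x"] P_has_derivative[OF x]
      bounded_linear_imp_has_derivative[OF bounded_linear_fst, of "at (x, \<eta>)"] by (simp add: o_def)
  then have 1: "((\<lambda>z. (P (fst z), dP (fst z) (snd z))) has_derivative ?D) (at (x, \<eta>))"
    by (rule has_derivative_Pair[OF _ linear_family_has_derivative[OF open_S x linear_dP smooth_dP]])
  have "\<forall>\<^sub>F z in nhds (coord tb (vec x \<eta>)). (P (fst z), dP (fst z) (snd z)) = local_rep tb tk F z"
    using eventually_S[OF x]
  proof (rule eventually_mono)
    fix z :: "'f \<times> 'f" assume "z \<in> S \<times> UNIV"
    then have z: "fst z \<in> S" by auto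
    show "(P (fst z), dP (fst z) (snd z)) = local_rep tb tk F z"
      using param_tb[OF z, of "snd z"] tangent_map_\<pi>_vec[OF z, of "snd z"] S_point(7)[OF z] by (simp add: local_rep_def)
  qed
  from has_derivative_transform_eventually_nhds[OF 1[folded vec_in_tangent_chart(2)[OF x, of \<eta>]] this]
  have D: "(local_rep tb tk F has_derivative ?D) (at (coord tb (vec x \<eta>)))" .
  from frechet_derivative_at[OF D, symmetric] show ?thesis .
qed

lemma F_projection: assumes x: "x \<in> S" shows "F (\<Phi> (vec x y)) = F (vec x y)"
  unfolding projection_vec[OF x]
  by (rule tangent_eqI[OF tangent_map_\<pi>_in_tangent_space[OF x] tangent_map_\<pi>_in_tangent_space[OF x] k S_point(3)[OF x]])
    (simp only: tangent_map_\<pi>_vec[OF x] dP_Q[OF x])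

text \<open>As \<open>F (\<Phi> u) = F u\<close> near \<open>vec x \<eta>\<close>, the projection may be dropped by the chain rule. The derivative of
  \<open>F\<close> at the horizontal vector \<open>(v, - Nb v)\<close> is \<open>(dP v, D\<^sup>2P(\<eta>, v) - dP (Nb v))\<close>, where \<open>Nb\<close> is the connection of
  \<open>Gb\<close> at \<open>\<eta>\<close>, and \<open>connection_relation\<close> identifies the second component.\<close>

lemma pushforward_projected_horizontal:
  assumes x: "x \<in> S" and \<eta>: "\<eta> \<in> Lspace x" "\<eta> \<noteq> 0" and v: "v \<in> Lspace x"
  defines "Hb \<equiv> coord_vector (tangent_bundle Mb) tb (vec x \<eta>) (v, - spray_connection Mb Gb kb x \<eta> v)"
  shows "tangent_map (tangent_bundle Mb) (tangent_bundle M) F (tangent_map (tangent_bundle Mb) (tangent_bundle Mb) \<Phi> Hb)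
    = coord_vector (tangent_bundle M) tk (F (vec x \<eta>)) (dP x v, - spray_connection M G k (P x) (dP x \<eta>) (dP x v))"
proof -
  have Hb: "Hb \<in> tangent_space (tangent_bundle Mb) (vec x \<eta>)"
    unfolding Hb_def by (rule coord_vector_in_tangent_space[OF TMb tb vec_in_tangent_chart(1)[OF x]])
  have Hbc: "comp_in Hb tb = (v, - spray_connection Mb Gb kb x \<eta> v)"
    unfolding Hb_def by (rule coord_vector_comp[OF TMb tb vec_in_tangent_chart(1)[OF x]])
  have \<Phi>y: "\<Phi> (vec x \<eta>) = vec x \<eta>" by (simp only: projection_vec[OF x] Q_fix[OF x \<eta>(1)])
  note d\<Phi> = projection_derivative(1)[OF x \<eta>(1)]
  note dF = F_mdifferentiable[OF x, of \<eta>]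
  have dF': "mdifferentiable (tangent_bundle Mb) (tangent_bundle M) F (\<Phi> (vec x \<eta>))" unfolding \<Phi>y by (rule dF)
  have "mdifferentiable (tangent_bundle Mb) (tangent_bundle M) (\<lambda>u. F (\<Phi> u)) (vec x \<eta>)"
    by (rule mdifferentiable_compose[OF TMb TMb d\<Phi> dF'])
  note dF\<Phi> = this
  have c: "tangent_map (tangent_bundle Mb) (tangent_bundle M) F (tangent_map (tangent_bundle Mb) (tangent_bundle Mb) \<Phi> Hb)
     = tangent_map (tangent_bundle Mb) (tangent_bundle M) (\<lambda>u. F (\<Phi> u)) Hb"
    by (rule tangent_map_compose[OF TMb TMb TM d\<Phi> dF' Hb])
  have F\<Phi>: "F (\<Phi> (vec x \<eta>)) \<in> dom_of tk" unfolding \<Phi>y by (rule F_dom[OF x])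
  have "\<forall>\<^sub>F z in nhds (coord tb (vec x \<eta>)). local_rep tb tk F z = local_rep tb tk (\<lambda>u. F (\<Phi> u)) z"
    using eventually_S[OF x]
  proof (rule eventually_mono)
    fix z :: "'f \<times> 'f" assume "z \<in> S \<times> UNIV"
    then have z: "fst z \<in> S" by auto
    show "local_rep tb tk F z = local_rep tb tk (\<lambda>u. F (\<Phi> u)) z"
      unfolding local_rep_def using param_tb[OF z, of "snd z"] F_projection[OF z, of "snd z"] by (simp only: prod.collapse)
  qed
  from mderiv_eq_of_eventually[OF this mdifferentiable_has_derivative[OF dF tb tk vec_in_tangent_chart(1)[OF x] F_dom[OF x]]]
  have m: "mderiv tb tk (\<lambda>u. F (\<Phi> u)) (vec x \<eta>) = mderiv tb tk F (vec x \<eta>)" .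
  have "comp_in (tangent_map (tangent_bundle Mb) (tangent_bundle M) (\<lambda>u. F (\<Phi> u)) Hb) tk
     = mderiv tb tk F (vec x \<eta>) (v, - spray_connection Mb Gb kb x \<eta> v)"
    unfolding tangent_map_comp[OF TMb dF\<Phi> Hb tb vec_in_tangent_chart(1)[OF x] tk F\<Phi>] m Hbc ..
  also have "\<dots> = (dP x v, - spray_connection M G k (P x) (dP x \<eta>) (dP x v))"
    unfolding F_derivative[OF x] using connection_relation[OF x \<eta> v] by (simp add: linear_neg[OF linear_dP[OF x]])
  finally have comp: "comp_in (tangent_map (tangent_bundle Mb) (tangent_bundle M) (\<lambda>u. F (\<Phi> u)) Hb) tk
     = (dP x v, - spray_connection M G k (P x) (dP x \<eta>) (dP x v))" .
  have ts: "tangent_map (tangent_bundle Mb) (tangent_bundle M) (\<lambda>u. F (\<Phi> u)) Hb \<in> tangent_space (tangent_bundle M) (F (vec x \<eta>))"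
    using tangent_map_in_tangent_space[OF TMb TM dF\<Phi> Hb] unfolding \<Phi>y .
  show ?thesis
    unfolding c
    by (rule tangent_eqI[OF ts coord_vector_in_tangent_space[OF TM tk F_dom[OF x]] tk F_dom[OF x]])
      (simp only: comp coord_vector_comp[OF TM tk F_dom[OF x]])
qed

text \<open>In coordinates the curve is \<open>s \<mapsto> (cb (t + s), Q (cb (t + s)) (\<eta> + s w))\<close>. It is the image under \<open>\<Phi>\<close> of a curve
  with velocity \<open>(v, w)\<close>; for \<open>w = - Nb v\<close> its velocity is the projected horizontal lift.\<close>

lemma curve_in_L:
  assumes cb: "smooth_curve Mb I cb" and t: "t \<in> I" and tkb: "cb t \<in> dom_of kb" and tkk: "\<pi> (cb t) \<in> dom_of k"
    and \<eta>: "\<eta> \<in> Lspace (coord kb (cb t))" "\<eta> \<noteq> 0"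
  defines "x \<equiv> coord kb (cb t)" and "v \<equiv> comp_in (velocity Mb cb t) kb"
  obtains \<sigma> where "\<sigma> 0 = vec x \<eta>"
    "\<forall>\<^sub>F s in nhds 0. t + s \<in> I \<and> \<sigma> s \<in> fiber L (cb (t + s)) \<inter> nonzero_vectors \<and> \<sigma> s \<in> dom_of tb"
    "((\<lambda>s. coord tb (\<sigma> s)) has_vector_derivative (v, DQ x \<eta> v + Q x w)) (at 0)"
proof -
  have x: "x \<in> S" unfolding x_def by (rule coord_in_S[OF tkb tkk])
  have \<eta>x: "\<eta> \<in> Lspace x" unfolding x_def by (rule \<eta>(1))
  define \<xi> where "\<xi> = (\<lambda>s. coord kb (cb (t + s)))"
  have \<xi>0: "\<xi> 0 = x" by (simp add: \<xi>_def x_def)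
  have \<xi>: "(\<xi> has_vector_derivative v) (at 0)"
  proof -
    have "((\<lambda>s. t + s) has_vector_derivative 1) (at 0)" by (auto intro!: derivative_eq_intros)
    moreover have "((\<lambda>s. coord kb (cb s)) has_vector_derivative v) (at (t + 0))"
      using smooth_curve_has_vector_derivative[OF Mb cb kb t tkb] by (simp add: v_def)
    ultimately show ?thesis
      using vector_diff_chain_at[of "\<lambda>s. t + s" 1 0 "\<lambda>s. coord kb (cb s)" v] by (simp add: \<xi>_def o_def)
  qed
  define \<theta> where "\<theta> = (\<lambda>s. \<eta> + s *\<^sub>R w)"
  have \<theta>: "(\<theta> has_vector_derivative w) (at 0)"
    unfolding \<theta>_def has_vector_derivative_def by (auto intro!: derivative_eq_intros)
  define \<sigma> where "\<sigma> = (\<lambda>s. vec (\<xi> s) (Q (\<xi> s) (\<theta> s)))"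
  have p: "((\<lambda>s. (\<xi> s, \<theta> s)) has_vector_derivative (v, w)) (at 0)" by (rule has_vector_derivative_Pair[OF \<xi> \<theta>])
  have q: "((\<lambda>s. Q (\<xi> s) (\<theta> s)) has_vector_derivative DQ x \<eta> v + Q x w) (at 0)"
    using has_vector_derivative_compose_frechet[OF p, of "\<lambda>z. Q (fst z) (snd z)"]
      linear_family_has_derivative[of S x Q \<eta>, OF open_S x linear_Q smooth_Q] by (fastforce simp: \<xi>0 \<theta>_def)
  have ev: "\<forall>\<^sub>F s in nhds 0. t + s \<in> I \<and> cb (t + s) \<in> dom_of kb"
  proof -
    have "((\<lambda>s. t + s) \<longlongrightarrow> t) (nhds 0)" by (auto intro!: tendsto_eq_intros filterlim_ident)
    from eventually_compose_filterlim[OF smooth_curve_eventually[OF Mb cb kb t tkb] this] show ?thesis .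
  qed
  have tend: "(f \<longlongrightarrow> f 0) (nhds 0)" if "(f has_vector_derivative f') (at 0)" for f :: "real \<Rightarrow> 'f" and f'
    using has_vector_derivative_continuous[OF that] tendsto_at_iff_tendsto_nhds[of f 0] by (simp add: isCont_def)
  have evS: "\<forall>\<^sub>F s in nhds 0. \<xi> s \<in> S"
    using topological_tendstoD[OF tend[OF \<xi>] open_S] x by (simp add: \<xi>0)
  have evq: "\<forall>\<^sub>F s in nhds 0. Q (\<xi> s) (\<theta> s) \<noteq> 0"
    using topological_tendstoD[OF tend[OF q], of "- {0}"] \<eta>(2) Q_fix[OF x \<eta>x] by (simp add: \<xi>0 \<theta>_def open_Compl)
  show ?thesis
  proof (rule that[of \<sigma>])
    show "\<sigma> 0 = vec x \<eta>" by (simp add: \<sigma>_def \<xi>0 \<theta>_def Q_fix[OF x \<eta>x])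
    show "\<forall>\<^sub>F s in nhds 0. t + s \<in> I \<and> \<sigma> s \<in> fiber L (cb (t + s)) \<inter> nonzero_vectors \<and> \<sigma> s \<in> dom_of tb"
      using ev evS evq
    proof eventually_elim
      case (elim s)
      have pk: "param kb (\<xi> s) = cb (t + s)" using elim(1) by (simp add: \<xi>_def param_coord[OF Mb kb])
      have "\<sigma> s \<in> L" using Q_Lspace[OF elim(2)] by (simp add: \<sigma>_def Lspace_def)
      moreover have "\<sigma> s \<in> nonzero_vectors" unfolding \<sigma>_def vec_nonzero[OF elim(2)] by (rule elim(3))
      moreover have "\<sigma> s \<in> dom_of tb" unfolding \<sigma>_def by (rule vec_in_tangent_chart(1)[OF elim(2)])
      moreover have "base (\<sigma> s) = cb (t + s)" by (simp add: \<sigma>_def pk)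
      ultimately show ?case using elim(1) by blast
    qed
    have "\<forall>\<^sub>F s in nhds 0. (\<xi> s, Q (\<xi> s) (\<theta> s)) = coord tb (\<sigma> s)"
      using evS by (rule eventually_mono) (simp only: \<sigma>_def vec_in_tangent_chart(2))
    from has_derivative_transform_eventually_nhds[OF has_vector_derivative_Pair[OF \<xi> q, unfolded has_vector_derivative_def] this]
    show "((\<lambda>s. coord tb (\<sigma> s)) has_vector_derivative (v, DQ x \<eta> v + Q x w)) (at 0)"
      unfolding has_vector_derivative_def .
  qed
qed

lemma velocity_push:
  assumes cb: "smooth_curve Mb I cb" and t: "t \<in> I" and tkb: "cb t \<in> dom_of kb" and tkk: "\<pi> (cb t) \<in> dom_of k"
    and c: "\<And>s. s \<in> I \<Longrightarrow> \<pi> (cb s) = c s"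
  shows "comp_in (velocity M c t) k = dP (coord kb (cb t)) (comp_in (velocity Mb cb t) kb)"
proof -
  have I: "open I" using cb by (simp add: smooth_curve_def)
  have x: "coord kb (cb t) \<in> S" by (rule coord_in_S[OF tkb tkk])
  have "\<forall>\<^sub>F s in nhds t. cb s \<in> dom_of kb"
    using smooth_curve_eventually[OF Mb cb kb t tkb] by (rule eventually_mono) simp
  from curve_chain[OF Mb kb tkb smooth_curve_has_vector_derivative[OF Mb cb kb t tkb] this P_has_derivative[OF x, unfolded P_def]]
  have "((\<lambda>s. coord k (\<pi> (cb s))) has_vector_derivative dP (coord kb (cb t)) (comp_in (velocity Mb cb t) kb)) (at t)" .
  then have "((\<lambda>s. coord k (c s)) has_vector_derivative dP (coord kb (cb t)) (comp_in (velocity Mb cb t) kb)) (at t)"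
    by (rule has_vector_derivative_transform_within_open[OF _ I t]) (simp add: c)
  from vector_derivative_at[OF this] show ?thesis
    using velocity_comp[of k M c t, OF k] tkk c[OF t] by simp
qed

end

section \<open>Horizontal lifts along a lifted curve\<close>

text \<open>Continuity in the topology of the ambient manifold passes to \<open>NL\<close>, because the topologies of \<open>NL\<close> and \<open>Nb\<close> are
  subspace topologies.\<close>

lemma eventually_in_embedded:
  assumes N: "points NL \<subseteq> points Nb" "points Nb \<subseteq> points A"
    and topNL: "atlas_topology NL = subtopology (atlas_topology Nb) (points NL)"
    and topNb: "atlas_topology Nb = subtopology (atlas_topology A) (points Nb)"
    and A: "smooth_atlas A" and d: "d \<in> A" "\<sigma> 0 \<in> dom_of d"
    and ev: "\<forall>\<^sub>F s in nhds (0::real). \<sigma> s \<in> points NL \<and> \<sigma> s \<in> dom_of d"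
    and cont: "isCont (\<lambda>s. coord d (\<sigma> s)) 0"
    and U: "openin (atlas_topology NL) U" "\<sigma> 0 \<in> U"
  shows "\<forall>\<^sub>F s in nhds 0. \<sigma> s \<in> U"
proof -
  obtain U1 where U1: "openin (atlas_topology Nb) U1" "U = U1 \<inter> points NL"
    using U(1) unfolding topNL openin_subtopology by blast
  obtain U2 where U2: "openin (atlas_topology A) U2" "U1 = U2 \<inter> points Nb"
    using U1(1) unfolding topNb openin_subtopology by blast
  have evd: "\<forall>\<^sub>F s in nhds 0. \<sigma> s \<in> dom_of d" using ev by (rule eventually_mono) simp
  have "\<sigma> 0 \<in> U2" using U(2) U1(2) U2(2) by simp
  from eventually_in_openin_of_chart[where \<sigma>=\<sigma> and t=0, OF A U2(1) this d evd cont]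
  show ?thesis using ev by eventually_elim (use U1(2) U2(2) N in auto)
qed

theorem lemma3p6:
  fixes M :: "('a, 'e::euclidean_space) atlas"
    and Mb :: "('b, 'f::euclidean_space) atlas"
    and G :: "('a, 'e) tangent \<Rightarrow> (('a, 'e) tangent, 'e \<times> 'e) tangent"
    and Gb :: "('b, 'f) tangent \<Rightarrow> (('b, 'f) tangent, 'f \<times> 'f) tangent"
    and \<pi> :: "'b \<Rightarrow> 'a"
    and L :: "('b, 'f) tangent set"
    and I :: "real set"
    and c :: "real \<Rightarrow> 'a"
    and cb :: "real \<Rightarrow> 'b"
    and N :: "(('a, 'e) tangent, real \<times> 'e) atlas"
    and Nb :: "(('b, 'f) tangent, real \<times> 'f) atlas"
    and NL :: "(('b, 'f) tangent, real \<times> 'e) atlas"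
  assumes "spray_submersion Mb Gb M G \<pi> L"
    and "smooth_curve M I c"
    and "\<forall>t\<in>I. velocity M c t \<in> nonzero_vectors"
    and "is_lifting_tangent_to Mb \<pi> L I c cb"
    and "points N = (\<Union>t\<in>I. tangent_space M (c t) \<inter> nonzero_vectors)"
    and "points Nb = (\<Union>t\<in>I. tangent_space Mb (cb t) \<inter> nonzero_vectors)"
    and "points NL = (\<Union>t\<in>I. fiber L (cb t) \<inter> nonzero_vectors)"
    and "embedded_submanifold N (slit_bundle M)"
    and "embedded_submanifold Nb (slit_bundle Mb)"
    and "embedded_submanifold NL Nb"
    and "diffeomorphism NL N (tangent_map Mb M \<pi>)"
  shows "\<forall>t\<in>I. \<forall>y \<in> fiber L (cb t) \<inter> nonzero_vectors.
    \<exists>w \<in> tangent_space N (tangent_map Mb M \<pi> y).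
      tangent_map N (tangent_bundle M) (\<lambda>u. u) w
        = horizontal_lift M G (velocity M c t) (tangent_map Mb M \<pi> y) \<and>
      tangent_map (tangent_bundle Mb) (tangent_bundle Mb) (distribution_projection Mb M \<pi> L)
          (horizontal_lift Mb Gb (velocity Mb cb t) y)
        = tangent_map NL (tangent_bundle Mb) (\<lambda>u. u)
            (tangent_map N NL (inv_into (points NL) (tangent_map Mb M \<pi>)) w)"
proof (intro ballI)
  fix t y assume t: "t \<in> I" and y: "y \<in> fiber L (cb t) \<inter> nonzero_vectors"
  have man: "manifold Mb" "manifold M" "spray Mb Gb" "spray M G" "submersion Mb M \<pi>" "distribution Mb L"
      "complements_vertical Mb M \<pi> L"
    and tan: "\<forall>u \<in> L \<inter> nonzero_vectors. Gb u \<in> subset_tangent_space (tangent_bundle Mb) (L \<inter> nonzero_vectors) u"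
    and geo: "\<forall>I cb. geodesic Mb Gb I cb \<and> (\<forall>t\<in>I. velocity Mb cb t \<in> L \<inter> nonzero_vectors) \<longrightarrow> geodesic M G I (\<lambda>t. \<pi> (cb t))"
    using assms(1) unfolding spray_submersion_def by simp_all
  have Mb: "smooth_atlas Mb" and M: "smooth_atlas M" using man by (auto simp: manifold_def)
  have cb: "smooth_curve Mb I cb" and lift: "\<And>s. s \<in> I \<Longrightarrow> \<pi> (cb s) = c s" "velocity Mb cb t \<in> L"
    using assms(4) t unfolding is_lifting_tangent_to_def by simp_all
  let ?F = "tangent_map Mb M \<pi>" and ?\<Phi> = "distribution_projection Mb M \<pi> L"
  \<comment> \<open>These are the charts that the definition of \<open>horizontal_lift\<close> selects.\<close>
  define kb where "kb = chart_at Mb (cb t)"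
  define k where "k = chart_at M (c t)"
  have kbd: "kb \<in> Mb" "cb t \<in> dom_of kb" unfolding kb_def using chart_at[OF smooth_curve_in_points[OF cb t]] by auto
  have kd: "k \<in> M" "c t \<in> dom_of k" unfolding k_def using chart_at[OF smooth_curve_in_points[OF assms(2) t]] by auto
  have k': "\<pi> (cb t) \<in> dom_of k" using kd(2) lift(1)[OF t] by simp
  interpret spray_submersion_charts Mb M \<pi> L kb k G Gb
  proof unfold_locales
    show "Gb u \<in> subset_tangent_space (tangent_bundle Mb) (L \<inter> nonzero_vectors) u" if "u \<in> L" "u \<in> nonzero_vectors" for u
      using tan that by blast
    show "geodesic M G I (\<lambda>t. \<pi> (cb t))" if "geodesic Mb Gb I cb" "\<forall>t\<in>I. velocity Mb cb t \<in> L \<inter> nonzero_vectors" for I cb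
      using geo that by blast
  qed (use Mb M man kbd kd in auto)
  let ?TMb = "tangent_bundle Mb" and ?TM = "tangent_bundle M"
  let ?tb = "tangent_chart Mb kb" and ?tk = "tangent_chart M k"
  define x where "x = coord kb (cb t)"
  define \<eta> where "\<eta> = comp_in y kb"
  define v where "v = comp_in (velocity Mb cb t) kb"
  have x: "x \<in> S" unfolding x_def by (rule coord_in_S[OF kbd(2) k'])
  have px: "param kb x = cb t" unfolding x_def by (rule param_coord[OF Mb kbd])
  have yL: "y \<in> L" "base y = cb t" "y \<in> nonzero_vectors" using y by auto
  have yv: "vec x \<eta> = y"
    unfolding x_def \<eta>_def by (rule vec_coord[OF kbd(2)]) (use L_in_tangent_space[OF yL(1)] yL(2) in simp)
  have "\<eta> \<in> Lspace x" unfolding Lspace_def mem_Collect_eq yv by (rule yL(1))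
  moreover have "\<eta> \<noteq> 0" using vec_nonzero[OF x, of \<eta>] yL(3) unfolding yv by blast
  ultimately have \<eta>: "\<eta> \<in> Lspace x" "\<eta> \<noteq> 0" .
  have vv: "vec x v = velocity Mb cb t"
    unfolding x_def v_def by (rule vec_coord[OF kbd(2) velocity_in_tangent_space[OF Mb cb t]])
  have v: "v \<in> Lspace x" unfolding Lspace_def mem_Collect_eq vv by (rule lift(2))
  have Px: "coord k (c t) = P x" using S_point(7)[OF x] unfolding px lift(1)[OF t] .
  define Hb where "Hb = horizontal_lift Mb Gb (velocity Mb cb t) y"
  have Hb: "Hb = coord_vector ?TMb ?tb (vec x \<eta>) (v, - spray_connection Mb Gb kb x \<eta> v)"
    unfolding Hb_def horizontal_lift_def Let_def yL(2) kb_def[symmetric] yv x_def[symmetric] \<eta>_def[symmetric] v_def[symmetric] ..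
  have bF: "base (?F y) = c t" using lift(1)[OF t] yL(2) by simp
  have Fk: "comp_in (?F y) k = dP x \<eta>" using tangent_map_\<pi>_vec[OF x, of \<eta>] unfolding yv .
  have vk: "comp_in (velocity M c t) k = dP x v"
    unfolding x_def v_def by (rule velocity_push[OF cb t kbd(2) k' lift(1)])
  have H: "horizontal_lift M G (velocity M c t) (?F y)
      = coord_vector ?TM ?tk (?F (vec x \<eta>)) (dP x v, - spray_connection M G k (P x) (dP x \<eta>) (dP x v))"
    unfolding horizontal_lift_def Let_def bF k_def[symmetric] Fk vk Px yv ..
  have push: "tangent_map ?TMb ?TM ?F (tangent_map ?TMb ?TMb ?\<Phi> Hb) = horizontal_lift M G (velocity M c t) (?F y)"
    unfolding H Hb by (rule pushforward_projected_horizontal[OF x \<eta> v])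
  have yd: "y \<in> dom_of ?tb" using vec_in_tangent_chart(1)[OF x, of \<eta>] unfolding yv .
  have Hbts: "Hb \<in> tangent_space ?TMb y" unfolding Hb yv by (rule coord_vector_in_tangent_space[OF TMb tb yd])
  have \<Phi>y: "?\<Phi> y = y" using projection_vec[OF x, of \<eta>] unfolding Q_fix[OF x \<eta>(1)] yv .
  have \<Phi>d: "mdifferentiable ?TMb ?TMb ?\<Phi> y" using projection_derivative(1)[OF x \<eta>(1)] unfolding yv .
  define Z where "Z = tangent_map ?TMb ?TMb ?\<Phi> Hb"
  have Zts: "Z \<in> tangent_space ?TMb y" unfolding Z_def using tangent_map_in_tangent_space[OF TMb TMb \<Phi>d Hbts] unfolding \<Phi>y .
  define w0 where "w0 = - spray_connection Mb Gb kb x \<eta> v"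
  have \<Phi>yd: "?\<Phi> y \<in> dom_of ?tb" unfolding \<Phi>y by (rule yd)
  have Zc: "comp_in Z ?tb = (v, DQ x \<eta> v + Q x w0)"
  proof -
    have "comp_in Z ?tb = mderiv ?tb ?tb ?\<Phi> y (comp_in Hb ?tb)"
      unfolding Z_def by (rule tangent_map_comp[OF TMb \<Phi>d Hbts tb yd tb \<Phi>yd])
    also have "comp_in Hb ?tb = (v, w0)" unfolding Hb w0_def by (rule coord_vector_comp[OF TMb tb vec_in_tangent_chart(1)[OF x]])
    finally show ?thesis using projection_derivative(2)[OF x \<eta>(1)] unfolding yv by simp
  qed
  have NL: "smooth_atlas NL" "points NL \<subseteq> points Nb" "smooth_map NL Nb (\<lambda>p. p)"
      "\<forall>p\<in>points NL. inj_on (tangent_map NL Nb (\<lambda>p. p)) (tangent_space NL p)"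
      "atlas_topology NL = subtopology (atlas_topology Nb) (points NL)"
    using assms(10) unfolding embedded_submanifold_def manifold_def by simp_all
  have Nb: "smooth_atlas Nb" "points Nb \<subseteq> points (slit_bundle Mb)" "smooth_map Nb (slit_bundle Mb) (\<lambda>p. p)"
      "\<forall>p\<in>points Nb. inj_on (tangent_map Nb (slit_bundle Mb) (\<lambda>p. p)) (tangent_space Nb p)"
      "atlas_topology Nb = subtopology (atlas_topology (slit_bundle Mb)) (points Nb)"
    using assms(9) unfolding embedded_submanifold_def manifold_def by simp_all
  have N: "smooth_atlas N" "smooth_map N (slit_bundle M) (\<lambda>p. p)"
    using assms(8) unfolding embedded_submanifold_def manifold_def by simp_all
  have F: "bij_betw ?F (points NL) (points N)" "smooth_map NL N ?F" "smooth_map N NL (inv_into (points NL) ?F)"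
    using assms(11) unfolding diffeomorphism_def by simp_all
  note SMb = smooth_atlas_slit_bundle[OF Mb] and SM = smooth_atlas_slit_bundle[OF M]
  have yNL: "y \<in> points NL" unfolding assms(7) using t y by blast
  have yNb: "y \<in> points Nb" using yNL NL(2) by blast
  have FyN: "?F y \<in> points N" by (rule smooth_map_in_points[OF F(2) yNL])
  note d1 = smooth_map_imp_mdifferentiable[OF NL(1) Nb(1) NL(3) yNL]
  note d2 = smooth_map_imp_mdifferentiable[OF Nb(1) SMb Nb(3) yNb]
  have iS: "mdifferentiable NL (slit_bundle Mb) (\<lambda>p. p) y" by (rule mdifferentiable_compose[OF NL(1) Nb(1) d1 d2])
  have iT: "mdifferentiable NL ?TMb (\<lambda>p. p) y"
    using iS unfolding slit_bundle_def by (rule mdifferentiable_open_submanifold_target)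
  have inj: "inj_on (tangent_map NL (slit_bundle Mb) (\<lambda>p. p)) (tangent_space NL y)"
  proof (rule inj_onI)
    fix a b assume a: "a \<in> tangent_space NL y" and b: "b \<in> tangent_space NL y"
      and eq: "tangent_map NL (slit_bundle Mb) (\<lambda>p. p) a = tangent_map NL (slit_bundle Mb) (\<lambda>p. p) b"
    have "tangent_map Nb (slit_bundle Mb) (\<lambda>p. p) (tangent_map NL Nb (\<lambda>p. p) a)
        = tangent_map Nb (slit_bundle Mb) (\<lambda>p. p) (tangent_map NL Nb (\<lambda>p. p) b)"
      unfolding tangent_map_compose[OF NL(1) Nb(1) SMb d1 d2 a] tangent_map_compose[OF NL(1) Nb(1) SMb d1 d2 b] by (rule eq)
    then have "tangent_map NL Nb (\<lambda>p. p) a = tangent_map NL Nb (\<lambda>p. p) b"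
      by (rule inj_onD[OF bspec[OF Nb(4) yNb] _ tangent_map_in_tangent_space[OF NL(1) Nb(1) d1 a]
            tangent_map_in_tangent_space[OF NL(1) Nb(1) d1 b]])
    then show "a = b" by (rule inj_onD[OF bspec[OF NL(4) yNL] _ a b])
  qed
  obtain \<sigma> where \<sigma>0': "\<sigma> 0 = vec x \<eta>"
    and \<sigma>: "\<forall>\<^sub>F s in nhds 0. t + s \<in> I \<and> \<sigma> s \<in> fiber L (cb (t + s)) \<inter> nonzero_vectors \<and> \<sigma> s \<in> dom_of ?tb"
    and \<sigma>': "((\<lambda>s. coord ?tb (\<sigma> s)) has_vector_derivative (v, DQ x \<eta> v + Q x w0)) (at 0)"
    by (rule curve_in_L[OF cb t kbd(2) k' \<eta>(1)[unfolded x_def] \<eta>(2), of w0, folded x_def v_def])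
  note \<sigma>0 = \<sigma>0'[unfolded yv]
  \<comment> \<open>\<open>NL\<close> is embedded in the slit bundle, whose charts are restrictions of the natural ones; \<open>?d\<close> is the
    restriction of \<open>?tb\<close>.\<close>
  let ?d = "(dom_of ?tb \<inter> nonzero_vectors, coord ?tb)"
  have d: "?d \<in> slit_bundle Mb" using tb by (simp add: slit_bundle_def open_submanifold_def)
  have yd': "\<sigma> 0 \<in> dom_of ?d" using yd yL(3) by (simp add: \<sigma>0)
  have ev: "\<forall>\<^sub>F s in nhds 0. \<sigma> s \<in> points NL \<and> \<sigma> s \<in> dom_of ?d"
    using \<sigma> by (rule eventually_mono) (auto simp: assms(7))
  have \<sigma>'': "((\<lambda>s. coord ?d (\<sigma> s)) has_vector_derivative (v, DQ x \<eta> v + Q x w0)) (at 0)" using \<sigma>' by simp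
  have "\<exists>\<zeta>\<in>tangent_space NL (\<sigma> 0). comp_in (tangent_map NL (slit_bundle Mb) (\<lambda>q. q) \<zeta>) ?d = (v, DQ x \<eta> v + Q x w0)"
  proof (rule velocity_tangent_to_embedded[OF NL(1) SMb])
    show "\<sigma> 0 \<in> points NL" "mdifferentiable NL (slit_bundle Mb) (\<lambda>q. q) (\<sigma> 0)"
      "inj_on (tangent_map NL (slit_bundle Mb) (\<lambda>q. q)) (tangent_space NL (\<sigma> 0))"
      unfolding \<sigma>0 by (rule yNL iS inj)+
    show "\<forall>\<^sub>F s in nhds 0. \<sigma> s \<in> U" if "openin (atlas_topology NL) U" "\<sigma> 0 \<in> U" for U
      by (rule eventually_in_embedded[OF NL(2) Nb(2) NL(5) Nb(5) SMb d yd' ev has_vector_derivative_continuous[OF \<sigma>''] that])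
  qed (rule d yd' \<sigma>'')+
  then obtain \<zeta> where \<zeta>: "\<zeta> \<in> tangent_space NL y"
    and \<zeta>c: "comp_in (tangent_map NL (slit_bundle Mb) (\<lambda>q. q) \<zeta>) ?d = (v, DQ x \<eta> v + Q x w0)"
    unfolding \<sigma>0 by blast
  have \<zeta>Z: "tangent_map NL ?TMb (\<lambda>q. q) \<zeta> = Z"
  proof (rule tangent_eqI[OF tangent_map_in_tangent_space[OF NL(1) TMb iT \<zeta>] Zts tb yd])
    obtain e where e: "e \<in> NL" "y \<in> dom_of e" using yNL by (auto simp: points_def)
    have "comp_in (tangent_map NL ?TMb (\<lambda>q. q) \<zeta>) ?tb = mderiv e ?tb (\<lambda>q. q) y (comp_in \<zeta> e)"
      by (rule tangent_map_comp[OF NL(1) iT \<zeta> e tb yd])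
    also have "local_rep e ?tb (\<lambda>q. q) = local_rep e ?d (\<lambda>q. q)" by (simp add: local_rep_def)
    also have "mderiv e ?d (\<lambda>q. q) y (comp_in \<zeta> e) = comp_in (tangent_map NL (slit_bundle Mb) (\<lambda>q. q) \<zeta>) ?d"
      using tangent_map_comp[OF NL(1) iS \<zeta> e d] yd' unfolding \<sigma>0 by simp
    finally show "comp_in (tangent_map NL ?TMb (\<lambda>q. q) \<zeta>) ?tb = comp_in Z ?tb" unfolding \<zeta>c Zc .
  qed
  note dF = smooth_map_imp_mdifferentiable[OF NL(1) N(1) F(2) yNL]
  note dFi = smooth_map_imp_mdifferentiable[OF N(1) NL(1) F(3) FyN]
  have dN: "mdifferentiable N ?TM (\<lambda>p. p) (?F y)"
    using smooth_map_imp_mdifferentiable[OF N(1) SM N(2) FyN] unfolding slit_bundle_def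
    by (rule mdifferentiable_open_submanifold_target)
  \<comment> \<open>On \<open>NL\<close> the map \<open>?F\<close> factors through \<open>N\<close> and through the tangent bundle of \<open>Mb\<close>; comparing the two
    factorisations at \<open>\<zeta>\<close> gives the first equation.\<close>
  define w where "w = tangent_map NL N ?F \<zeta>"
  have w: "w \<in> tangent_space N (?F y)" unfolding w_def by (rule tangent_map_in_tangent_space[OF NL(1) N(1) dF \<zeta>])
  have dFT: "mdifferentiable ?TMb ?TM ?F y" using F_mdifferentiable[OF x, of \<eta>] unfolding yv .
  have "tangent_map N ?TM (\<lambda>u. u) w = tangent_map NL ?TM ?F \<zeta>"
    unfolding w_def by (rule tangent_map_compose[OF NL(1) N(1) TM dF dN \<zeta>])
  also have "\<dots> = tangent_map ?TMb ?TM ?F (tangent_map NL ?TMb (\<lambda>q. q) \<zeta>)"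
    by (rule tangent_map_compose[OF NL(1) TMb TM iT dFT \<zeta>, symmetric])
  also have "\<dots> = horizontal_lift M G (velocity M c t) (?F y)" unfolding \<zeta>Z Z_def by (rule push)
  finally have 1: "tangent_map N ?TM (\<lambda>u. u) w = horizontal_lift M G (velocity M c t) (?F y)" .
  have "tangent_map N NL (inv_into (points NL) ?F) w = tangent_map NL NL (\<lambda>q. inv_into (points NL) ?F (?F q)) \<zeta>"
    unfolding w_def by (rule tangent_map_compose[OF NL(1) N(1) NL(1) dF dFi \<zeta>])
  also have "\<dots> = tangent_map NL NL (\<lambda>q. q) \<zeta>"
    by (rule tangent_map_cong[OF NL(1) mdifferentiable_transition[OF NL(1) yNL] \<zeta>, symmetric])
      (simp add: inv_into_f_f[OF bij_betw_imp_inj_on[OF F(1)]])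
  also have "\<dots> = \<zeta>" by (rule tangent_map_ident[OF NL(1) \<zeta>])
  finally have "tangent_map NL ?TMb (\<lambda>u. u) (tangent_map N NL (inv_into (points NL) ?F) w) = Z" using \<zeta>Z by simp
  with w 1 show "\<exists>w \<in> tangent_space N (?F y).
      tangent_map N ?TM (\<lambda>u. u) w = horizontal_lift M G (velocity M c t) (?F y) \<and>
      tangent_map ?TMb ?TMb ?\<Phi> (horizontal_lift Mb Gb (velocity Mb cb t) y)
        = tangent_map NL ?TMb (\<lambda>u. u) (tangent_map N NL (inv_into (points NL) ?F) w)"
    unfolding Hb_def[symmetric] Z_def[symmetric] by (intro bexI[of _ w]) auto
qed

end
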